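(* Let $C$ be a commutative ring with identity, $\lambda\in C$, and let $A$ be a $C$-algebra with identity. 1. The operator $\bar P$ on $\prod_{k\in\mathbb N}\mathrm{Sh}^k_C(A)$ given by $\bar P((x_k)_k)=(1_A\otimes x_{k-1})_k$ (with $1_A\otimes x_{k-1}=0$ for $k=0$) is a Baxter operator of weight $\lambda$ on the $C$-algebra $\prod_{k\in\mathbb N}\mathrm{Sh}_C^k(A)$, and $$\psi_A:\widehat{\mathrm{Sh}}_C(A)\to\prod_{k\in\mathbb N}\mathrm{Sh}_C^k(A)$$ is an isomorphism of Baxter $C$-algebras. 2. Given a homomorphism $f:A\to B$ of unital $C$-algebras, the diagram in the category $\mathbf{Bax}_C$ of unital Baxter $C$-algebras of weight $\lambda$ with horizontal maps $\psi_A$ and $\psi_B$, left vertical map $\widehat{\mathrm{Sh}}_C(f):\widehat{\mathrm{Sh}}_C(A)\to\widehat{\mathrm{Sh}}_C(B)$ and right vertical map $\prod_kf_k:\prod_k\mathrm{Sh}^k_C(A)\to\prod_k\mathrm{Sh}^k_C(B)$ commutes, i.e. $\big(\prod_kf_k\big)\circ\psi_A=\psi_B\circ\widehat{\mathrm{Sh}}_C(f)$. Here $\widehat{\mathrm{Sh}}_C(f)$ is induced by the Baxter homomorphism $\mathrm{Sh}_C(f):\mathrm{Sh}_C(A)\to \mathrm{Sh}_C(B)$, which is in turn induced by $f$, and $f_k=f^{\otimes(k+1)}:A^{\otimes(k+1)}\to B^{\otimes(k+1)}$.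
   Context: All rings and algebras are associative, commutative, with identity; $\otimes=\otimes_C$; $\mathbb N=\{0,1,2,\dots\}$, $\mathbb N_+=\mathbb N\setminus\{0\}$. A Baxter $C$-algebra (of weight $\lambda$) is a pair $(R,P)$ with $R$ a $C$-algebra and $P:R\to R$ a Baxter operator of weight $\lambda$, i.e. a $C$-linear map satisfying $P(x)P(y)=P(xP(y))+P(yP(x))+\lambda P(xy)$. A homomorphism $f:(R,P)\to(S,Q)$ is a $C$-algebra homomorphism with $f\circ P=Q\circ f$. A Baxter ideal is an ideal $I$ with $P(I)\subseteq I$; $\langle U\rangle_B$ is the Baxter ideal generated by $U$. Baxter filtration: $\mathrm{Fil}^0R=R$, $\mathrm{Fil}^{n+1}R=\langle P(\mathrm{Fil}^nR)\rangle_B$. It is a decreasing filtration by Baxter ideals. The completion is $\widehat R=\varprojlim R/\mathrm{Fil}^nR$ with the induced operator $\widehat P$. Shuffle Baxter algebra. For $m,n\ge1$ let $S(m,n)$ be the set of $\sigma\in S_{m+n}$ with $\sigma^{-1}(1)<\dots<\sigma^{-1}(m)$ and $\sigma^{-1}(m+1)<\dots<\sigma^{-1}(m+n)$. A pair $(k,k+1)$, $1\le k<m+n$, is admissible for $\sigma$ if $\sigma(k)\le m<\sigma(k+1)$; $\mathcal T^\sigma$ is the set of admissible pairs; $\bar S(m,n)=\{(\sigma,T):\sigma\in S(m,n),\,T\subseteq\mathcal T^\sigma\}$. For $x=x_1\otimes\dots\otimes x_m$, $y=y_1\otimes\dots\otimes y_n$, put $u_k=x_k$ for $k\le m$, $u_k=y_{k-m}$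 for $k>m$, and let $\sigma(x\otimes y;T)$ be obtained from $u_{\sigma(1)}\otimes\dots\otimes u_{\sigma(m+n)}$ by replacing, for each $(k,k+1)\in T$, the tensor symbol between $u_{\sigma(k)}$ and $u_{\sigma(k+1)}$ by the product in $A$. Let $\mathrm{Sh}_C(A)=\bigoplus_{k\in\mathbb N}\mathrm{Sh}_C^k(A)$, $\mathrm{Sh}_C^k(A)=A^{\otimes(k+1)}$, with $C$-bilinear product determined by $$(x_0\otimes x)\diamond(y_0\otimes y)=\sum_{(\sigma,T)\in\bar S(m,n)}\lambda^{|T|}\,x_0y_0\otimes\sigma(x\otimes y;T)$$ for $m,n\ge1$ and $x_0\diamond(y_0\otimes\dots\otimes y_n)=(y_0\otimes\dots\otimes y_n)\diamond x_0=x_0y_0\otimes y_1\otimes\dots\otimes y_n$ for $x_0\in A$. With $P_A(x_0\otimes\dots\otimes x_n)=1_A\otimes x_0\otimes\dots\otimes x_n$, $(\mathrm{Sh}_C(A),P_A)$ is the free Baxter $C$-algebra of weight $\lambda$ on $A$. One has $\mathrm{Fil}^n\mathrm{Sh}_C(A)=\bigoplus_{k\ge n}\mathrm{Sh}_C^k(A)$ for $n\ge 1$. $\widehat{\mathrm{Sh}}_C(A)$ denotes its completion $\varprojlim\mathrm{Sh}_C(A)/\mathrm{Fil}^n\mathrm{Sh}_C(A)$. Algebra structure on the product. For $x=(x_k)_k\in\prod_k\mathrm{Sh}_C^k(A)$ let $x^{[n]}\in\mathrm{Sh}_C(A)$ be its truncation ($x^{[n]}_k=x_k$ for $k\le n$,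 $0$ for $k>n$). The product of $x$ and $y$ is the element whose $k$-th component is the eventual constant value, as $n\to\infty$, of the $k$-th component of $x^{[n]}\diamond y^{[n]}$. The map $\psi_A$ sends a compatible family $(x^{(n)}+\mathrm{Fil}^n\mathrm{Sh}_C(A))_n$ to the sequence $(x_k)_k$ where $x_k$ is the component in $\mathrm{Sh}_C^k(A)$ of $x^{(n)}$ for any $n>k$. *)

theory Defs
  imports "HOL-Algebra.Free_Abelian_Groups" "HOL-Algebra.Generated_Groups"
    "HOL-Algebra.Module" "HOL-Algebra.QuotRing"
    "HOL-Combinatorics.Permutations"
begin

text \<open>A commutative unital \<open>C\<close>-algebra is \<open>algebra C R\<close> from the library (the locale contains
  \<open>cring C\<close> and \<open>cring R\<close>; zero rings are allowed).\<close>


section \<open>Baxter algebras\<close>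

definition linear_map ::
  "('c,'k) ring_scheme \<Rightarrow> ('c,'r,'m) module_scheme \<Rightarrow> ('c,'s,'n) module_scheme \<Rightarrow> ('r \<Rightarrow> 's) \<Rightarrow> bool"
where
  "linear_map C M N h \<longleftrightarrow>
     h \<in> carrier M \<rightarrow> carrier N \<and>
     (\<forall>x\<in>carrier M. \<forall>y\<in>carrier M. h (x \<oplus>\<^bsub>M\<^esub> y) = h x \<oplus>\<^bsub>N\<^esub> h y) \<and>
     (\<forall>c\<in>carrier C. \<forall>x\<in>carrier M. h (c \<odot>\<^bsub>M\<^esub> x) = c \<odot>\<^bsub>N\<^esub> h x)"

definition algebra_hom ::
  "('c,'k) ring_scheme \<Rightarrow> ('c,'r,'m) module_scheme \<Rightarrow> ('c,'s,'n) module_scheme \<Rightarrow> ('r \<Rightarrow> 's) set"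
where
  "algebra_hom C R S = {f \<in> ring_hom R S. linear_map C R S f}"

definition baxter_operator ::
  "('c,'k) ring_scheme \<Rightarrow> 'c \<Rightarrow> ('c,'r,'m) module_scheme \<Rightarrow> ('r \<Rightarrow> 'r) \<Rightarrow> bool"
where
  "baxter_operator C lam R P \<longleftrightarrow>
     linear_map C R R P \<and>
     (\<forall>x\<in>carrier R. \<forall>y\<in>carrier R.
        P x \<otimes>\<^bsub>R\<^esub> P y =
          P (x \<otimes>\<^bsub>R\<^esub> P y) \<oplus>\<^bsub>R\<^esub> P (y \<otimes>\<^bsub>R\<^esub> P x) \<oplus>\<^bsub>R\<^esub> lam \<odot>\<^bsub>R\<^esub> P (x \<otimes>\<^bsub>R\<^esub> y))"

definition baxter_algebra ::
  "('c,'k) ring_scheme \<Rightarrow> 'c \<Rightarrow> ('c,'r,'m) module_scheme \<Rightarrow> ('r \<Rightarrow> 'r) \<Rightarrow> bool"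
where
  "baxter_algebra C lam R P \<longleftrightarrow> algebra C R \<and> baxter_operator C lam R P"

definition baxter_hom ::
  "('c,'k) ring_scheme \<Rightarrow> 'c \<Rightarrow> ('c,'r,'m) module_scheme \<Rightarrow> ('r \<Rightarrow> 'r) \<Rightarrow>
     ('c,'s,'n) module_scheme \<Rightarrow> ('s \<Rightarrow> 's) \<Rightarrow> ('r \<Rightarrow> 's) \<Rightarrow> bool"
where
  "baxter_hom C lam R P S Q f \<longleftrightarrow>
     baxter_algebra C lam R P \<and> baxter_algebra C lam S Q \<and>
     f \<in> algebra_hom C R S \<and> (\<forall>x\<in>carrier R. f (P x) = Q (f x))"

definition baxter_iso ::
  "('c,'k) ring_scheme \<Rightarrow> 'c \<Rightarrow> ('c,'r,'m) module_scheme \<Rightarrow> ('r \<Rightarrow> 'r) \<Rightarrow>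
     ('c,'s,'n) module_scheme \<Rightarrow> ('s \<Rightarrow> 's) \<Rightarrow> ('r \<Rightarrow> 's) \<Rightarrow> bool"
where
  "baxter_iso C lam R P S Q f \<longleftrightarrow>
     baxter_hom C lam R P S Q f \<and> bij_betw f (carrier R) (carrier S)"


section \<open>Baxter filtration and completion\<close>

definition baxter_ideal :: "('r,'m) ring_scheme \<Rightarrow> ('r \<Rightarrow> 'r) \<Rightarrow> 'r set \<Rightarrow> bool" where
  "baxter_ideal R P I \<longleftrightarrow> ideal I R \<and> P ` I \<subseteq> I"

definition baxter_ideal_gen :: "('r,'m) ring_scheme \<Rightarrow> ('r \<Rightarrow> 'r) \<Rightarrow> 'r set \<Rightarrow> 'r set" where
  "baxter_ideal_gen R P U = \<Inter> {I. baxter_ideal R P I \<and> U \<subseteq> I}"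

primrec Fil :: "('r,'m) ring_scheme \<Rightarrow> ('r \<Rightarrow> 'r) \<Rightarrow> nat \<Rightarrow> 'r set" where
  "Fil R P 0 = carrier R"
| "Fil R P (Suc n) = baxter_ideal_gen R P (P ` Fil R P n)"

text \<open>A map on cosets induced by a map \<open>h\<close> on representatives is written
  \<open>\<Union>r\<in>X. J +> h r\<close>, in the style of the library's \<^const>\<open>rcoset_mult\<close>: if \<open>h\<close> respects the
  cosets, all the sets in the union coincide with the coset of \<open>h r\<close>.\<close>

text \<open>The projective limit of the \<open>R Quot Fil R P n\<close>: an element is a family \<open>X\<close> of cosets
  \<open>X n\<close> such that, for \<open>m \<le> n\<close>, the projection \<open>R Quot Fil R P n \<rightarrow> R Quot Fil R P m\<close> sends
  \<open>X n\<close> to \<open>X m\<close>.\<close>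

definition completion ::
  "('c,'r,'m) module_scheme \<Rightarrow> ('r \<Rightarrow> 'r) \<Rightarrow> ('c, nat \<Rightarrow> 'r set) module"
where
  "completion R P =
     \<lparr>carrier = {X. (\<forall>n. X n \<in> carrier (R Quot Fil R P n)) \<and>
                    (\<forall>m n. m \<le> n \<longrightarrow> (\<Union>r\<in>X n. Fil R P m +>\<^bsub>R\<^esub> r) = X m)},
      monoid.mult = (\<lambda>X Y n. X n \<otimes>\<^bsub>R Quot Fil R P n\<^esub> Y n),
      one = (\<lambda>n. \<one>\<^bsub>R Quot Fil R P n\<^esub>),
      zero = (\<lambda>n. \<zero>\<^bsub>R Quot Fil R P n\<^esub>),
      add = (\<lambda>X Y n. X n \<oplus>\<^bsub>R Quot Fil R P n\<^esub> Y n),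
      smult = (\<lambda>c X n. \<Union>r\<in>X n. Fil R P n +>\<^bsub>R\<^esub> (c \<odot>\<^bsub>R\<^esub> r))\<rparr>"

definition completion_map ::
  "('s,'m) ring_scheme \<Rightarrow> ('s \<Rightarrow> 's) \<Rightarrow> ('r \<Rightarrow> 's) \<Rightarrow> (nat \<Rightarrow> 'r set) \<Rightarrow> nat \<Rightarrow> 's set"
where
  "completion_map S Q h X = (\<lambda>n. \<Union>r\<in>X n. Fil S Q n +>\<^bsub>S\<^esub> h r)"

definition completion_op ::
  "('r,'m) ring_scheme \<Rightarrow> ('r \<Rightarrow> 'r) \<Rightarrow> (nat \<Rightarrow> 'r set) \<Rightarrow> nat \<Rightarrow> 'r set"
where
  "completion_op R P = completion_map R P P"


section \<open>Tensor powers\<close>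

text \<open>\<open>A\<^bsup>\<otimes>(k+1)\<^esup>\<close> over \<open>C\<close> is the free abelian group on words of length \<open>k+1\<close> over \<open>A\<close>, modulo
  additivity in each position and the relations that move a scalar from one position to another;
  \<open>C\<close> acts through the first position. The word \<open>[x\<^sub>0,\<dots>,x\<^sub>k]\<close> represents
  \<open>x\<^sub>0 \<otimes> \<dots> \<otimes> x\<^sub>k\<close>.\<close>

type_synonym 'a tensor = "('a list \<Rightarrow>\<^sub>0 int) set"

definition words :: "('a,'m) ring_scheme \<Rightarrow> nat \<Rightarrow> 'a list set" where
  "words A k = {w. length w = Suc k \<and> set w \<subseteq> carrier A}"

definition tensor_relators ::
  "('c,'k) ring_scheme \<Rightarrow> ('c,'a,'m) module_scheme \<Rightarrow> nat \<Rightarrow> ('a list \<Rightarrow>\<^sub>0 int) set"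
where
  "tensor_relators C A k =
     {frag_of (w[i := a \<oplus>\<^bsub>A\<^esub> b]) - frag_of (w[i := a]) - frag_of (w[i := b]) | w i a b.
        w \<in> words A k \<and> i \<le> k \<and> a \<in> carrier A \<and> b \<in> carrier A} \<union>
     {frag_of (w[i := c \<odot>\<^bsub>A\<^esub> (w ! i)]) - frag_of (w[j := c \<odot>\<^bsub>A\<^esub> (w ! j)]) | w i j c.
        w \<in> words A k \<and> i \<le> k \<and> j \<le> k \<and> c \<in> carrier C}"

definition tensor_rel ::
  "('c,'k) ring_scheme \<Rightarrow> ('c,'a,'m) module_scheme \<Rightarrow> nat \<Rightarrow> ('a list \<Rightarrow>\<^sub>0 int) set"
where
  "tensor_rel C A k = generate (free_Abelian_group (words A k)) (tensor_relators C A k)"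

definition tensor_class ::
  "('c,'k) ring_scheme \<Rightarrow> ('c,'a,'m) module_scheme \<Rightarrow> nat \<Rightarrow> ('a list \<Rightarrow>\<^sub>0 int) \<Rightarrow> 'a tensor"
where
  "tensor_class C A k u = tensor_rel C A k #>\<^bsub>free_Abelian_group (words A k)\<^esub> u"

text \<open>The module \<open>Sh\<^sup>k = A\<^bsup>\<otimes>(k+1)\<^esup>\<close>. Only its module structure is used; the fields \<open>mult\<close> and
  \<open>one\<close> are part of the library record but not of the locale \<open>module\<close>.\<close>

definition Sh_comp ::
  "('c,'k) ring_scheme \<Rightarrow> ('c,'a,'m) module_scheme \<Rightarrow> nat \<Rightarrow> ('c, 'a tensor) module"
where
  "Sh_comp C A k =
     (let T = free_Abelian_group (words A k) Mod tensor_rel C A k in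
     \<lparr>carrier = carrier T,
      monoid.mult = undefined,
      one = undefined,
      zero = \<one>\<^bsub>T\<^esub>,
      add = monoid.mult T,
      smult = (\<lambda>c U. \<Union>u\<in>U. tensor_class C A k
                 (frag_extend (\<lambda>w. frag_of ((c \<odot>\<^bsub>A\<^esub> hd w) # tl w)) u))\<rparr>)"

definition tensor_map ::
  "('c,'k) ring_scheme \<Rightarrow> ('c,'b,'m) module_scheme \<Rightarrow> ('a \<Rightarrow> 'b) \<Rightarrow> nat \<Rightarrow> 'a tensor \<Rightarrow> 'b tensor"
where
  "tensor_map C B f k U =
     (\<Union>u\<in>U. tensor_class C B k (frag_extend (\<lambda>w. frag_of (map f w)) u))"

text \<open>\<open>x \<mapsto> 1\<^sub>A \<otimes> x\<close> from \<open>Sh\<^sup>k\<close> to \<open>Sh\<^bsup>k+1\<^esup>\<close>.\<close>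

definition one_tensor ::
  "('c,'k) ring_scheme \<Rightarrow> ('c,'a,'m) module_scheme \<Rightarrow> nat \<Rightarrow> 'a tensor \<Rightarrow> 'a tensor"
where
  "one_tensor C A k U =
     (\<Union>u\<in>U. tensor_class C A (Suc k) (frag_extend (\<lambda>w. frag_of (\<one>\<^bsub>A\<^esub> # w)) u))"


section \<open>Mixable shuffles\<close>

definition shuffle_perms :: "nat \<Rightarrow> nat \<Rightarrow> (nat \<Rightarrow> nat) set" where
  "shuffle_perms m n =
     {\<sigma>. \<sigma> permutes {1..m + n} \<and>
          strict_mono_on {1..m} (inv_into UNIV \<sigma>) \<and> strict_mono_on {m + 1..m + n} (inv_into UNIV \<sigma>)}"

text \<open>The pair \<open>(k, k+1)\<close> is encoded by \<open>k\<close>.\<close>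

definition admissible_pairs :: "nat \<Rightarrow> nat \<Rightarrow> (nat \<Rightarrow> nat) \<Rightarrow> nat set" where
  "admissible_pairs m n \<sigma> = {k. 1 \<le> k \<and> k < m + n \<and> \<sigma> k \<le> m \<and> m < \<sigma> (k + 1)}"

definition mixable_shuffles :: "nat \<Rightarrow> nat \<Rightarrow> ((nat \<Rightarrow> nat) \<times> nat set) set" where
  "mixable_shuffles m n = (SIGMA \<sigma>:shuffle_perms m n. Pow (admissible_pairs m n \<sigma>))"

text \<open>\<open>merge A T k w\<close>, where the letters of \<open>w\<close> are numbered \<open>k, k+1, \<dots>\<close>, multiplies the letters
  numbered \<open>j\<close> and \<open>j+1\<close> for every \<open>j \<in> T\<close>.\<close>

fun merge :: "('a,'m) ring_scheme \<Rightarrow> nat set \<Rightarrow> nat \<Rightarrow> 'a list \<Rightarrow> 'a list" where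
  "merge A T k [] = []"
| "merge A T k [a] = [a]"
| "merge A T k (a # b # w) =
     (if k \<in> T then merge A T (Suc k) ((a \<otimes>\<^bsub>A\<^esub> b) # w) else a # merge A T (Suc k) (b # w))"

text \<open>\<open>\<sigma>(x \<otimes> y; T)\<close>; the letter \<open>u\<^sub>i\<close> is \<open>(xs @ ys) ! (i - 1)\<close>.\<close>

definition mixed_word ::
  "('a,'m) ring_scheme \<Rightarrow> (nat \<Rightarrow> nat) \<Rightarrow> nat set \<Rightarrow> 'a list \<Rightarrow> 'a list \<Rightarrow> 'a list"
where
  "mixed_word A \<sigma> T xs ys =
     merge A T 1 (map (\<lambda>i. (xs @ ys) ! (\<sigma> i - 1)) [1..<length xs + length ys + 1])"

text \<open>The product of the pure tensors represented by two words, as a formal sum of words; the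
  scalar \<open>\<lambda>\<^bsup>|T|\<^esup>\<close> is put into the first position. The last equation is irrelevant, as words are
  nonempty.\<close>

fun shuffle_words ::
  "('c,'k) ring_scheme \<Rightarrow> 'c \<Rightarrow> ('c,'a,'m) module_scheme \<Rightarrow> 'a list \<Rightarrow> 'a list \<Rightarrow> ('a list \<Rightarrow>\<^sub>0 int)"
where
  "shuffle_words C lam A (x0 # xs) (y0 # ys) =
     (if xs = [] then frag_of ((x0 \<otimes>\<^bsub>A\<^esub> y0) # ys)
      else if ys = [] then frag_of ((x0 \<otimes>\<^bsub>A\<^esub> y0) # xs)
      else (\<Sum>(\<sigma>, T)\<in>mixable_shuffles (length xs) (length ys).
              frag_of (((lam [^]\<^bsub>C\<^esub> card T) \<odot>\<^bsub>A\<^esub> (x0 \<otimes>\<^bsub>A\<^esub> y0)) # mixed_word A \<sigma> T xs ys)))"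
| "shuffle_words C lam A _ _ = 0"

definition shuffle_frag ::
  "('c,'k) ring_scheme \<Rightarrow> 'c \<Rightarrow> ('c,'a,'m) module_scheme \<Rightarrow>
     ('a list \<Rightarrow>\<^sub>0 int) \<Rightarrow> ('a list \<Rightarrow>\<^sub>0 int) \<Rightarrow> ('a list \<Rightarrow>\<^sub>0 int)"
where
  "shuffle_frag C lam A u v = frag_extend (\<lambda>x. frag_extend (\<lambda>y. shuffle_words C lam A x y) v) u"

definition degree_part :: "nat \<Rightarrow> ('a list \<Rightarrow>\<^sub>0 int) \<Rightarrow> ('a list \<Rightarrow>\<^sub>0 int)" where
  "degree_part k = frag_extend (\<lambda>w. if length w = Suc k then frag_of w else 0)"

text \<open>The \<open>Sh\<^sup>k\<close>-component of the product of \<open>U \<in> Sh\<^sup>i\<close> and \<open>V \<in> Sh\<^sup>j\<close>.\<close>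

definition tensor_shuffle ::
  "('c,'k) ring_scheme \<Rightarrow> 'c \<Rightarrow> ('c,'a,'m) module_scheme \<Rightarrow> nat \<Rightarrow> 'a tensor \<Rightarrow> 'a tensor \<Rightarrow> 'a tensor"
where
  "tensor_shuffle C lam A k U V =
     (\<Union>u\<in>U. \<Union>v\<in>V. tensor_class C A k (degree_part k (shuffle_frag C lam A u v)))"


section \<open>The shuffle Baxter algebra and the product of its components\<close>

definition Sh_incl ::
  "('c,'k) ring_scheme \<Rightarrow> ('c,'a,'m) module_scheme \<Rightarrow> 'a \<Rightarrow> nat \<Rightarrow> 'a tensor"
where
  "Sh_incl C A a = (\<lambda>k. if k = 0 then tensor_class C A 0 (frag_of [a]) else \<zero>\<^bsub>Sh_comp C A k\<^esub>)"

text \<open>The direct sum consists of the families of finite support. The product is the bilinear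
  extension of the products of homogeneous elements.\<close>

definition Sh ::
  "('c,'k) ring_scheme \<Rightarrow> 'c \<Rightarrow> ('c,'a,'m) module_scheme \<Rightarrow> ('c, nat \<Rightarrow> 'a tensor) module"
where
  "Sh C lam A =
     \<lparr>carrier = {x. (\<forall>k. x k \<in> carrier (Sh_comp C A k)) \<and> finite {k. x k \<noteq> \<zero>\<^bsub>Sh_comp C A k\<^esub>}},
      monoid.mult = (\<lambda>x y k. finsum (Sh_comp C A k) (\<lambda>(i, j). tensor_shuffle C lam A k (x i) (y j))
                ({i. x i \<noteq> \<zero>\<^bsub>Sh_comp C A i\<^esub>} \<times> {j. y j \<noteq> \<zero>\<^bsub>Sh_comp C A j\<^esub>})),
      one = Sh_incl C A \<one>\<^bsub>A\<^esub>,
      zero = (\<lambda>k. \<zero>\<^bsub>Sh_comp C A k\<^esub>),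
      add = (\<lambda>x y k. x k \<oplus>\<^bsub>Sh_comp C A k\<^esub> y k),
      smult = (\<lambda>c x k. c \<odot>\<^bsub>Sh_comp C A k\<^esub> x k)\<rparr>"

definition Sh_op ::
  "('c,'k) ring_scheme \<Rightarrow> ('c,'a,'m) module_scheme \<Rightarrow> (nat \<Rightarrow> 'a tensor) \<Rightarrow> nat \<Rightarrow> 'a tensor"
where
  "Sh_op C A x = (\<lambda>k. case k of 0 \<Rightarrow> \<zero>\<^bsub>Sh_comp C A 0\<^esub> | Suc j \<Rightarrow> one_tensor C A j (x j))"

definition truncate ::
  "('c,'k) ring_scheme \<Rightarrow> ('c,'a,'m) module_scheme \<Rightarrow> nat \<Rightarrow> (nat \<Rightarrow> 'a tensor) \<Rightarrow> nat \<Rightarrow> 'a tensor"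
where
  "truncate C A n x = (\<lambda>k. if k \<le> n then x k else \<zero>\<^bsub>Sh_comp C A k\<^esub>)"

definition Sh_prod ::
  "('c,'k) ring_scheme \<Rightarrow> 'c \<Rightarrow> ('c,'a,'m) module_scheme \<Rightarrow> ('c, nat \<Rightarrow> 'a tensor) module"
where
  "Sh_prod C lam A =
     \<lparr>carrier = {x. \<forall>k. x k \<in> carrier (Sh_comp C A k)},
      monoid.mult = (\<lambda>x y k. THE z. \<forall>\<^sub>F n in sequentially.
                (truncate C A n x \<otimes>\<^bsub>Sh C lam A\<^esub> truncate C A n y) k = z),
      one = Sh_incl C A \<one>\<^bsub>A\<^esub>,
      zero = (\<lambda>k. \<zero>\<^bsub>Sh_comp C A k\<^esub>),
      add = (\<lambda>x y k. x k \<oplus>\<^bsub>Sh_comp C A k\<^esub> y k),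
      smult = (\<lambda>c x k. c \<odot>\<^bsub>Sh_comp C A k\<^esub> x k)\<rparr>"

text \<open>The operator \<open>(x\<^sub>k)\<^sub>k \<mapsto> (1\<^sub>A \<otimes> x\<^bsub>k-1\<^esub>)\<^sub>k\<close> on the product.\<close>

definition Sh_prod_op ::
  "('c,'k) ring_scheme \<Rightarrow> ('c,'a,'m) module_scheme \<Rightarrow> (nat \<Rightarrow> 'a tensor) \<Rightarrow> nat \<Rightarrow> 'a tensor"
where
  "Sh_prod_op C A x =
     (\<lambda>k. if k = 0 then \<zero>\<^bsub>Sh_comp C A 0\<^esub> else one_tensor C A (k - 1) (x (k - 1)))"

definition Sh_prod_map ::
  "('c,'k) ring_scheme \<Rightarrow> ('c,'b,'m) module_scheme \<Rightarrow> ('a \<Rightarrow> 'b) \<Rightarrow>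
     (nat \<Rightarrow> 'a tensor) \<Rightarrow> nat \<Rightarrow> 'b tensor"
where
  "Sh_prod_map C B f x = (\<lambda>k. tensor_map C B f k (x k))"

text \<open>\<open>Sh(f)\<close> is given by the universal property of the free Baxter algebra: the Baxter
  homomorphism that restricts to \<open>f\<close> along the inclusions of \<open>A\<close> and \<open>B\<close>.\<close>

definition Sh_map ::
  "('c,'k) ring_scheme \<Rightarrow> 'c \<Rightarrow> ('c,'a,'m) module_scheme \<Rightarrow> ('c,'b,'n) module_scheme \<Rightarrow> ('a \<Rightarrow> 'b) \<Rightarrow>
     (nat \<Rightarrow> 'a tensor) \<Rightarrow> nat \<Rightarrow> 'b tensor"
where
  "Sh_map C lam A B f =
     (THE F. F \<in> extensional (carrier (Sh C lam A)) \<and>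
             baxter_hom C lam (Sh C lam A) (Sh_op C A) (Sh C lam B) (Sh_op C B) F \<and>
             (\<forall>a\<in>carrier A. F (Sh_incl C A a) = Sh_incl C B (f a)))"

definition Sh_hat ::
  "('c,'k) ring_scheme \<Rightarrow> 'c \<Rightarrow> ('c,'a,'m) module_scheme \<Rightarrow>
     ('c, nat \<Rightarrow> (nat \<Rightarrow> 'a tensor) set) module"
where
  "Sh_hat C lam A = completion (Sh C lam A) (Sh_op C A)"

definition Sh_hat_op ::
  "('c,'k) ring_scheme \<Rightarrow> 'c \<Rightarrow> ('c,'a,'m) module_scheme \<Rightarrow>
     (nat \<Rightarrow> (nat \<Rightarrow> 'a tensor) set) \<Rightarrow> nat \<Rightarrow> (nat \<Rightarrow> 'a tensor) set"
where
  "Sh_hat_op C lam A = completion_op (Sh C lam A) (Sh_op C A)"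

definition Sh_hat_map ::
  "('c,'k) ring_scheme \<Rightarrow> 'c \<Rightarrow> ('c,'a,'m) module_scheme \<Rightarrow> ('c,'b,'n) module_scheme \<Rightarrow> ('a \<Rightarrow> 'b) \<Rightarrow>
     (nat \<Rightarrow> (nat \<Rightarrow> 'a tensor) set) \<Rightarrow> nat \<Rightarrow> (nat \<Rightarrow> 'b tensor) set"
where
  "Sh_hat_map C lam A B f = completion_map (Sh C lam B) (Sh_op C B) (Sh_map C lam A B f)"

text \<open>The \<open>k\<close>-th entry of \<open>psi X\<close> is the \<open>k\<close>-th component of any representative of \<open>X n\<close>, for any
  \<open>n > k\<close>.\<close>

definition psi :: "(nat \<Rightarrow> (nat \<Rightarrow> 'a tensor) set) \<Rightarrow> nat \<Rightarrow> 'a tensor" where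
  "psi X = (\<lambda>k. THE z. \<forall>n>k. \<forall>r\<in>X n. r k = z)"

end

theory Submission
  imports Defs
begin

text \<open>
  Everything is computed with formal sums of words instead of tensors. Sorting the mixable shuffles
  of two words by what becomes of the first letters turns the sum over permutations into the
  quasi-shuffle recursion (\<open>sum_mixable_shuffles\<close>). In that form the product of formal sums is
  commutative and associative on the nose (\<open>qshuffle_commute\<close>, \<open>qshuffle_assoc\<close>): only products of
  letters in \<open>A\<close> have to be compared, since the power of \<open>\<lambda>\<close> is kept apart in the zeroth letter. The
  relations that define tensor powers are stable under multiplication (\<open>N_mul\<close>), because a shuffle is
  additive and \<open>C\<close>-linear in each letter of a factor modulo these relations. The Baxter identity
  holds modulo them too (\<open>baxter_identity_frag\<close>): its three summands are the three branches of the
  recursion, and only scalars have to move from one letter to another.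

  In degree at most \<open>n\<close> a product depends on its factors in degree at most \<open>n\<close> only, as shuffling and
  merging never make a word shorter than either factor. So an infinite family of tensors can be
  replaced by a finite formal sum that represents it up to degree \<open>n\<close> (\<open>rep\<close>), and every identity
  between families follows from the identities between formal sums, for one \<open>n\<close> after another
  (\<open>represented_baxter_algebra\<close>). This proves at the same time that the direct sum and the product
  are Baxter algebras; the direct sum consists of the families that a single formal sum represents in
  all degrees.

  From \<open>x\<^sub>0 \<otimes> x\<^sub>1 \<otimes> \<dots> \<otimes> x\<^sub>k = x\<^sub>0 \<diamondop> P (x\<^sub>1 \<otimes> \<dots> \<otimes> x\<^sub>k)\<close> it follows that the \<open>n\<close>-th step of the
  Baxter filtration consists of the elements without components below degree \<open>n\<close> (\<open>Fil_Sh\<close>). Hence a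
  coset of that step is the set of elements with prescribed components below \<open>n\<close>, and a compatible
  sequence of cosets is nothing but a family of components. This gives the inverse \<open>cosets_of\<close> of
  \<open>psi\<close>; it respects all operations, and through it the completion inherits its algebra structure
  from the product. For naturality, the same factorization of pure tensors shows that a Baxter
  homomorphism on the direct sum is determined by its values on \<open>A\<close>, so that \<open>Sh(f)\<close> applies \<open>f\<close> to
  every letter (\<open>Sh_map_eq\<close>); both ways around the square do the same to each component.
\<close>

section \<open>Mixable shuffles by recursion on the first letter\<close>

text \<open>The sum of \<open>F e w\<close> over the words \<open>w\<close> that arise by mixable shuffling, where \<open>e\<close> counts the
  merged pairs. Summing a function, instead of returning a multiset of words, lets the recursion
  prefix letters by changing \<open>F\<close>, and makes products of three words a nested sum.\<close>

fun qshuffle ::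
  "('a,'m) ring_scheme \<Rightarrow> 'a list \<Rightarrow> 'a list \<Rightarrow> (nat \<Rightarrow> 'a list \<Rightarrow> 'v) \<Rightarrow> 'v::comm_monoid_add"
where
  "qshuffle A [] ys F = F 0 ys"
| "qshuffle A (x # xs) [] F = F 0 (x # xs)"
| "qshuffle A (x # xs) (y # ys) F =
     qshuffle A xs (y # ys) (\<lambda>e w. F e (x # w)) +
     qshuffle A (x # xs) ys (\<lambda>e w. F e (y # w)) +
     qshuffle A xs ys (\<lambda>e w. F (Suc e) ((x \<otimes>\<^bsub>A\<^esub> y) # w))"

lemma qshuffle_Nil2 [simp]: "qshuffle A xs [] F = F 0 xs"
  by (cases xs) auto

text \<open>The letters of \<open>s\<close> are the numbers of the letters of the two words: those up to \<open>m\<close> come from the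
  first word. The positions in \<open>s\<close> are counted from \<open>k\<close>, as in \<^const>\<open>merge\<close>, so that the first letter
  can be split off.\<close>

definition admissible_from :: "nat \<Rightarrow> nat \<Rightarrow> nat list \<Rightarrow> nat set" where
  "admissible_from m k s =
     {j. k \<le> j \<and> Suc j < k + length s \<and> s ! (j - k) \<le> m \<and> m < s ! (Suc j - k)}"

text \<open>The part of the mixable shuffle sum that belongs to one permutation, given as the list \<open>s\<close> of its
  values.\<close>

definition merge_sum ::
  "('a,'m) ring_scheme \<Rightarrow> nat \<Rightarrow> (nat \<Rightarrow> 'a) \<Rightarrow> nat \<Rightarrow> nat list \<Rightarrow> (nat \<Rightarrow> 'a list \<Rightarrow> 'v) \<Rightarrow> 'v::comm_monoid_add"
where
  "merge_sum A m u k s F =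
     (\<Sum>T\<in>Pow (admissible_from m k s). F (card T) (merge A T k (map u s)))"

lemma merge_cong:
  "(\<And>j. k \<le> j \<Longrightarrow> j \<in> T \<longleftrightarrow> j \<in> T') \<Longrightarrow> merge A T k w = merge A T' k w"
  by (induction A T k w rule: merge.induct) auto

lemma merge_not_first: "k \<notin> T \<Longrightarrow> merge A T k (a # w) = a # merge A T (Suc k) w"
  by (cases w) auto

lemma finite_admissible_from: "finite (admissible_from m k s)"
  by (rule finite_subset[of _ "{..<k + length s}"]) (auto simp: admissible_from_def)

lemma admissible_from_ge: "j \<in> admissible_from m k s \<Longrightarrow> k \<le> j"
  by (simp add: admissible_from_def)

lemma admissible_from_Cons:
  "admissible_from m k (a # s) =
     (if a \<le> m \<and> s \<noteq> [] \<and> m < hd s then {k} else {}) \<union> admissible_from m (Suc k) s"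
proof (rule Set.set_eqI)
  fix j
  show "j \<in> admissible_from m k (a # s) \<longleftrightarrow>
    j \<in> (if a \<le> m \<and> s \<noteq> [] \<and> m < hd s then {k} else {}) \<union> admissible_from m (Suc k) s"
  proof (cases "j = k")
    case True
    then show ?thesis by (cases s) (auto simp: admissible_from_def)
  next
    case False
    then show ?thesis
      by (cases "j > k") (auto simp: admissible_from_def nth_Cons' Suc_diff_Suc)
  qed
qed

lemma merge_sum_Nil [simp]: "merge_sum A m u k [] F = F 0 []"
proof -
  have "admissible_from m k [] = {}" by (auto simp: admissible_from_def)
  then show ?thesis by (simp add: merge_sum_def)
qed

lemma merge_sum_skip:
  "(\<Sum>T\<in>Pow (admissible_from m (Suc k) s). F (card T) (merge A T k (map u (a # s)))) =
   merge_sum A m u (Suc k) s (\<lambda>e w. F e (u a # w))"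
  unfolding merge_sum_def
proof (rule sum.cong[OF refl])
  fix T assume "T \<in> Pow (admissible_from m (Suc k) s)"
  then have "k \<notin> T" using admissible_from_ge by fastforce
  then show "F (card T) (merge A T k (map u (a # s))) = F (card T) (u a # merge A T (Suc k) (map u s))"
    by (simp add: merge_not_first)
qed

lemma merge_sum_Cons_unmergeable:
  "m < a \<Longrightarrow> merge_sum A m u k (a # s) F = merge_sum A m u (Suc k) s (\<lambda>e w. F e (u a # w))"
  using merge_sum_skip[where m=m and k=k and s=s and F=F and A=A and u=u and a=a] by (simp add: merge_sum_def admissible_from_Cons)

text \<open>If the leading letter \<open>a\<close> of the first word is followed by a letter of the second word, the sets \<open>T\<close>
  that contain the first position give the second summand. The pair after a merged pair starts with
  a letter of the second word and is therefore not admissible, so that merging resumes two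
  positions further on.\<close>

lemma merge_sum_Cons:
  assumes "a \<le> m"
  shows "merge_sum A m u k (a # s) F =
     merge_sum A m u (Suc k) s (\<lambda>e w. F e (u a # w)) +
     (if s \<noteq> [] \<and> m < hd s
      then merge_sum A m u (Suc (Suc k)) (tl s) (\<lambda>e w. F (Suc e) ((u a \<otimes>\<^bsub>A\<^esub> u (hd s)) # w))
      else 0)"
proof (cases "s \<noteq> [] \<and> m < hd s")
  case False
  then show ?thesis
    using merge_sum_skip[where m=m and k=k and s=s and F=F and A=A and u=u and a=a] assms
    by (auto simp: merge_sum_def admissible_from_Cons)
next
  case True
  then obtain b s' where s: "s = b # s'" and b: "m < b" by (cases s) auto
  let ?B = "admissible_from m (Suc k) s"
  let ?g = "\<lambda>T. F (card T) (merge A T k (map u (a # s)))"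
  have B: "?B = admissible_from m (Suc (Suc k)) s'"
    using b by (simp add: s admissible_from_Cons)
  have kB: "k \<notin> ?B" using admissible_from_ge by fastforce
  \<comment> \<open>so the sets that contain \<open>k\<close> are the sets \<open>insert k T\<close> with \<open>T\<close> a set of later positions\<close>
  have adm: "admissible_from m k (a # s) = insert k ?B"
    using True assms by (simp add: admissible_from_Cons[of m k a s])
  have "merge_sum A m u k (a # s) F = sum ?g (Pow ?B) + sum ?g (insert k ` Pow ?B)"
    unfolding merge_sum_def adm Pow_insert
    by (rule sum.union_disjoint) (use kB finite_admissible_from in auto)
  moreover have "sum ?g (insert k ` Pow ?B) = (\<Sum>T\<in>Pow ?B. ?g (insert k T))"
    by (rule sum.reindex_cong[OF _ refl refl]) (use kB in \<open>auto simp: inj_on_def\<close>)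
  moreover have "(\<Sum>T\<in>Pow ?B. ?g (insert k T)) =
    merge_sum A m u (Suc (Suc k)) s' (\<lambda>e w. F (Suc e) ((u a \<otimes>\<^bsub>A\<^esub> u b) # w))"
    unfolding merge_sum_def B
  proof (rule sum.cong[OF refl])
    fix T assume T: "T \<in> Pow (admissible_from m (Suc (Suc k)) s')"
    then have T': "T \<subseteq> admissible_from m (Suc (Suc k)) s'" by simp
    have fin: "finite T" using T' finite_admissible_from finite_subset by blast
    have nT: "k \<notin> T" "Suc k \<notin> T" using T' admissible_from_ge by fastforce+
    have "merge A (insert k T) k (map u (a # s)) =
          (u a \<otimes>\<^bsub>A\<^esub> u b) # merge A (insert k T) (Suc (Suc k)) (map u s')"
      using nT by (simp add: s merge_not_first)
    also have "merge A (insert k T) (Suc (Suc k)) (map u s') = merge A T (Suc (Suc k)) (map u s')"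
      by (rule merge_cong) auto
    finally show "?g (insert k T) = F (Suc (card T)) ((u a \<otimes>\<^bsub>A\<^esub> u b) # merge A T (Suc (Suc k)) (map u s'))"
      using fin nT by simp
  qed
  ultimately show ?thesis
    using True merge_sum_skip[where m=m and k=k and s=s and F=F and A=A and u=u and a=a] by (simp add: s)
qed

lemma merge_sum_constant_side:
  assumes "(\<forall>i\<in>set s. i \<le> m) \<or> (\<forall>i\<in>set s. m < i)"
  shows "merge_sum A m u k s F = F 0 (map u s)"
  using assms
proof (induction s arbitrary: k F)
  case (Cons a s)
  then show ?case
    by (cases "a \<le> m"; cases s) (auto simp: merge_sum_Cons merge_sum_Cons_unmergeable)
qed simp

text \<open>A shuffle of \<open>a # p\<close> and \<open>b # q\<close> starts with \<open>a\<close> or with \<open>b\<close>. The letter \<open>b\<close> cannot be merged with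
  its successor; the letter \<open>a\<close> can exactly when it is followed by \<open>b\<close>, which leaves a shuffle of \<open>p\<close>
  and \<open>q\<close>. These are the three branches of \<^const>\<open>qshuffle\<close>.\<close>

lemma sum_merge_sum_shuffles:
  assumes "\<forall>i\<in>set p. i \<le> m" and "\<forall>i\<in>set q. m < i"
  shows "(\<Sum>s\<in>shuffles p q. merge_sum A m u k s F) = qshuffle A (map u p) (map u q) F"
  using assms
proof (induction "length p + length q" arbitrary: p q k F rule: less_induct)
  case less
  consider "p = []" | "q = []" | a p' b q' where "p = a # p'" "q = b # q'"
    by (meson neq_Nil_conv)
  then show ?case
  proof cases
    case 1
    then show ?thesis using less.prems by (simp add: merge_sum_constant_side)
  next
    case 2
    then show ?thesis using less.prems by (cases p) (simp_all add: merge_sum_constant_side del: set_simps)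
  next
    case (3 a p' b q')
    have am: "a \<le> m" and bm: "m < b"
      and prems: "\<forall>i\<in>set p'. i \<le> m" "\<forall>i\<in>set q'. m < i" using less.prems 3 by auto
    then have ab: "a \<noteq> b" by simp
    let ?L = "shuffles p' (b # q')" and ?R = "shuffles (a # p') q'"
    let ?G = "\<lambda>e w. F (Suc e) ((u a \<otimes>\<^bsub>A\<^esub> u b) # w)"
    have "(\<Sum>s\<in>shuffles (a # p') (b # q'). merge_sum A m u k s F) =
      (\<Sum>s\<in>?L. merge_sum A m u k (a # s) F) + (\<Sum>s\<in>?R. merge_sum A m u k (b # s) F)"
      using ab by (simp, subst sum.union_disjoint) (auto simp: sum.reindex)
    moreover have "(\<Sum>s\<in>?R. merge_sum A m u k (b # s) F) =
        qshuffle A (u a # map u p') (map u q') (\<lambda>e w. F e (u b # w))"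
      using less.hyps[of "a # p'" q'] prems am bm 3 by (simp add: merge_sum_Cons_unmergeable)
    moreover have "(\<Sum>s\<in>?L. merge_sum A m u k (a # s) F) =
        qshuffle A (map u p') (u b # map u q') (\<lambda>e w. F e (u a # w)) +
        qshuffle A (map u p') (map u q') ?G"
    proof -
      have sub: "(#) b ` shuffles p' q' \<subseteq> ?L" by (rule Cons_shuffles_subset2)
      have first: "s \<noteq> [] \<and> m < hd s \<longleftrightarrow> s \<in> (#) b ` shuffles p' q'" if "s \<in> ?L" for s
        using that prems am bm by (cases s; cases p') (auto simp: Cons_in_shuffles_iff)
      have "(\<Sum>s\<in>?L. merge_sum A m u k (a # s) F) =
        (\<Sum>s\<in>?L. merge_sum A m u (Suc k) s (\<lambda>e w. F e (u a # w))) +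
        (\<Sum>s\<in>?L. if s \<in> (#) b ` shuffles p' q'
            then merge_sum A m u (Suc (Suc k)) (tl s) (\<lambda>e w. F (Suc e) ((u a \<otimes>\<^bsub>A\<^esub> u (hd s)) # w)) else 0)"
        unfolding sum.distrib[symmetric]
        by (rule sum.cong[OF refl]) (simp add: merge_sum_Cons[OF am] first)
      also have "(\<Sum>s\<in>?L. if s \<in> (#) b ` shuffles p' q'
            then merge_sum A m u (Suc (Suc k)) (tl s) (\<lambda>e w. F (Suc e) ((u a \<otimes>\<^bsub>A\<^esub> u (hd s)) # w)) else 0)
         = (\<Sum>s\<in>(#) b ` shuffles p' q'.
              merge_sum A m u (Suc (Suc k)) (tl s) (\<lambda>e w. F (Suc e) ((u a \<otimes>\<^bsub>A\<^esub> u (hd s)) # w)))"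
        using sub by (simp add: sum.inter_restrict[symmetric] Int_absorb1)
      also have "\<dots> = (\<Sum>s\<in>shuffles p' q'. merge_sum A m u (Suc (Suc k)) s ?G)"
        by (simp add: sum.reindex)
      also have "\<dots> = qshuffle A (map u p') (map u q') ?G"
        using less.hyps[of p' q'] prems 3 by simp
      also have "(\<Sum>s\<in>?L. merge_sum A m u (Suc k) s (\<lambda>e w. F e (u a # w))) =
         qshuffle A (map u p') (u b # map u q') (\<lambda>e w. F e (u a # w))"
        using less.hyps[of p' "b # q'"] prems bm 3 by simp
      finally show ?thesis .
    qed
    ultimately show ?thesis using 3 by (simp add: algebra_simps)
  qed
qed

lemma sorted_wrt_filter_iff:
  "sorted_wrt R (filter Q s) \<longleftrightarrow> sorted_wrt (\<lambda>x y. Q x \<longrightarrow> Q y \<longrightarrow> R x y) s"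
  by (induction s) auto

text \<open>The inverse of \<open>\<sigma>\<close> gives the positions of the values in the list of values of \<open>\<sigma>\<close>; it is increasing
  on a set of values exactly if these are listed in increasing order.\<close>

lemma strict_mono_on_inv_iff_sorted:
  fixes \<sigma> :: "nat \<Rightarrow> nat"
  assumes \<sigma>: "\<sigma> permutes {1..N}" and I: "I = {i\<in>{1..N}. Q i}"
  shows "strict_mono_on I (inv_into UNIV \<sigma>) \<longleftrightarrow> sorted_wrt (<) (filter Q (map \<sigma> [1..<N + 1]))"
proof -
  have inv: "inv_into UNIV \<sigma> (\<sigma> i) = i" "\<sigma> (inv_into UNIV \<sigma> i) = i" for i
    using permutes_inverses[OF \<sigma>] by auto
  have inv_mem: "inv_into UNIV \<sigma> i \<in> {1..N}" if "i \<in> {1..N}" for i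
    using permutes_in_image[OF permutes_inv[OF \<sigma>]] that by blast
  have mem: "\<sigma> i \<in> {1..N}" if "i \<in> {1..N}" for i
    using permutes_in_image[OF \<sigma>] that by blast
  have sorted: "sorted_wrt (<) (filter Q (map \<sigma> [1..<N + 1])) \<longleftrightarrow>
    (\<forall>i\<in>{1..N}. \<forall>j\<in>{1..N}. i < j \<longrightarrow> Q (\<sigma> i) \<longrightarrow> Q (\<sigma> j) \<longrightarrow> \<sigma> i < \<sigma> j)" (is "_ \<longleftrightarrow> ?R")
  proof -
    have "sorted_wrt (\<lambda>x y. Q x \<longrightarrow> Q y \<longrightarrow> x < y) (map \<sigma> [1..<N + 1]) \<longleftrightarrow> ?R"
      unfolding sorted_wrt_iff_nth_less length_map length_upt
    proof (intro iffI ballI impI allI)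
      fix i j assume *: "\<forall>a b. a < b \<longrightarrow> b < N + 1 - 1 \<longrightarrow> Q (map \<sigma> [1..<N + 1] ! a) \<longrightarrow>
          Q (map \<sigma> [1..<N + 1] ! b) \<longrightarrow> map \<sigma> [1..<N + 1] ! a < map \<sigma> [1..<N + 1] ! b"
        and "i \<in> {1..N}" "j \<in> {1..N}" "i < j" "Q (\<sigma> i)" "Q (\<sigma> j)"
      then show "\<sigma> i < \<sigma> j"
        using *[rule_format, of "i - 1" "j - 1"] by (simp del: upt_Suc)
    qed (simp del: upt_Suc)
    then show ?thesis by (simp add: sorted_wrt_filter_iff)
  qed
  show ?thesis
    unfolding sorted
  proof (intro iffI ballI impI)
    fix i j assume mono: "strict_mono_on I (inv_into UNIV \<sigma>)" and ij: "i \<in> {1..N}" "j \<in> {1..N}" "i < j"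
      and Q: "Q (\<sigma> i)" "Q (\<sigma> j)"
    have "\<sigma> i \<in> I" "\<sigma> j \<in> I" using mem ij Q by (auto simp: I)
    then have "\<sigma> j \<le> \<sigma> i \<Longrightarrow> j \<le> i"
      using mono inv(1) unfolding strict_mono_on_def
      by (metis le_less)
    then show "\<sigma> i < \<sigma> j" using ij(3) by linarith
  next
    assume R: "\<forall>i\<in>{1..N}. \<forall>j\<in>{1..N}. i < j \<longrightarrow> Q (\<sigma> i) \<longrightarrow> Q (\<sigma> j) \<longrightarrow> \<sigma> i < \<sigma> j"
    show "strict_mono_on I (inv_into UNIV \<sigma>)"
    proof (rule strict_mono_onI)
      fix a b assume ab: "a \<in> I" "b \<in> I" "a < b"
      have m: "inv_into UNIV \<sigma> a \<in> {1..N}" "inv_into UNIV \<sigma> b \<in> {1..N}" using ab inv_mem by (auto simp: I)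
      have "inv_into UNIV \<sigma> a \<noteq> inv_into UNIV \<sigma> b" using ab(3) inv(2) by (metis less_irrefl)
      moreover have "\<not> inv_into UNIV \<sigma> b < inv_into UNIV \<sigma> a"
        using R[rule_format, of "inv_into UNIV \<sigma> b" "inv_into UNIV \<sigma> a"] m ab
        by (auto simp: inv(2) I)
      ultimately show "inv_into UNIV \<sigma> a < inv_into UNIV \<sigma> b" by linarith
    qed
  qed
qed

text \<open>This is the passage from permutations to the recursively defined shuffles of lists: a list of
  values is an interleaving of \<open>1, \<dots>, m\<close> and \<open>m+1, \<dots>, m+n\<close> exactly if both blocks are increasing in it.\<close>

lemma bij_betw_shuffle_perms_shuffles:
  "bij_betw (\<lambda>\<sigma>. map \<sigma> [1..<m + n + 1]) (shuffle_perms m n)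
     (shuffles [1..<m + 1] [m + 1..<m + n + 1])"
proof (rule bij_betw_imageI)
  let ?N = "m + n" and ?L = "\<lambda>\<sigma>::nat \<Rightarrow> nat. map \<sigma> [1..<m + n + 1]"
  let ?P = "\<lambda>i::nat. i \<le> m"
  show "inj_on ?L (shuffle_perms m n)"
  proof (rule inj_onI, rule ext)
    fix \<sigma> \<tau> i assume "\<sigma> \<in> shuffle_perms m n" "\<tau> \<in> shuffle_perms m n" "?L \<sigma> = ?L \<tau>"
    then show "\<sigma> i = \<tau> i"
      by (cases "i \<in> {1..m + n}") (auto simp: shuffle_perms_def permutes_def simp del: upt_Suc)
  qed
  have sorted_unique: "xs = ys" if "sorted_wrt (<) xs" "sorted_wrt (<) ys" "set xs = set ys" for xs ys :: "nat list"
    using that by (meson strict_sorted_equal)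
  have iff: "\<sigma> \<in> shuffle_perms m n \<longleftrightarrow> ?L \<sigma> \<in> shuffles [1..<m + 1] [m + 1..<?N + 1]"
    if \<sigma>: "\<sigma> permutes {1..?N}" for \<sigma>
  proof -
    have set: "set (?L \<sigma>) = {1..?N}"
      using permutes_image[OF \<sigma>] by (auto simp del: upt_Suc simp: atLeastLessThanSuc_atLeastAtMost)
    have "\<sigma> \<in> shuffle_perms m n \<longleftrightarrow> sorted_wrt (<) (filter ?P (?L \<sigma>)) \<and>
       sorted_wrt (<) (filter (\<lambda>i. \<not> ?P i) (?L \<sigma>))"
    proof -
      have "strict_mono_on {1..m} (inv_into UNIV \<sigma>) \<longleftrightarrow> sorted_wrt (<) (filter ?P (?L \<sigma>))"
        by (rule strict_mono_on_inv_iff_sorted[OF \<sigma>]) auto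
      moreover have "strict_mono_on {m + 1..m + n} (inv_into UNIV \<sigma>) \<longleftrightarrow>
          sorted_wrt (<) (filter (\<lambda>i. \<not> ?P i) (?L \<sigma>))"
        by (rule strict_mono_on_inv_iff_sorted[OF \<sigma>]) auto
      ultimately show ?thesis using \<sigma> unfolding shuffle_perms_def by blast
    qed
    also have "\<dots> \<longleftrightarrow> filter ?P (?L \<sigma>) = [1..<m + 1] \<and> filter (\<lambda>i. \<not> ?P i) (?L \<sigma>) = [m + 1..<?N + 1]"
    proof -
      have "set (filter ?P (?L \<sigma>)) = set [1..<m + 1]"
        "set (filter (\<lambda>i. \<not> ?P i) (?L \<sigma>)) = set [m + 1..<?N + 1]"
        unfolding set_filter set by auto
      then show ?thesis
        using sorted_unique strict_sorted_iff sorted_wrt_upt by metis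
    qed
    also have "\<dots> \<longleftrightarrow> ?L \<sigma> \<in> shuffles [1..<m + 1] [m + 1..<?N + 1]"
    proof
      assume "filter ?P (?L \<sigma>) = [1..<m + 1] \<and> filter (\<lambda>i. \<not> ?P i) (?L \<sigma>) = [m + 1..<?N + 1]"
      then show "?L \<sigma> \<in> shuffles [1..<m + 1] [m + 1..<?N + 1]"
        using partition_in_shuffles[of "?L \<sigma>" ?P] by metis
    next
      assume s: "?L \<sigma> \<in> shuffles [1..<m + 1] [m + 1..<?N + 1]"
      then have "filter ?P (?L \<sigma>) \<in> filter ?P ` shuffles [1..<m + 1] [m + 1..<?N + 1]"
        and "filter (\<lambda>i. \<not> ?P i) (?L \<sigma>) \<in> filter (\<lambda>i. \<not> ?P i) ` shuffles [1..<m + 1] [m + 1..<?N + 1]"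
        by blast+
      moreover have "filter ?P [1..<m + 1] = [1..<m + 1]" "filter ?P [m + 1..<?N + 1] = []"
        "filter (\<lambda>i. \<not> ?P i) [1..<m + 1] = []" "filter (\<lambda>i. \<not> ?P i) [m + 1..<?N + 1] = [m + 1..<?N + 1]"
        by (auto simp: filter_empty_conv filter_id_conv simp del: upt_Suc)
      ultimately show "filter ?P (?L \<sigma>) = [1..<m + 1] \<and> filter (\<lambda>i. \<not> ?P i) (?L \<sigma>) = [m + 1..<?N + 1]"
        unfolding filter_shuffles by (simp del: upt_Suc)
    qed
    finally show ?thesis .
  qed
  show "?L ` shuffle_perms m n = shuffles [1..<m + 1] [m + 1..<?N + 1]"
  proof (intro equalityI subsetI)
    fix s assume "s \<in> ?L ` shuffle_perms m n"
    then show "s \<in> shuffles [1..<m + 1] [m + 1..<?N + 1]"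
      using iff by (auto simp: shuffle_perms_def simp del: upt_Suc)
  next
    fix s assume s: "s \<in> shuffles [1..<m + 1] [m + 1..<?N + 1]"
    have len: "length s = ?N" using length_shuffles[OF s] by simp
    have set: "set s = {1..?N}" unfolding set_shuffles[OF s] set_upt by auto
    define \<sigma> where "\<sigma> i = (if i \<in> {1..?N} then s ! (i - 1) else i)" for i
    have Ls: "?L \<sigma> = s" by (rule nth_equalityI) (auto simp: len \<sigma>_def simp del: upt_Suc)
    have "\<sigma> permutes {1..?N}"
    proof (rule bij_imp_permutes)
      have "\<sigma> ` {1..?N} = set (?L \<sigma>)" by (auto simp del: upt_Suc)
      then have im: "\<sigma> ` {1..?N} = {1..?N}" by (simp only: Ls set)
      then show "bij_betw \<sigma> {1..?N} {1..?N}"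
        by (simp add: bij_betw_def eq_card_imp_inj_on)
    qed (auto simp: \<sigma>_def)
    then show "s \<in> ?L ` shuffle_perms m n"
      using iff[of \<sigma>] s Ls by (metis image_eqI)
  qed
qed

lemma sum_mixable_shuffles:
  "(\<Sum>(\<sigma>, T)\<in>mixable_shuffles (length xs) (length ys). F (card T) (mixed_word A \<sigma> T xs ys)) =
   qshuffle A xs ys F"
proof -
  let ?m = "length xs" and ?n = "length ys"
  let ?u = "\<lambda>i. (xs @ ys) ! (i - 1)" and ?L = "\<lambda>\<sigma>::nat \<Rightarrow> nat. map \<sigma> [1..<length xs + length ys + 1]"
  have fin: "finite (shuffle_perms ?m ?n)"
    by (rule finite_subset[OF _ finite_permutations[of "{1..?m + ?n}"]]) (auto simp: shuffle_perms_def)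
  have adm: "admissible_pairs ?m ?n \<sigma> = admissible_from ?m 1 (?L \<sigma>)" for \<sigma>
    unfolding admissible_pairs_def admissible_from_def by (auto simp del: upt_Suc)
  have finT: "finite (Pow (admissible_pairs ?m ?n \<sigma>))" for \<sigma>
    by (simp add: adm finite_admissible_from del: upt_Suc)
  have "(\<Sum>(\<sigma>, T)\<in>mixable_shuffles ?m ?n. F (card T) (mixed_word A \<sigma> T xs ys)) =
     (\<Sum>\<sigma>\<in>shuffle_perms ?m ?n. \<Sum>T\<in>Pow (admissible_pairs ?m ?n \<sigma>). F (card T) (mixed_word A \<sigma> T xs ys))"
    unfolding mixable_shuffles_def by (rule sum.Sigma[symmetric]) (use fin finT in auto)
  also have "\<dots> = (\<Sum>\<sigma>\<in>shuffle_perms ?m ?n. merge_sum A ?m ?u 1 (?L \<sigma>) F)"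
    by (simp add: merge_sum_def adm mixed_word_def comp_def del: upt_Suc)
  also have "\<dots> = (\<Sum>s\<in>shuffles [1..<?m + 1] [?m + 1..<?m + ?n + 1]. merge_sum A ?m ?u 1 s F)"
    by (rule sum.reindex_bij_betw[OF bij_betw_shuffle_perms_shuffles])
  also have "\<dots> = qshuffle A (map ?u [1..<?m + 1]) (map ?u [?m + 1..<?m + ?n + 1]) F"
    by (rule sum_merge_sum_shuffles) auto
  also have "map ?u [1..<?m + 1] = xs"
    by (rule nth_equalityI) (auto simp: nth_append simp del: upt_Suc)
  also have "map ?u [?m + 1..<?m + ?n + 1] = ys"
    by (rule nth_equalityI) (auto simp: nth_append simp del: upt_Suc)
  finally show ?thesis .
qed

section \<open>Laws of the quasi-shuffle sum\<close>

lemma qshuffle_add: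
  "qshuffle A xs ys (\<lambda>e w. F e w + G e w) = qshuffle A xs ys F + qshuffle A xs ys G"
proof (induction A xs ys F arbitrary: G rule: qshuffle.induct)
  case (3 A x xs y ys F)
  show ?case by (simp add: "3.IH") (simp only: ac_simps)
qed auto

lemma qshuffle_hom:
  assumes "h 0 = 0" "\<And>u v. h (u + v) = h u + h v"
  shows "h (qshuffle A xs ys F) = qshuffle A xs ys (\<lambda>e w. h (F e w))"
  by (induction A xs ys F rule: qshuffle.induct) (auto simp: assms)

text \<open>A relation that is compatible with addition passes from the summands to the sums. With suitable \<open>R\<close>
  this yields bounds for the support of a product as well as congruences.\<close>

lemma qshuffle_parametric:
  assumes "Group.monoid A" "set xs \<subseteq> carrier A" "set ys \<subseteq> carrier A"
    and "\<And>u v u' v'. R u v \<Longrightarrow> R u' v' \<Longrightarrow> R (u + u') (v + v')"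
    and "\<And>e w. set w \<subseteq> carrier A \<Longrightarrow> length xs \<le> length w \<Longrightarrow> length ys \<le> length w \<Longrightarrow> R (F e w) (G e w)"
  shows "R (qshuffle A xs ys F) (qshuffle A xs ys G)"
  using assms
proof (induction A xs ys F arbitrary: G rule: qshuffle.induct)
  case (3 A x xs y ys F)
  have "x \<otimes>\<^bsub>A\<^esub> y \<in> carrier A"
    using "3.prems" by (simp add: monoid.m_closed)
  then show ?case using "3.prems" unfolding qshuffle.simps
    by (intro "3.prems"(4) "3.IH") auto
qed auto

lemma qshuffle_commute:
  assumes "comm_monoid A" "set xs \<subseteq> carrier A" "set ys \<subseteq> carrier A"
  shows "qshuffle A xs ys F = qshuffle A ys xs F"
  using assms
proof (induction A xs ys F rule: qshuffle.induct)
  case (3 A x xs y ys F)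
  have "x \<otimes>\<^bsub>A\<^esub> y = y \<otimes>\<^bsub>A\<^esub> x"
    using "3.prems" by (simp add: comm_monoid.m_comm)
  then show ?case using 3 by (simp add: ac_simps)
qed auto

text \<open>Expanding both sides when no word is empty gives seven terms each, according to which letters
  are involved in the first letter of the result: one of \<open>x\<close>, \<open>y\<close>, \<open>z\<close>, a product of two of them, or
  the product of all three. Corresponding terms are instances of the claim for shorter words.\<close>

lemma qshuffle_assoc:
  fixes F :: "nat \<Rightarrow> 'a list \<Rightarrow> 'v::comm_monoid_add"
  assumes "Group.monoid A" "set xs \<subseteq> carrier A" "set ys \<subseteq> carrier A" "set zs \<subseteq> carrier A"
  shows "qshuffle A xs ys (\<lambda>e w. qshuffle A w zs (\<lambda>e' w'. F (e + e') w')) =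
    qshuffle A ys zs (\<lambda>e w. qshuffle A xs w (\<lambda>e' w'. F (e + e') w'))"
  using assms(2-)
proof (induction "length xs + length ys + length zs" arbitrary: xs ys zs F rule: less_induct)
  case less
  show ?case
  proof (cases "xs = [] \<or> ys = [] \<or> zs = []")
    case True
    then show ?thesis by auto
  next
    case False
    then obtain x p y q z r where xs: "xs = x # p" and ys: "ys = y # q" and zs: "zs = z # r"
      by (meson neq_Nil_conv)
    have IH: "qshuffle A xs' ys' (\<lambda>e w. qshuffle A w zs' (\<lambda>e' w'. G (e + e') w')) =
        qshuffle A ys' zs' (\<lambda>e w. qshuffle A xs' w (\<lambda>e' w'. G (e + e') w'))"
      if "xs' = xs \<or> xs' = p" "ys' = ys \<or> ys' = q" "zs' = zs \<or> zs' = r"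
        "xs' = p \<or> ys' = q \<or> zs' = r" for xs' ys' zs' and G :: "nat \<Rightarrow> 'a list \<Rightarrow> 'v"
      using that less.prems less.hyps[of xs' ys' zs' G]
      by (auto simp: xs ys zs)
    have assoc: "(x \<otimes>\<^bsub>A\<^esub> y) \<otimes>\<^bsub>A\<^esub> z = x \<otimes>\<^bsub>A\<^esub> (y \<otimes>\<^bsub>A\<^esub> z)"
      using less.prems by (intro monoid.m_assoc[OF assms(1)]) (auto simp: xs ys zs)
    let ?c = "\<lambda>a e w. F e (a # w)" and ?d = "\<lambda>a e w. F (Suc e) (a # w)"
    let ?L = "\<lambda>xs ys zs G. qshuffle A xs ys (\<lambda>e w. qshuffle A w zs (\<lambda>e' w'. G (e + e') w'))"
    let ?R = "\<lambda>xs ys zs G. qshuffle A ys zs (\<lambda>e w. qshuffle A xs w (\<lambda>e' w'. G (e + e') w'))"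
    have "?L xs ys zs F =
      ?L p ys zs (?c x) + ?L xs q zs (?c y) + ?L xs ys r (?c z) +
      ?L p q zs (?d (x \<otimes>\<^bsub>A\<^esub> y)) + ?L p ys r (?d (x \<otimes>\<^bsub>A\<^esub> z)) + ?L xs q r (?d (y \<otimes>\<^bsub>A\<^esub> z)) +
      ?L p q r (\<lambda>e w. F (Suc (Suc e)) (((x \<otimes>\<^bsub>A\<^esub> y) \<otimes>\<^bsub>A\<^esub> z) # w))"
      unfolding xs ys zs by (simp add: qshuffle_add) (simp only: ac_simps)
    moreover have "?R xs ys zs F =
      ?R p ys zs (?c x) + ?R xs q zs (?c y) + ?R xs ys r (?c z) +
      ?R p q zs (?d (x \<otimes>\<^bsub>A\<^esub> y)) + ?R p ys r (?d (x \<otimes>\<^bsub>A\<^esub> z)) + ?R xs q r (?d (y \<otimes>\<^bsub>A\<^esub> z)) +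
      ?R p q r (\<lambda>e w. F (Suc (Suc e)) ((x \<otimes>\<^bsub>A\<^esub> (y \<otimes>\<^bsub>A\<^esub> z)) # w))"
      unfolding xs ys zs by (simp add: qshuffle_add) (simp only: ac_simps)
    moreover have "?L p ys zs (?c x) = ?R p ys zs (?c x)" "?L xs q zs (?c y) = ?R xs q zs (?c y)"
      "?L xs ys r (?c z) = ?R xs ys r (?c z)"
      by (rule IH; simp)+
    moreover have "?L p q zs (?d (x \<otimes>\<^bsub>A\<^esub> y)) = ?R p q zs (?d (x \<otimes>\<^bsub>A\<^esub> y))"
      "?L p ys r (?d (x \<otimes>\<^bsub>A\<^esub> z)) = ?R p ys r (?d (x \<otimes>\<^bsub>A\<^esub> z))"
      "?L xs q r (?d (y \<otimes>\<^bsub>A\<^esub> z)) = ?R xs q r (?d (y \<otimes>\<^bsub>A\<^esub> z))"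
      by (rule IH; simp)+
    moreover have "?L p q r (\<lambda>e w. F (Suc (Suc e)) (((x \<otimes>\<^bsub>A\<^esub> y) \<otimes>\<^bsub>A\<^esub> z) # w)) =
       ?R p q r (\<lambda>e w. F (Suc (Suc e)) ((x \<otimes>\<^bsub>A\<^esub> (y \<otimes>\<^bsub>A\<^esub> z)) # w))"
      unfolding assoc by (rule IH; simp)
    ultimately show ?thesis by (simp only:)
  qed
qed

section \<open>The ring of formal sums of words\<close>

lemma additive_map:
  fixes h :: "'u::ab_group_add \<Rightarrow> 'v::ab_group_add"
  assumes "\<And>u v. h (u - v) = h u - h v"
  shows "h 0 = 0" "h (- u) = - h u" "h (u + v) = h u + h v"
proof -
  show 0: "h 0 = 0" using assms[of 0 0] by simp
  show m: "h (- u) = - h u" for u using assms[of 0 u] 0 by simp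
  show "h (u + v) = h u + h v" using assms[of u "- v"] m[of v] by simp
qed

lemma frag_extend_pointwise_diff:
  fixes f g :: "'b \<Rightarrow> ('a \<Rightarrow>\<^sub>0 int)"
  shows "frag_extend (\<lambda>x. f x - g x) u = frag_extend f u - frag_extend g u"
proof -
  have "frag_cmul c (a - b) = frag_cmul c a - frag_cmul c b" for c and a b :: "'a \<Rightarrow>\<^sub>0 int"
    by (rule poly_mapping_eqI) (simp add: lookup_minus right_diff_distrib)
  then show ?thesis by (simp add: frag_extend_def sum_subtractf[symmetric])
qed

lemma degree_part_diff: "degree_part k (u - v) = degree_part k u - degree_part k v"
  by (simp add: degree_part_def frag_extend_diff)

lemma degree_part_of: "degree_part k (frag_of w) = (if length w = Suc k then frag_of w else 0)"
  by (simp add: degree_part_def)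

lemmas degree_part_additive = additive_map[of "degree_part _", OF degree_part_diff]

lemma shuffle_frag_diff_left:
  "shuffle_frag C lam A (u - u') v = shuffle_frag C lam A u v - shuffle_frag C lam A u' v"
  by (simp add: shuffle_frag_def frag_extend_diff)

lemma shuffle_frag_diff_right:
  "shuffle_frag C lam A u (v - v') = shuffle_frag C lam A u v - shuffle_frag C lam A u v'"
  by (simp add: shuffle_frag_def frag_extend_diff frag_extend_pointwise_diff)

lemmas shuffle_frag_additive_left = additive_map[of "\<lambda>u. shuffle_frag _ _ _ u _", OF shuffle_frag_diff_left]
lemmas shuffle_frag_additive_right = additive_map[of "shuffle_frag _ _ _ _", OF shuffle_frag_diff_right]

text \<open>A word of length \<open>k + 1\<close> represents a tensor of degree \<open>k\<close>, and \<open>m\<close> is a lower bound for the degree.\<close>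

definition words_ge :: "('a,'m) ring_scheme \<Rightarrow> nat \<Rightarrow> 'a list set" where
  "words_ge A m = {w. Suc m \<le> length w \<and> set w \<subseteq> carrier A}"

definition scale_frag ::
  "('c,'a,'m) module_scheme \<Rightarrow> 'c \<Rightarrow> ('a list \<Rightarrow>\<^sub>0 int) \<Rightarrow> ('a list \<Rightarrow>\<^sub>0 int)" where
  "scale_frag A c = frag_extend (\<lambda>w. frag_of ((c \<odot>\<^bsub>A\<^esub> hd w) # tl w))"

definition prefix_frag ::
  "('a,'m) ring_scheme \<Rightarrow> ('a list \<Rightarrow>\<^sub>0 int) \<Rightarrow> ('a list \<Rightarrow>\<^sub>0 int)" where
  "prefix_frag A = frag_extend (\<lambda>w. frag_of (\<one>\<^bsub>A\<^esub> # w))"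

lemma scale_frag_diff: "scale_frag A c (u - v) = scale_frag A c u - scale_frag A c v"
  by (simp add: scale_frag_def frag_extend_diff)

lemma scale_frag_Cons [simp]: "scale_frag A c (frag_of (a # w)) = frag_of ((c \<odot>\<^bsub>A\<^esub> a) # w)"
  by (simp add: scale_frag_def)

lemmas scale_frag_additive = additive_map[of "scale_frag _ _", OF scale_frag_diff]

lemma prefix_frag_diff: "prefix_frag A (u - v) = prefix_frag A u - prefix_frag A v"
  by (simp add: prefix_frag_def frag_extend_diff)

lemma prefix_frag_of [simp]: "prefix_frag A (frag_of w) = frag_of (\<one>\<^bsub>A\<^esub> # w)"
  by (simp add: prefix_frag_def)

lemmas prefix_frag_additive = additive_map[of "prefix_frag _", OF prefix_frag_diff]

text \<open>Formal sums that vanish as tensors in all degrees up to \<open>n\<close>, with no condition on higher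
  degrees.\<close>

definition rel_upto ::
  "('c,'k) ring_scheme \<Rightarrow> ('c,'a,'m) module_scheme \<Rightarrow> nat \<Rightarrow> ('a list \<Rightarrow>\<^sub>0 int) set" where
  "rel_upto C A n =
     {u. Poly_Mapping.keys u \<subseteq> words_ge A 0 \<and> (\<forall>k\<le>n. degree_part k u \<in> tensor_rel C A k)}"

locale shuffle_algebra = algebra C A
  for C :: "('c,'k) ring_scheme" and A :: "('c,'a,'m) module_scheme" +
  fixes lam :: 'c
  assumes lam_closed [simp]: "lam \<in> carrier C"
begin

abbreviation smul (infixr "\<cdot>" 75) where "c \<cdot> a \<equiv> c \<odot>\<^bsub>A\<^esub> a"
abbreviation mulA (infixl "\<star>" 70) where "a \<star> b \<equiv> a \<otimes>\<^bsub>A\<^esub> b"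
abbreviation W where "W \<equiv> words_ge A"
abbreviation mul where "mul \<equiv> shuffle_frag C lam A"
abbreviation lpow where "lpow e \<equiv> lam [^]\<^bsub>C\<^esub> (e::nat)"

lemma smult_assoc2_right:
  "c \<in> carrier C \<Longrightarrow> a \<in> carrier A \<Longrightarrow> b \<in> carrier A \<Longrightarrow> a \<star> (c \<cdot> b) = c \<cdot> (a \<star> b)"
  by (simp add: m_comm[of a] smult_assoc2)

lemma smult_commute:
  "c \<in> carrier C \<Longrightarrow> d \<in> carrier C \<Longrightarrow> a \<in> carrier A \<Longrightarrow> c \<cdot> d \<cdot> a = d \<cdot> c \<cdot> a"
  by (simp add: smult_assoc1[symmetric] R.m_comm)

text \<open>The separate cases of \<^const>\<open>shuffle_words\<close> for words of length one fit the general formula, as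
  \<open>\<lambda>\<^sup>0 = 1\<close> acts trivially.\<close>

lemma shuffle_words_qshuffle:
  assumes "x0 \<in> carrier A" "y0 \<in> carrier A"
  shows "shuffle_words C lam A (x0 # xs) (y0 # ys) =
    qshuffle A xs ys (\<lambda>e w. frag_of ((lpow e \<cdot> (x0 \<star> y0)) # w))"
  using assms sum_mixable_shuffles[of "\<lambda>e w. frag_of ((lpow e \<cdot> (x0 \<star> y0)) # w)" A xs ys]
  by (cases "xs = []"; cases "ys = []") simp_all

lemma words_ge_Cons: "a # w \<in> W m \<longleftrightarrow> a \<in> carrier A \<and> set w \<subseteq> carrier A \<and> m \<le> length w"
  by (auto simp: words_ge_def)

lemma words_ge_cases:
  assumes "w \<in> W m"
  obtains a w' where "w = a # w'" "a \<in> carrier A" "set w' \<subseteq> carrier A" "m \<le> length w'"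
  using assms by (cases w) (auto simp: words_ge_def)

lemma words_ge_mono: "m \<le> n \<Longrightarrow> W n \<subseteq> W m"
  by (auto simp: words_ge_def)

lemma keys_diff_subset:
  "Poly_Mapping.keys u \<subseteq> S \<Longrightarrow> Poly_Mapping.keys v \<subseteq> S \<Longrightarrow> Poly_Mapping.keys (u - v) \<subseteq> S"
  using keys_diff[of u v] by auto

lemma keys_add_subset:
  "Poly_Mapping.keys u \<subseteq> S \<Longrightarrow> Poly_Mapping.keys v \<subseteq> S \<Longrightarrow> Poly_Mapping.keys (u + v) \<subseteq> S"
  using keys_add[of u v] by auto

lemma keys_of_subset [simp]: "Poly_Mapping.keys (frag_of w) \<subseteq> S \<longleftrightarrow> w \<in> S"
  by (simp add: keys_frag_of)

lemma mul_of: "mul (frag_of x) (frag_of y) = shuffle_words C lam A x y"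
  by (simp add: shuffle_frag_def)

lemma mul_words:
  assumes "x0 \<in> carrier A" "y0 \<in> carrier A"
  shows "mul (frag_of (x0 # xs)) (frag_of (y0 # ys)) =
    qshuffle A xs ys (\<lambda>e w. frag_of ((lpow e \<cdot> (x0 \<star> y0)) # w))"
  unfolding mul_of by (rule shuffle_words_qshuffle[OF assms])

lemma monoid_A: "Group.monoid A" by unfold_locales

text \<open>Merging turns one letter of each factor into a single letter, so no letter of a factor is lost and
  the length of the result is at least that of either factor.\<close>

lemma mul_words_keys:
  assumes "x \<in> W m" "y \<in> W 0"
  shows "Poly_Mapping.keys (mul (frag_of x) (frag_of y)) \<subseteq> W m"
proof -
  obtain a p where x: "x = a # p" "a \<in> carrier A" "set p \<subseteq> carrier A" "m \<le> length p"
    using assms(1) by (rule words_ge_cases)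
  obtain b q where y: "y = b # q" "b \<in> carrier A" "set q \<subseteq> carrier A"
    using assms(2) by (rule words_ge_cases)
  show ?thesis
    unfolding x(1) y(1) mul_words[OF x(2) y(2)]
  proof (rule qshuffle_parametric[OF monoid_A, where R = "\<lambda>u _. Poly_Mapping.keys u \<subseteq> W m" and G = "\<lambda>_ _. 0::nat"])
    show "Poly_Mapping.keys (u + u') \<subseteq> W m"
      if "Poly_Mapping.keys u \<subseteq> W m" "Poly_Mapping.keys u' \<subseteq> W m" for u u'
      using that by (rule keys_add_subset)
  qed (use x y in \<open>auto simp: words_ge_Cons\<close>)
qed

lemma mul_keys:
  assumes "Poly_Mapping.keys u \<subseteq> W m" "Poly_Mapping.keys v \<subseteq> W 0"
  shows "Poly_Mapping.keys (mul u v) \<subseteq> W m"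
  using assms(1)
proof (induction u rule: frag_induction)
  case (one x)
  show ?case using assms(2)
  proof (induction v rule: frag_induction)
    case (one y)
    then show ?case using \<open>x \<in> W m\<close> by (rule mul_words_keys[rotated])
  qed (simp_all add: shuffle_frag_additive_right shuffle_frag_diff_right keys_diff_subset)
qed (simp_all add: shuffle_frag_additive_left shuffle_frag_diff_left keys_diff_subset)

lemma bilinear_words_induct [consumes 2, case_names words left_zero left right_zero right]:
  assumes "Poly_Mapping.keys u \<subseteq> W 0" "Poly_Mapping.keys v \<subseteq> W 0"
    and "\<And>a p b q. a \<in> carrier A \<Longrightarrow> set p \<subseteq> carrier A \<Longrightarrow> b \<in> carrier A \<Longrightarrow> set q \<subseteq> carrier A \<Longrightarrow>
        P (frag_of (a # p)) (frag_of (b # q))"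
    and left: "\<And>v. P 0 v" "\<And>u u' v. P u v \<Longrightarrow> P u' v \<Longrightarrow> P (u - u') v"
    and right: "\<And>u. P u 0" "\<And>u v v'. P u v \<Longrightarrow> P u v' \<Longrightarrow> P u (v - v')"
  shows "P u v"
  using assms(1)
proof (induction u rule: frag_induction)
  case (one x)
  show ?case using assms(2)
  proof (induction v rule: frag_induction)
    case (one y)
    show ?case using \<open>x \<in> W 0\<close> \<open>y \<in> W 0\<close> by (elim words_ge_cases) (simp add: assms(3))
  qed (auto intro: right)
qed (auto intro: left)

text \<open>An identity of formal sums, without recourse to the tensor relations; the same holds for the
  associativity below.\<close>

lemma mul_commute:
  assumes "Poly_Mapping.keys u \<subseteq> W 0" "Poly_Mapping.keys v \<subseteq> W 0"
  shows "mul u v = mul v u"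
  using assms
proof (induction u v rule: bilinear_words_induct)
  case (words a p b q)
  have "comm_monoid A" by unfold_locales
  then show ?case using words
    by (simp add: mul_words m_comm[of a] qshuffle_commute[of A p q])
qed (simp_all add: shuffle_frag_additive_left shuffle_frag_diff_left shuffle_frag_additive_right shuffle_frag_diff_right)

lemma mul_qshuffle_left: "mul (qshuffle A p q F) v = qshuffle A p q (\<lambda>e w. mul (F e w) v)"
  by (rule qshuffle_hom[where h = "\<lambda>u. mul u v"]) (simp_all add: shuffle_frag_additive_left)

lemma mul_qshuffle_right: "mul u (qshuffle A p q F) = qshuffle A p q (\<lambda>e w. mul u (F e w))"
  by (rule qshuffle_hom[where h = "mul u"]) (simp_all add: shuffle_frag_additive_right)

text \<open>Both bracketings multiply the zeroth letter \<open>a b c\<close> by a power of \<open>\<lambda>\<close> whose exponent is the total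
  number of merged pairs.\<close>

lemma mul_assoc_words:
  assumes "a \<in> carrier A" "set p \<subseteq> carrier A" "b \<in> carrier A" "set q \<subseteq> carrier A"
    "c \<in> carrier A" "set r \<subseteq> carrier A"
  shows "mul (mul (frag_of (a # p)) (frag_of (b # q))) (frag_of (c # r)) =
         mul (frag_of (a # p)) (mul (frag_of (b # q)) (frag_of (c # r)))"
proof -
  let ?F = "\<lambda>e w. frag_of ((lpow e \<cdot> (a \<star> b \<star> c)) # w)"
  have "mul (mul (frag_of (a # p)) (frag_of (b # q))) (frag_of (c # r)) =
      qshuffle A p q (\<lambda>e w. qshuffle A w r (\<lambda>e' w'. ?F (e + e') w'))"
    using assms
    by (simp add: mul_words mul_qshuffle_left smult_assoc2 smult_assoc1[symmetric] R.nat_pow_mult R.m_comm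
        add.commute)
  also have "\<dots> = qshuffle A q r (\<lambda>e w. qshuffle A p w (\<lambda>e' w'. ?F (e + e') w'))"
    using assms by (intro qshuffle_assoc[OF monoid_A])
  also have "\<dots> = mul (frag_of (a # p)) (mul (frag_of (b # q)) (frag_of (c # r)))"
    using assms
    by (simp add: mul_words mul_qshuffle_right smult_assoc2_right smult_assoc1[symmetric] R.nat_pow_mult
        m_assoc add.commute)
  finally show ?thesis .
qed

lemma mul_assoc:
  assumes "Poly_Mapping.keys u \<subseteq> W 0" "Poly_Mapping.keys v \<subseteq> W 0" "Poly_Mapping.keys w \<subseteq> W 0"
  shows "mul (mul u v) w = mul u (mul v w)"
  using assms(1,2)
proof (induction u v rule: bilinear_words_induct)
  case (words a p b q)
  show ?case using assms(3)
  proof (induction w rule: frag_induction)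
    case (one z)
    then show ?case using words by (elim words_ge_cases) (simp add: mul_assoc_words)
  qed (simp_all add: shuffle_frag_additive_right shuffle_frag_diff_right)
qed (simp_all add: shuffle_frag_additive_left shuffle_frag_diff_left shuffle_frag_additive_right shuffle_frag_diff_right)

lemma mul_one:
  assumes "Poly_Mapping.keys v \<subseteq> W 0"
  shows "mul (frag_of [\<one>\<^bsub>A\<^esub>]) v = v"
  using assms
proof (induction v rule: frag_induction)
  case (one y)
  then show ?case by (elim words_ge_cases) (simp add: mul_words)
qed (simp_all add: shuffle_frag_additive_right shuffle_frag_diff_right)

lemma mul_scale:
  assumes "c \<in> carrier C" "Poly_Mapping.keys u \<subseteq> W 0" "Poly_Mapping.keys v \<subseteq> W 0"
  shows "mul (scale_frag A c u) v = scale_frag A c (mul u v)"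
  using assms(2,3)
proof (induction u v rule: bilinear_words_induct)
  case (words a p b q)
  have "scale_frag A c (qshuffle A p q F) = qshuffle A p q (\<lambda>e w. scale_frag A c (F e w))" for F
    by (rule qshuffle_hom) (simp_all add: scale_frag_additive)
  then show ?case using words assms(1)
    by (simp add: mul_words smult_assoc2 smult_commute[of c])
qed (simp_all add: shuffle_frag_additive_left shuffle_frag_diff_left shuffle_frag_additive_right
   shuffle_frag_diff_right scale_frag_additive scale_frag_diff)

lemma scale_keys:
  assumes "c \<in> carrier C" "Poly_Mapping.keys u \<subseteq> W m"
  shows "Poly_Mapping.keys (scale_frag A c u) \<subseteq> W m"
  using assms(2)
proof (induction u rule: frag_induction)
  case (one y)
  then show ?case using assms(1) by (elim words_ge_cases) (simp add: words_ge_Cons)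
qed (simp_all add: scale_frag_additive scale_frag_diff keys_diff_subset)

lemma prefix_keys:
  assumes "Poly_Mapping.keys u \<subseteq> W m"
  shows "Poly_Mapping.keys (prefix_frag A u) \<subseteq> W (Suc m)"
  using assms
proof (induction u rule: frag_induction)
  case (one y)
  then show ?case by (simp add: words_ge_def)
qed (simp_all add: prefix_frag_additive prefix_frag_diff keys_diff_subset)

lemma scale_scale:
  assumes "c \<in> carrier C" "d \<in> carrier C" "Poly_Mapping.keys u \<subseteq> W 0"
  shows "scale_frag A (c \<otimes>\<^bsub>C\<^esub> d) u = scale_frag A c (scale_frag A d u)"
  using assms(3)
proof (induction u rule: frag_induction)
  case (one y)
  then show ?case using assms(1,2) by (elim words_ge_cases) (simp add: smult_assoc1)
qed (simp_all add: scale_frag_additive scale_frag_diff)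

lemma scale_one:
  assumes "Poly_Mapping.keys u \<subseteq> W 0"
  shows "scale_frag A \<one>\<^bsub>C\<^esub> u = u"
  using assms
proof (induction u rule: frag_induction)
  case (one y)
  then show ?case by (elim words_ge_cases) simp
qed (simp_all add: scale_frag_additive scale_frag_diff)

section \<open>The tensor relations are stable under all operations\<close>

abbreviation N where "N \<equiv> rel_upto C A"

lemma word_update_closed:
  assumes "w \<in> words A k" "a \<in> carrier A"
  shows "w[i := a] \<in> words A k"
  using assms set_update_subset_insert[of w i a] by (auto simp: words_def)

lemma word_nth_closed: "w \<in> words A k \<Longrightarrow> i \<le> k \<Longrightarrow> w ! i \<in> carrier A"
  by (auto simp: words_def)

lemma words_subset: "words A k \<subseteq> W 0"
  by (auto simp: words_def words_ge_def)

lemma relators_keys: "r \<in> tensor_relators C A k \<Longrightarrow> Poly_Mapping.keys r \<subseteq> words A k"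
  unfolding tensor_relators_def
  by (elim UnE CollectE exE conjE; hypsubst; intro keys_diff_subset;
      simp add: word_update_closed word_nth_closed)

lemma relator_additive:
  assumes "w \<in> words A k" "i \<le> k" "a \<in> carrier A" "b \<in> carrier A"
  shows "frag_of (w[i := a \<oplus>\<^bsub>A\<^esub> b]) - frag_of (w[i := a]) - frag_of (w[i := b]) \<in> tensor_relators C A k"
  unfolding tensor_relators_def
  by (intro UnI1 CollectI exI conjI) (rule refl assms)+

lemma relator_scalar:
  assumes "w \<in> words A k" "i \<le> k" "j \<le> k" "c \<in> carrier C"
  shows "frag_of (w[i := c \<cdot> (w ! i)]) - frag_of (w[j := c \<cdot> (w ! j)]) \<in> tensor_relators C A k"
  unfolding tensor_relators_def
  by (intro UnI2 CollectI exI conjI) (rule refl assms)+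

lemma relators_carrier: "tensor_relators C A k \<subseteq> carrier (free_Abelian_group (words A k))"
  by (intro subsetI) (simp add: relators_keys)

lemma tensor_rel_keys: "r \<in> tensor_rel C A k \<Longrightarrow> Poly_Mapping.keys r \<subseteq> words A k"
  using group.generate_in_carrier[OF group_free_Abelian_group, of "tensor_relators C A k" "words A k" r]
    relators_carrier unfolding tensor_rel_def by simp

lemma tensor_rel_subgroup: "subgroup (tensor_rel C A k) (free_Abelian_group (words A k))"
  unfolding tensor_rel_def
  by (rule group.generate_is_subgroup[OF group_free_Abelian_group relators_carrier])

lemma tensor_rel_zero: "0 \<in> tensor_rel C A k"
  using subgroup.one_closed[OF tensor_rel_subgroup] by simp

lemma tensor_rel_minus: "u \<in> tensor_rel C A k \<Longrightarrow> - u \<in> tensor_rel C A k"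
  using subgroup.m_inv_closed[OF tensor_rel_subgroup, of u k] tensor_rel_keys[of u k] by simp

lemma tensor_rel_add: "u \<in> tensor_rel C A k \<Longrightarrow> v \<in> tensor_rel C A k \<Longrightarrow> u + v \<in> tensor_rel C A k"
  using subgroup.m_closed[OF tensor_rel_subgroup, of u k v] by simp

lemma tensor_rel_diff: "u \<in> tensor_rel C A k \<Longrightarrow> v \<in> tensor_rel C A k \<Longrightarrow> u - v \<in> tensor_rel C A k"
  using tensor_rel_add[of u k "- v"] tensor_rel_minus[of v k] by simp

lemma tensor_rel_induct [consumes 1, case_names relator zero diff]:
  assumes "r \<in> tensor_rel C A k"
    and relator: "\<And>r. r \<in> tensor_relators C A k \<Longrightarrow> P r" and zero: "P 0"
    and diff: "\<And>u v. P u \<Longrightarrow> P v \<Longrightarrow> P (u - v)"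
  shows "P r"
  using assms(1) unfolding tensor_rel_def
proof (induction r rule: generate.induct)
  case (inv h)
  then show ?case using diff[OF zero relator[of h]] relators_keys by simp
next
  case (eng u v)
  then show ?case using diff[of u "- v"] diff[OF zero, of v] by simp
qed (auto intro: relator zero)

lemma degree_part_same:
  "Poly_Mapping.keys u \<subseteq> words A k \<Longrightarrow> degree_part j u = (if j = k then u else 0)"
proof (induction u rule: frag_induction)
  case (one w)
  then show ?case by (auto simp: degree_part_of words_def)
qed (simp_all add: degree_part_additive degree_part_diff)

lemma degree_part_long: "Poly_Mapping.keys u \<subseteq> W (Suc n) \<Longrightarrow> k \<le> n \<Longrightarrow> degree_part k u = 0"
proof (induction u rule: frag_induction)
  case (one w)
  then show ?case by (auto simp: degree_part_of words_ge_def)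
qed (simp_all add: degree_part_additive degree_part_diff)

lemma degree_part_keys: "Poly_Mapping.keys u \<subseteq> W 0 \<Longrightarrow> Poly_Mapping.keys (degree_part k u) \<subseteq> words A k"
proof (induction u rule: frag_induction)
  case (one w)
  then show ?case by (auto simp: degree_part_of words_ge_def words_def)
qed (simp_all add: degree_part_additive degree_part_diff keys_diff_subset)

text \<open>What remains after removing the parts of degree up to \<open>n\<close> has only words of higher degree.\<close>

lemma degree_parts_rest:
  assumes "Poly_Mapping.keys u \<subseteq> W 0"
  shows "Poly_Mapping.keys (u - (\<Sum>k\<le>n. degree_part k u)) \<subseteq> W (Suc n)"
  using assms
proof (induction u rule: frag_induction)
  case (one w)
  then show ?case
    by (cases "length w \<le> Suc n"; cases "length w") (auto simp: degree_part_of words_ge_def)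
next
  case (diff a b)
  have "a - b - (\<Sum>k\<le>n. degree_part k (a - b)) =
    (a - (\<Sum>k\<le>n. degree_part k a)) - (b - (\<Sum>k\<le>n. degree_part k b))"
    by (simp add: degree_part_diff sum_subtractf)
  then show ?case using diff by (metis keys_diff_subset)
qed (simp add: degree_part_additive)

lemma N_keys: "u \<in> N n \<Longrightarrow> Poly_Mapping.keys u \<subseteq> W 0"
  by (simp add: rel_upto_def)

lemma N_zero: "0 \<in> N n"
  by (simp add: rel_upto_def degree_part_additive tensor_rel_zero)

lemma N_diff: "u \<in> N n \<Longrightarrow> v \<in> N n \<Longrightarrow> u - v \<in> N n"
  by (simp add: rel_upto_def degree_part_diff tensor_rel_diff keys_diff_subset)

lemma N_minus: "u \<in> N n \<Longrightarrow> - u \<in> N n"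
  using N_diff[OF N_zero, of u n] by simp

lemma N_add: "u \<in> N n \<Longrightarrow> v \<in> N n \<Longrightarrow> u + v \<in> N n"
  using N_diff[of u n "- v"] N_minus[of v n] by simp

lemma N_diff_add: "u - v \<in> N n \<Longrightarrow> u' - v' \<in> N n \<Longrightarrow> (u + u') - (v + v') \<in> N n"
  using N_add[of "u - v" n "u' - v'"] by (simp add: algebra_simps)

lemma tensor_rel_N: "r \<in> tensor_rel C A k \<Longrightarrow> r \<in> N n"
  using tensor_rel_keys[of r k] words_subset[of k]
  by (auto simp: rel_upto_def degree_part_same tensor_rel_zero)

lemma relators_N: "r \<in> tensor_relators C A k \<Longrightarrow> r \<in> N n"
  by (rule tensor_rel_N[of r k]) (simp add: tensor_rel_def generate.incl)

lemma long_N: "Poly_Mapping.keys u \<subseteq> W (Suc n) \<Longrightarrow> u \<in> N n"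
  using words_ge_mono[of 0 "Suc n"] by (auto simp: rel_upto_def degree_part_long tensor_rel_zero)

text \<open>An element that vanishes up to degree \<open>n\<close> is the sum of its parts of degree up to \<open>n\<close>, which are
  combinations of relators, and of a remainder of higher degree.\<close>

lemma N_induct [consumes 1, case_names long relator diff]:
  assumes "u \<in> N n"
    and long: "\<And>u. Poly_Mapping.keys u \<subseteq> W (Suc n) \<Longrightarrow> P u"
    and relator: "\<And>r k. r \<in> tensor_relators C A k \<Longrightarrow> P r"
    and diff: "\<And>u v. P u \<Longrightarrow> P v \<Longrightarrow> P (u - v)"
  shows "P u"
proof -
  have zero: "P 0" by (rule long) simp
  have add: "P (u + v)" if "P u" "P v" for u v
    using diff[OF that(1) diff[OF zero that(2)]] by simp
  have tensor: "P (degree_part k u)" if "k \<le> n" for k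
  proof -
    have "degree_part k u \<in> tensor_rel C A k" using assms(1) that by (simp add: rel_upto_def)
    then show ?thesis by (induction rule: tensor_rel_induct) (auto intro: relator zero diff)
  qed
  have "P (\<Sum>k\<in>K. degree_part k u)" if "finite K" "K \<subseteq> {..n}" for K
    using that by (induction K rule: finite_induct) (simp_all add: zero add tensor)
  then have "P (\<Sum>k\<le>n. degree_part k u)" by blast
  moreover have "P (u - (\<Sum>k\<le>n. degree_part k u))"
    by (rule long[OF degree_parts_rest[OF N_keys[OF assms(1)]]])
  ultimately have "P ((u - (\<Sum>k\<le>n. degree_part k u)) + (\<Sum>k\<le>n. degree_part k u))"
    by (rule add[rotated])
  then show ?thesis by simp
qed

text \<open>Being \<open>C\<close>-linear modulo the relations. On formal sums \<open>C\<close> acts through the zeroth letter; comparing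
  every scalar with its action there replaces the relators for pairs of positions by a condition
  on one position.\<close>

definition lin :: "nat \<Rightarrow> ('a \<Rightarrow> 'a list \<Rightarrow>\<^sub>0 int) \<Rightarrow> bool" where
  "lin n h \<longleftrightarrow>
     (\<forall>a\<in>carrier A. \<forall>b\<in>carrier A. h (a \<oplus>\<^bsub>A\<^esub> b) - h a - h b \<in> N n) \<and>
     (\<forall>c\<in>carrier C. \<forall>a\<in>carrier A. h (c \<cdot> a) - scale_frag A c (h a) \<in> N n)"

lemma lin_add: "lin n g \<Longrightarrow> lin n h \<Longrightarrow> lin n (\<lambda>a. g a + h a)"
  unfolding lin_def
proof (intro conjI ballI, goal_cases)
  case (1 a b)
  then have "(g (a \<oplus>\<^bsub>A\<^esub> b) - g a - g b) + (h (a \<oplus>\<^bsub>A\<^esub> b) - h a - h b) \<in> N n"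
    by (intro N_add) auto
  then show ?case by (simp add: algebra_simps)
next
  case (2 c a)
  then have "(g (c \<cdot> a) - scale_frag A c (g a)) + (h (c \<cdot> a) - scale_frag A c (h a)) \<in> N n"
    by (intro N_add) auto
  then show ?case by (simp add: scale_frag_additive algebra_simps)
qed

lemma lin_mult: "lin n h \<Longrightarrow> y \<in> carrier A \<Longrightarrow> lin n (\<lambda>a. h (a \<star> y))"
  unfolding lin_def by (auto simp: l_distr smult_assoc2)

lemma move_scalar:
  assumes "c \<in> carrier C" "set p \<subseteq> carrier A" "a \<in> carrier A" "set q \<subseteq> carrier A"
  shows "frag_of (p @ (c \<cdot> a) # q) - scale_frag A c (frag_of (p @ a # q)) \<in> N n"
proof -
  let ?w = "p @ a # q" and ?k = "length p + length q"
  have w: "?w \<in> words A ?k" using assms by (auto simp: words_def)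
  have "frag_of (?w[length p := c \<cdot> (?w ! length p)]) - frag_of (?w[0 := c \<cdot> (?w ! 0)])
      \<in> tensor_relators C A ?k"
    using w assms(1) by (intro relator_scalar) auto
  then have "frag_of (?w[length p := c \<cdot> (?w ! length p)]) - frag_of (?w[0 := c \<cdot> (?w ! 0)]) \<in> N n"
    by (rule relators_N)
  then show ?thesis by (cases p) auto
qed

lemma lin_word:
  assumes "set p \<subseteq> carrier A" "set q \<subseteq> carrier A"
  shows "lin n (\<lambda>a. frag_of (p @ a # q))"
  unfolding lin_def
proof (intro conjI ballI)
  fix a b assume ab: "a \<in> carrier A" "b \<in> carrier A"
  let ?w = "p @ a # q" and ?k = "length p + length q"
  have w: "?w \<in> words A ?k" using assms ab by (auto simp: words_def)
  have "frag_of (?w[length p := a \<oplus>\<^bsub>A\<^esub> b]) - frag_of (?w[length p := a]) - frag_of (?w[length p := b])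
      \<in> tensor_relators C A ?k"
    using w ab by (intro relator_additive) auto
  then have "frag_of (?w[length p := a \<oplus>\<^bsub>A\<^esub> b]) - frag_of (?w[length p := a]) - frag_of (?w[length p := b]) \<in> N n"
    by (rule relators_N)
  then show "frag_of (p @ (a \<oplus>\<^bsub>A\<^esub> b) # q) - frag_of (p @ a # q) - frag_of (p @ b # q) \<in> N n" by simp
qed (use assms move_scalar in auto)

text \<open>The relators say precisely that a word is linear in each letter. A relator that moves a scalar from
  position \<open>i\<close> to position \<open>j\<close> is the difference of two instances of linearity, in which the terms
  with the scalar at the zeroth letter cancel.\<close>

lemma additive_preserves_relators:
  assumes h: "\<And>u v. h (u - v) = h u - h v"
    and lin: "\<And>p q. set p \<subseteq> carrier A \<Longrightarrow> set q \<subseteq> carrier A \<Longrightarrow> lin n (\<lambda>a. h (frag_of (p @ a # q)))"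
    and r: "r \<in> tensor_relators C A k"
  shows "h r \<in> N n"
proof -
  have upd: "w[i := b] = take i w @ b # drop (Suc i) w" and nth: "w = take i w @ w ! i # drop (Suc i) w"
    and lin': "lin n (\<lambda>a. h (frag_of (take i w @ a # drop (Suc i) w)))"
    if "w \<in> words A k" "i \<le> k" for w i b
  proof -
    have l: "i < length w" "set w \<subseteq> carrier A" using that by (auto simp: words_def)
    show "w[i := b] = take i w @ b # drop (Suc i) w" using l by (simp add: upd_conv_take_nth_drop)
    show "w = take i w @ w ! i # drop (Suc i) w" using l by (simp add: id_take_nth_drop)
    show "lin n (\<lambda>a. h (frag_of (take i w @ a # drop (Suc i) w)))"
      using l set_take_subset[of i w] set_drop_subset[of "Suc i" w] by (intro lin) blast+
  qed
  from r consider
    w i a b where "w \<in> words A k" "i \<le> k" "a \<in> carrier A" "b \<in> carrier A"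
      "r = frag_of (w[i := a \<oplus>\<^bsub>A\<^esub> b]) - frag_of (w[i := a]) - frag_of (w[i := b])"
  | w i j c where "w \<in> words A k" "i \<le> k" "j \<le> k" "c \<in> carrier C"
      "r = frag_of (w[i := c \<cdot> (w ! i)]) - frag_of (w[j := c \<cdot> (w ! j)])"
    unfolding tensor_relators_def by blast
  then show ?thesis
  proof cases
    case 1
    then show ?thesis using lin'[OF 1(1,2)] by (simp add: h upd[OF 1(1,2)] lin_def)
  next
    case 2
    have *: "h (frag_of (w[i := c \<cdot> (w ! i)])) - scale_frag A c (h (frag_of w)) \<in> N n" if "i \<le> k" for i
    proof -
      have "h (frag_of (take i w @ (c \<cdot> (w ! i)) # drop (Suc i) w)) -
         scale_frag A c (h (frag_of (take i w @ (w ! i) # drop (Suc i) w))) \<in> N n"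
        using lin'[OF 2(1) that] 2(4) word_nth_closed[OF 2(1) that] by (auto simp: lin_def)
      then show ?thesis using nth[OF 2(1) that] by (simp add: upd[OF 2(1) that])
    qed
    show ?thesis using N_diff[OF *[OF 2(2)] *[OF 2(3)]] by (simp add: 2(5) h)
  qed
qed

lemma lin_qshuffle_values:
  assumes "set xs \<subseteq> carrier A" "set ys \<subseteq> carrier A"
    and "\<And>e w. set w \<subseteq> carrier A \<Longrightarrow> lin n (\<lambda>a. F a e w)"
  shows "lin n (\<lambda>a. qshuffle A xs ys (F a))"
  using assms
proof (induction "length xs + length ys" arbitrary: xs ys F rule: less_induct)
  case less
  show ?case
  proof (cases "xs = [] \<or> ys = []")
    case True
    then show ?thesis using less.prems by auto
  next
    case False
    then obtain x p y q where "xs = x # p" "ys = y # q" by (meson neq_Nil_conv)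
    then show ?thesis using less.prems
      by (auto intro!: lin_add less.hyps)
  qed
qed

text \<open>Each branch of the recursion either keeps the distinguished letter in its word, or prefixes it to
  the result, or prefixes its product with a letter \<open>y\<close>, and multiplication by \<open>y\<close> is linear.\<close>

lemma lin_qshuffle_letter:
  assumes "set p \<subseteq> carrier A" "set q \<subseteq> carrier A" "set ys \<subseteq> carrier A"
    and "\<And>e p q. set p \<subseteq> carrier A \<Longrightarrow> set q \<subseteq> carrier A \<Longrightarrow> lin n (\<lambda>a. F e (p @ a # q))"
  shows "lin n (\<lambda>a. qshuffle A (p @ a # q) ys F)"
  using assms
proof (induction "length p + length ys" arbitrary: p ys F rule: less_induct)
  case less
  show ?case
  proof (cases ys)
    case Nil
    then show ?thesis using less.prems by simp
  next
    case ys: (Cons y ys')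
    have y: "y \<in> carrier A" "set ys' \<subseteq> carrier A" using less.prems ys by auto
    have cons: "lin n (\<lambda>a. F e (b # p @ a # q))" if "set p \<subseteq> carrier A" "set q \<subseteq> carrier A" "b \<in> carrier A" for e p q b
      using less.prems(4)[of "b # p" q e] that by simp
    show ?thesis
    proof (cases p)
      case Nil
      have "lin n (\<lambda>a. qshuffle A (a # q) ys' (\<lambda>e w. F e (y # w)))"
        using less.hyps[of "[]" ys' "\<lambda>e w. F e (y # w)"] less.prems y cons by (simp add: ys Nil)
      moreover have "lin n (\<lambda>a. qshuffle A q (y # ys') (\<lambda>e w. F e (a # w)))"
        using y less.prems(2) less.prems(4)[of "[]"] by (intro lin_qshuffle_values) auto
      moreover have "lin n (\<lambda>a. qshuffle A q ys' (\<lambda>e w. F (Suc e) ((a \<star> y) # w)))"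
        using y less.prems(2) lin_mult[OF less.prems(4)[of "[]"]] by (intro lin_qshuffle_values) auto
      ultimately show ?thesis by (simp add: Nil ys lin_add)
    next
      case (Cons x p')
      have x: "x \<in> carrier A" "set p' \<subseteq> carrier A" using less.prems Cons by auto
      have "lin n (\<lambda>a. qshuffle A (p' @ a # q) ys (\<lambda>e w. F e (x # w)))"
        using less.hyps[of p' ys "\<lambda>e w. F e (x # w)"] less.prems x cons by (simp add: ys Cons)
      moreover have "lin n (\<lambda>a. qshuffle A (p @ a # q) ys' (\<lambda>e w. F e (y # w)))"
        using less.hyps[of p ys' "\<lambda>e w. F e (y # w)"] less.prems x y cons by (simp add: ys Cons)
      moreover have "lin n (\<lambda>a. qshuffle A (p' @ a # q) ys' (\<lambda>e w. F (Suc e) ((x \<star> y) # w)))"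
        using less.hyps[of p' ys' "\<lambda>e w. F (Suc e) ((x \<star> y) # w)"] less.prems x y cons by (simp add: ys Cons)
      ultimately show ?thesis by (simp add: Cons ys lin_add)
    qed
  qed
qed

text \<open>Zeroth letters are multiplied and take no part in shuffling, so they need a separate case.\<close>

lemma lin_mul_word:
  assumes "set p \<subseteq> carrier A" "set q \<subseteq> carrier A" "y \<in> carrier A" "set ys \<subseteq> carrier A"
  shows "lin n (\<lambda>a. mul (frag_of (p @ a # q)) (frag_of (y # ys)))"
proof (cases p)
  case Nil
  have "lin n (\<lambda>a. frag_of ((lpow e \<cdot> (a \<star> y)) # w))" if "set w \<subseteq> carrier A" for e w
  proof -
    have "lin n (\<lambda>a. frag_of ((a \<star> (lpow e \<cdot> y)) # w))"
      using lin_mult[OF lin_word[of "[]" w], of "lpow e \<cdot> y"] that assms by simp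
    then show ?thesis unfolding lin_def using assms
      by (simp add: smult_assoc2_right)
  qed
  then have "lin n (\<lambda>a. qshuffle A q ys (\<lambda>e w. frag_of ((lpow e \<cdot> (a \<star> y)) # w)))"
    using assms by (intro lin_qshuffle_values) auto
  then show ?thesis using assms unfolding lin_def Nil by (simp add: mul_words)
next
  case (Cons x p')
  have "lin n (\<lambda>a. frag_of ((lpow e \<cdot> (x \<star> y)) # p @ a # q))" if "set p \<subseteq> carrier A" "set q \<subseteq> carrier A" for e p q
    using lin_word[of "(lpow e \<cdot> (x \<star> y)) # p" q] assms Cons that by simp
  then have "lin n (\<lambda>a. qshuffle A (p' @ a # q) ys (\<lambda>e w. frag_of ((lpow e \<cdot> (x \<star> y)) # w)))"
    using assms Cons by (intro lin_qshuffle_letter) auto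
  then show ?thesis using assms Cons by (simp add: mul_words)
qed

text \<open>This is what makes the shuffle product of tensors well defined, also for families that are known
  only up to degree \<open>n\<close>.\<close>

lemma N_mul:
  assumes "u \<in> N n" "Poly_Mapping.keys v \<subseteq> W 0"
  shows "mul u v \<in> N n"
  using assms(1)
proof (induction rule: N_induct)
  case (long u)
  show ?case using mul_keys[OF long assms(2)] by (rule long_N)
next
  case (relator r k)
  show ?case using assms(2)
  proof (induction v rule: frag_induction)
    case (one y)
    then obtain b q where y: "y = b # q" "b \<in> carrier A" "set q \<subseteq> carrier A" by (rule words_ge_cases)
    show ?case unfolding y(1)
      by (rule additive_preserves_relators[where h = "\<lambda>u. mul u (frag_of (b # q))", OF shuffle_frag_diff_left lin_mul_word relator])
        (use y in auto)
  qed (simp_all add: shuffle_frag_additive_right shuffle_frag_diff_right N_zero N_diff)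
qed (simp_all add: shuffle_frag_diff_left N_diff)

text \<open>Prefixing the unit raises the degree, hence also the degree up to which an element vanishes.\<close>

lemma N_prefix:
  assumes "u \<in> N n"
  shows "prefix_frag A u \<in> N (Suc n)"
  using assms
proof (induction rule: N_induct)
  case (long u)
  then show ?case by (intro long_N prefix_keys)
next
  case (relator r k)
  show ?case
    by (rule additive_preserves_relators[where h = "prefix_frag A", OF prefix_frag_diff _ relator])
      (use lin_word[of "\<one>\<^bsub>A\<^esub> # _"] in auto)
qed (simp_all add: prefix_frag_diff N_diff)

lemma N_scale:
  assumes "c \<in> carrier C" "u \<in> N n"
  shows "scale_frag A c u \<in> N n"
  using assms(2)
proof (induction rule: N_induct)
  case (long u)
  then show ?case using assms(1) by (intro long_N scale_keys)
next
  case (relator r k)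
  show ?case
  proof (rule additive_preserves_relators[where h = "scale_frag A c", OF scale_frag_diff _ relator])
    fix p q assume pq: "set p \<subseteq> carrier A" "set q \<subseteq> carrier A"
    show "lin n (\<lambda>a. scale_frag A c (frag_of (p @ a # q)))"
    proof (cases p)
      case Nil
      then show ?thesis
        using lin_word[of "[]" q n] assms(1) pq unfolding lin_def
        by (simp add: smult_r_distr smult_commute[of c])
    next
      case (Cons x p')
      then show ?thesis using lin_word[of "(c \<cdot> x) # p'" q n] assms(1) pq by simp
    qed
  qed
qed (simp_all add: scale_frag_diff N_diff)

lemma scale_add_scalars:
  assumes "c \<in> carrier C" "d \<in> carrier C" "Poly_Mapping.keys u \<subseteq> W 0"
  shows "scale_frag A (c \<oplus>\<^bsub>C\<^esub> d) u - (scale_frag A c u + scale_frag A d u) \<in> N n"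
  using assms(3)
proof (induction u rule: frag_induction)
  case (one y)
  then obtain b q where y: "y = b # q" "b \<in> carrier A" "set q \<subseteq> carrier A" by (rule words_ge_cases)
  have "c \<cdot> b \<in> carrier A" "d \<cdot> b \<in> carrier A" using y assms by auto
  then have "frag_of (((c \<cdot> b) \<oplus>\<^bsub>A\<^esub> (d \<cdot> b)) # q) - frag_of ((c \<cdot> b) # q) - frag_of ((d \<cdot> b) # q) \<in> N n"
    using lin_word[of "[]" q n] y unfolding lin_def by simp
  then show ?case using y assms by (simp add: smult_l_distr diff_diff_eq)
next
  case (diff a b)
  then show ?case using N_diff[OF diff] by (simp add: scale_frag_diff algebra_simps)
qed (simp_all add: scale_frag_additive N_zero)

lemma prefix_scale:
  assumes "c \<in> carrier C" "Poly_Mapping.keys u \<subseteq> W 0"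
  shows "prefix_frag A (scale_frag A c u) - scale_frag A c (prefix_frag A u) \<in> N n"
  using assms(2)
proof (induction u rule: frag_induction)
  case (one y)
  then obtain b q where y: "y = b # q" "b \<in> carrier A" "set q \<subseteq> carrier A" by (rule words_ge_cases)
  then show ?case using move_scalar[of c "[\<one>\<^bsub>A\<^esub>]" b q n] assms by simp
next
  case (diff a b)
  then show ?case using N_diff[OF diff] by (simp add: scale_frag_diff prefix_frag_diff algebra_simps)
qed (simp_all add: scale_frag_additive prefix_frag_additive N_zero)

text \<open>For two words the recursion splits the product of \<open>1 \<otimes> x\<close> and \<open>1 \<otimes> y\<close> by whether the next letter is
  that of \<open>x\<close>, that of \<open>y\<close>, or their product. The summands on the right-hand side are the same sums, but
  with the powers of \<open>\<lambda>\<close> at the first letter instead of at the zeroth one.\<close>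

lemma baxter_identity_frag:
  assumes "Poly_Mapping.keys u \<subseteq> W 0" "Poly_Mapping.keys v \<subseteq> W 0"
  shows "mul (prefix_frag A u) (prefix_frag A v) -
     (prefix_frag A (mul u (prefix_frag A v)) + prefix_frag A (mul v (prefix_frag A u)) +
      scale_frag A lam (prefix_frag A (mul u v))) \<in> N n"
  using assms
proof (induction u v rule: bilinear_words_induct)
  case (words a p b q)
  let ?P = "prefix_frag A"
  have P: "?P (qshuffle A p q F) = qshuffle A p q (\<lambda>e w. ?P (F e w))" for p q F
    by (rule qshuffle_hom) (simp_all add: prefix_frag_additive)
  have S: "scale_frag A lam (qshuffle A p q F) = qshuffle A p q (\<lambda>e w. scale_frag A lam (F e w))" for p q F
    by (rule qshuffle_hom) (simp_all add: scale_frag_additive)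
  have R: "qshuffle A xs ys F - qshuffle A xs ys G \<in> N n"
    if "set xs \<subseteq> carrier A" "set ys \<subseteq> carrier A"
      "\<And>e w. set w \<subseteq> carrier A \<Longrightarrow> F e w - G e w \<in> N n" for xs ys F G
  proof (rule qshuffle_parametric[OF monoid_A, where R = "\<lambda>u v. u - v \<in> N n"])
    fix u v u' v' assume "u - v \<in> N n" "u' - v' \<in> N n"
    then show "u + u' - (v + v') \<in> N n" by (rule N_diff_add)
  qed (use that in auto)
  have com: "qshuffle A q (a # p) F = qshuffle A (a # p) q F" for F :: "nat \<Rightarrow> 'a list \<Rightarrow> 'a list \<Rightarrow>\<^sub>0 int"
    by (rule qshuffle_commute) (use words in \<open>auto intro: comm_monoid_axioms\<close>)
  \<comment> \<open>the scalar moves from the prefixed unit to the letter behind it\<close>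
  have mv: "frag_of ((c \<cdot> \<one>\<^bsub>A\<^esub>) # d # w) - frag_of (\<one>\<^bsub>A\<^esub> # (c \<cdot> d) # w) \<in> N n"
    if "c \<in> carrier C" "d \<in> carrier A" "set w \<subseteq> carrier A" for c d w
    using N_minus[OF move_scalar[of c "[\<one>\<^bsub>A\<^esub>]" d w n]] that by simp
  have "mul (?P (frag_of (a # p))) (?P (frag_of (b # q))) =
      qshuffle A p (b # q) (\<lambda>e w. frag_of ((lpow e \<cdot> \<one>\<^bsub>A\<^esub>) # a # w)) +
      qshuffle A (a # p) q (\<lambda>e w. frag_of ((lpow e \<cdot> \<one>\<^bsub>A\<^esub>) # b # w)) +
      qshuffle A p q (\<lambda>e w. frag_of ((lpow (Suc e) \<cdot> \<one>\<^bsub>A\<^esub>) # (a \<star> b) # w))"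
    using words by (simp add: mul_words del: R.nat_pow_Suc)
  moreover have "?P (mul (frag_of (a # p)) (?P (frag_of (b # q)))) =
      qshuffle A p (b # q) (\<lambda>e w. frag_of (\<one>\<^bsub>A\<^esub> # (lpow e \<cdot> a) # w))"
    using words by (simp add: mul_words P)
  moreover have "?P (mul (frag_of (b # q)) (?P (frag_of (a # p)))) =
      qshuffle A (a # p) q (\<lambda>e w. frag_of (\<one>\<^bsub>A\<^esub> # (lpow e \<cdot> b) # w))"
    using words by (simp add: mul_words P com)
  moreover have "scale_frag A lam (?P (mul (frag_of (a # p)) (frag_of (b # q)))) =
      qshuffle A p q (\<lambda>e w. frag_of ((lam \<cdot> \<one>\<^bsub>A\<^esub>) # (lpow e \<cdot> (a \<star> b)) # w))"
    using words by (simp add: mul_words P S)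
  moreover have "qshuffle A p (b # q) (\<lambda>e w. frag_of ((lpow e \<cdot> \<one>\<^bsub>A\<^esub>) # a # w)) -
      qshuffle A p (b # q) (\<lambda>e w. frag_of (\<one>\<^bsub>A\<^esub> # (lpow e \<cdot> a) # w)) \<in> N n"
    using words by (intro R mv) auto
  moreover have "qshuffle A (a # p) q (\<lambda>e w. frag_of ((lpow e \<cdot> \<one>\<^bsub>A\<^esub>) # b # w)) -
      qshuffle A (a # p) q (\<lambda>e w. frag_of (\<one>\<^bsub>A\<^esub> # (lpow e \<cdot> b) # w)) \<in> N n"
    using words by (intro R mv) auto
  moreover have "qshuffle A p q (\<lambda>e w. frag_of ((lpow (Suc e) \<cdot> \<one>\<^bsub>A\<^esub>) # (a \<star> b) # w)) -
      qshuffle A p q (\<lambda>e w. frag_of ((lam \<cdot> \<one>\<^bsub>A\<^esub>) # (lpow e \<cdot> (a \<star> b)) # w)) \<in> N n"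
  proof (rule R)
    fix e w assume w: "set w \<subseteq> carrier A"
    have "frag_of ((lpow (Suc e) \<cdot> \<one>\<^bsub>A\<^esub>) # (a \<star> b) # w) - frag_of (\<one>\<^bsub>A\<^esub> # (lpow (Suc e) \<cdot> (a \<star> b)) # w) \<in> N n"
      using words w by (intro mv) auto
    moreover have "frag_of ((lam \<cdot> \<one>\<^bsub>A\<^esub>) # (lpow e \<cdot> (a \<star> b)) # w) -
        frag_of (\<one>\<^bsub>A\<^esub> # (lam \<cdot> (lpow e \<cdot> (a \<star> b))) # w) \<in> N n"
      using words w by (intro mv) auto
    moreover have "lpow (Suc e) \<cdot> (a \<star> b) = lam \<cdot> (lpow e \<cdot> (a \<star> b))"
      using words by (simp add: smult_assoc1[symmetric] R.m_comm)
    ultimately show "frag_of ((lpow (Suc e) \<cdot> \<one>\<^bsub>A\<^esub>) # (a \<star> b) # w) -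
        frag_of ((lam \<cdot> \<one>\<^bsub>A\<^esub>) # (lpow e \<cdot> (a \<star> b)) # w) \<in> N n"
      using N_diff by fastforce
  qed (use words in auto)
  ultimately show ?case by (simp only: N_diff_add)
next
  case (left u u' v)
  then show ?case using N_diff[OF left]
    by (simp add: shuffle_frag_diff_left shuffle_frag_diff_right prefix_frag_diff scale_frag_diff algebra_simps)
next
  case (right u v v')
  then show ?case using N_diff[OF right]
    by (simp add: shuffle_frag_diff_left shuffle_frag_diff_right prefix_frag_diff scale_frag_diff algebra_simps)
qed (simp_all add: shuffle_frag_additive_left shuffle_frag_additive_right prefix_frag_additive
    scale_frag_additive N_zero)

end

section \<open>Tensors as classes of formal sums\<close>

text \<open>Maps on cosets are unions over representatives; they are evaluated by showing that all
  representatives give the same coset.\<close>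

lemma UN_constant_value: "S \<noteq> {} \<Longrightarrow> (\<And>v. v \<in> S \<Longrightarrow> f v = c) \<Longrightarrow> (\<Union>v\<in>S. f v) = c"
  by auto

context shuffle_algebra
begin

abbreviation cls where "cls \<equiv> tensor_class C A"
abbreviation Shk where "Shk \<equiv> Sh_comp C A"

lemma cls_mem: "v \<in> cls k u \<longleftrightarrow> v - u \<in> tensor_rel C A k"
proof -
  have "v \<in> cls k u \<longleftrightarrow> (\<exists>r\<in>tensor_rel C A k. v = r + u)"
    by (auto simp: tensor_class_def r_coset_def)
  also have "\<dots> \<longleftrightarrow> v - u \<in> tensor_rel C A k"
    by (metis diff_add_cancel add_diff_cancel_right')
  finally show ?thesis .
qed

lemma cls_eq_iff: "cls k u = cls k v \<longleftrightarrow> u - v \<in> tensor_rel C A k"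
proof
  assume "cls k u = cls k v"
  moreover have "u \<in> cls k u" by (simp add: cls_mem tensor_rel_zero)
  ultimately show "u - v \<in> tensor_rel C A k" by (simp add: cls_mem)
next
  assume uv: "u - v \<in> tensor_rel C A k"
  show "cls k u = cls k v"
  proof (rule Set.set_eqI)
    fix w
    have "w - v = (w - u) + (u - v)" "w - u = (w - v) - (u - v)" by simp_all
    then show "w \<in> cls k u \<longleftrightarrow> w \<in> cls k v"
      unfolding cls_mem using uv tensor_rel_add tensor_rel_diff by metis
  qed
qed

lemma cls_self: "u \<in> cls k u"
  by (simp add: cls_mem tensor_rel_zero)

lemma cls_keys:
  assumes "Poly_Mapping.keys u \<subseteq> words A k" "v \<in> cls k u"
  shows "Poly_Mapping.keys v \<subseteq> words A k"
  using keys_add_subset[OF tensor_rel_keys[of "v - u" k] assms(1)] assms(2) by (simp add: cls_mem)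

lemma Sh_comp_carrier: "carrier (Shk k) = cls k ` {u. Poly_Mapping.keys u \<subseteq> words A k}"
  by (auto simp: Sh_comp_def Let_def FactGroup_def RCOSETS_def tensor_class_def)

lemma Sh_comp_zero: "\<zero>\<^bsub>Shk k\<^esub> = cls k 0"
  by (auto simp: Sh_comp_def Let_def FactGroup_def cls_mem)

lemma Sh_comp_add: "cls k u \<oplus>\<^bsub>Shk k\<^esub> cls k v = cls k (u + v)"
proof -
  have "cls k u \<oplus>\<^bsub>Shk k\<^esub> cls k v = {a + b | a b. a \<in> cls k u \<and> b \<in> cls k v}"
    by (auto simp: Sh_comp_def Let_def FactGroup_def set_mult_def)
  also have "\<dots> = cls k (u + v)"
  proof (intro equalityI subsetI)
    fix w assume "w \<in> {a + b | a b. a \<in> cls k u \<and> b \<in> cls k v}"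
    then obtain a b where ab: "w = a + b" "a - u \<in> tensor_rel C A k" "b - v \<in> tensor_rel C A k"
      by (auto simp: cls_mem)
    have "w - (u + v) = (a - u) + (b - v)" using ab by simp
    then show "w \<in> cls k (u + v)" using tensor_rel_add[OF ab(2,3)] by (simp only: cls_mem)
  next
    fix w assume "w \<in> cls k (u + v)"
    then have "w = (w - v) + v" "w - v \<in> cls k u" by (simp_all add: cls_mem diff_diff_eq add.commute)
    then show "w \<in> {a + b | a b. a \<in> cls k u \<and> b \<in> cls k v}" using cls_self by blast
  qed
  finally show ?thesis .
qed

lemma scale_words_keys:
  assumes "c \<in> carrier C" "Poly_Mapping.keys u \<subseteq> words A k"
  shows "Poly_Mapping.keys (scale_frag A c u) \<subseteq> words A k"
  using assms(2)
proof (induction u rule: frag_induction)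
  case (one y)
  then show ?case using assms(1) by (cases y) (auto simp: words_def)
qed (simp_all add: scale_frag_additive scale_frag_diff keys_diff_subset)

lemma prefix_words_keys:
  assumes "Poly_Mapping.keys u \<subseteq> words A k"
  shows "Poly_Mapping.keys (prefix_frag A u) \<subseteq> words A (Suc k)"
  using assms
proof (induction u rule: frag_induction)
  case (one y)
  then show ?case by (auto simp: words_def)
qed (simp_all add: prefix_frag_additive prefix_frag_diff keys_diff_subset)

text \<open>In a single degree, vanishing up to that degree amounts to being a relation.\<close>

lemma tensor_rel_scale:
  assumes "c \<in> carrier C" "r \<in> tensor_rel C A k"
  shows "scale_frag A c r \<in> tensor_rel C A k"
proof -
  have "degree_part k (scale_frag A c r) \<in> tensor_rel C A k"
    using N_scale[OF assms(1) tensor_rel_N[OF assms(2), of k]] by (simp add: rel_upto_def)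
  then show ?thesis
    by (simp add: degree_part_same[OF scale_words_keys[OF assms(1) tensor_rel_keys[OF assms(2)]]])
qed

lemma tensor_rel_prefix:
  assumes "r \<in> tensor_rel C A k"
  shows "prefix_frag A r \<in> tensor_rel C A (Suc k)"
proof -
  have "degree_part (Suc k) (prefix_frag A r) \<in> tensor_rel C A (Suc k)"
    using N_prefix[OF tensor_rel_N[OF assms, of k]] by (simp add: rel_upto_def)
  then show ?thesis
    by (simp add: degree_part_same[OF prefix_words_keys[OF tensor_rel_keys[OF assms]]])
qed

lemma Sh_comp_smult:
  assumes "c \<in> carrier C"
  shows "c \<odot>\<^bsub>Shk k\<^esub> cls k u = cls k (scale_frag A c u)"
proof -
  have "c \<odot>\<^bsub>Shk k\<^esub> cls k u = (\<Union>v\<in>cls k u. cls k (scale_frag A c v))"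
    by (simp add: Sh_comp_def Let_def scale_frag_def)
  also have "\<dots> = cls k (scale_frag A c u)"
  proof (rule UN_constant_value)
    show "cls k u \<noteq> {}" using cls_self by blast
  qed (auto simp: cls_eq_iff cls_mem scale_frag_diff[symmetric] tensor_rel_scale[OF assms])
  finally show ?thesis .
qed

lemma one_tensor_cls: "one_tensor C A k (cls k u) = cls (Suc k) (prefix_frag A u)"
  unfolding one_tensor_def prefix_frag_def[symmetric]
proof (rule UN_constant_value)
  show "cls k u \<noteq> {}" using cls_self by blast
qed (auto simp: cls_eq_iff cls_mem prefix_frag_diff[symmetric] tensor_rel_prefix)

lemma tensor_shuffle_cls:
  assumes "Poly_Mapping.keys u \<subseteq> words A i" "Poly_Mapping.keys v \<subseteq> words A j"
  shows "tensor_shuffle C lam A k (cls i u) (cls j v) = cls k (degree_part k (mul u v))"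
proof -
  have "cls k (degree_part k (mul u' v')) = cls k (degree_part k (mul u v))"
    if u': "u' \<in> cls i u" and v': "v' \<in> cls j v" for u' v'
  proof -
    have keys: "Poly_Mapping.keys u \<subseteq> W 0" "Poly_Mapping.keys v' \<subseteq> W 0"
      using assms(1) cls_keys[OF assms(2) v'] words_subset by blast+
    have "u' - u \<in> N k" "v' - v \<in> N k" using u' v' tensor_rel_N by (auto simp: cls_mem)
    then have "mul (u' - u) v' \<in> N k" "mul (v' - v) u \<in> N k" using keys by (auto intro: N_mul)
    then have "mul (u' - u) v' + mul u (v' - v) \<in> N k"
      using mul_commute[OF N_keys[OF \<open>v' - v \<in> N k\<close>] keys(1)] by (simp add: N_add)
    then have "mul u' v' - mul u v \<in> N k"
      by (simp add: shuffle_frag_diff_left shuffle_frag_diff_right)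
    then show ?thesis
      unfolding cls_eq_iff degree_part_diff[symmetric] by (simp add: rel_upto_def)
  qed
  then show ?thesis
    unfolding tensor_shuffle_def
    using cls_self by (intro UN_constant_value) blast+
qed

lemma abelian_monoid_Sh_comp: "abelian_monoid (Shk k)"
  by (rule abelian_monoidI)
    (auto simp: Sh_comp_carrier Sh_comp_zero Sh_comp_add keys_add_subset ac_simps intro!: imageI)

lemma Sh_comp_finsum:
  assumes "finite I" "\<And>i. i \<in> I \<Longrightarrow> Poly_Mapping.keys (f i) \<subseteq> words A k"
  shows "finsum (Shk k) (\<lambda>i. cls k (f i)) I = cls k (sum f I)"
  using assms
proof (induction I rule: finite_induct)
  case empty
  then show ?case by (simp add: abelian_monoid.finsum_empty[OF abelian_monoid_Sh_comp] Sh_comp_zero)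
next
  case (insert i I)
  have "finsum (Shk k) (\<lambda>i. cls k (f i)) (insert i I) =
      cls k (f i) \<oplus>\<^bsub>Shk k\<^esub> finsum (Shk k) (\<lambda>i. cls k (f i)) I"
    using insert by (intro abelian_monoid.finsum_insert[OF abelian_monoid_Sh_comp])
      (auto simp: Sh_comp_carrier)
  then show ?case using insert by (simp add: Sh_comp_add)
qed

section \<open>Representing families of tensors by formal sums\<close>

text \<open>The formal sum \<open>u\<close> represents the family \<open>x\<close> up to degree \<open>n\<close>. An arbitrary family is represented
  up to every degree, but in general not by one and the same formal sum.\<close>

definition rep :: "nat \<Rightarrow> ('a list \<Rightarrow>\<^sub>0 int) \<Rightarrow> (nat \<Rightarrow> 'a tensor) \<Rightarrow> bool" where
  "rep n u x \<longleftrightarrow> Poly_Mapping.keys u \<subseteq> W 0 \<and> (\<forall>k\<le>n. x k = cls k (degree_part k u))"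

definition family :: "('a list \<Rightarrow>\<^sub>0 int) \<Rightarrow> nat \<Rightarrow> 'a tensor" where
  "family u = (\<lambda>k. cls k (degree_part k u))"

abbreviation families where "families \<equiv> carrier (Sh_prod C lam A)"

lemma families_iff: "x \<in> families \<longleftrightarrow> (\<forall>k. x k \<in> carrier (Shk k))"
  by (simp add: Sh_prod_def)

lemma rep_keys: "rep n u x \<Longrightarrow> Poly_Mapping.keys u \<subseteq> W 0"
  by (simp add: rep_def)

lemma rep_family: "Poly_Mapping.keys u \<subseteq> W 0 \<Longrightarrow> rep n u (family u)"
  by (simp add: rep_def family_def)

lemma rep_mono: "rep n u x \<Longrightarrow> m \<le> n \<Longrightarrow> rep m u x"
  by (auto simp: rep_def)

lemma rep_agree: "rep n u x \<Longrightarrow> (\<And>k. k \<le> n \<Longrightarrow> x k = y k) \<Longrightarrow> rep n u y"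
  by (auto simp: rep_def)

lemma rep_unique:
  assumes "rep n u x" "rep n v y" "u - v \<in> N n" "k \<le> n"
  shows "x k = y k"
  using assms by (auto simp: rep_def cls_eq_iff degree_part_diff[symmetric] rel_upto_def)

lemma rep_diff_N:
  assumes "rep n u x" "rep n v x"
  shows "u - v \<in> N n"
  using assms keys_diff_subset[of u "W 0" v]
  by (simp add: rep_def rel_upto_def degree_part_diff cls_eq_iff[symmetric])

lemma rep_change:
  assumes "rep n u x" "u - v \<in> N n" "Poly_Mapping.keys v \<subseteq> W 0"
  shows "rep n v x"
  using assms by (auto simp: rep_def cls_eq_iff degree_part_diff[symmetric] rel_upto_def)

lemma rep_ext:
  assumes "\<And>n. \<exists>u v. rep n u x \<and> rep n v y \<and> u - v \<in> N n"
  shows "x = y"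
proof
  fix k
  show "x k = y k" using assms[of k] rep_unique by blast
qed

lemma degree_part_sum: "degree_part k (sum f I) = (\<Sum>i\<in>I. degree_part k (f i))"
  by (induction I rule: infinite_finite_induct) (simp_all add: degree_part_additive)

lemma keys_sum_subset:
  assumes "\<And>i. i \<in> I \<Longrightarrow> Poly_Mapping.keys (f i) \<subseteq> S"
  shows "Poly_Mapping.keys (sum f I) \<subseteq> S"
  using assms by (induction I rule: infinite_finite_induct) (simp_all add: keys_add_subset)

lemma choose_components:
  assumes "x \<in> families"
  obtains f where "\<And>i. Poly_Mapping.keys (f i) \<subseteq> words A i" "\<And>i. x i = cls i (f i)"
proof -
  have "\<forall>i. \<exists>u. Poly_Mapping.keys u \<subseteq> words A i \<and> x i = cls i u"
  proof
    fix i
    have "x i \<in> carrier (Shk i)" using assms by (simp add: families_iff)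
    then show "\<exists>u. Poly_Mapping.keys u \<subseteq> words A i \<and> x i = cls i u"
      by (auto simp: Sh_comp_carrier)
  qed
  then show ?thesis using that by metis
qed

lemma sum_components:
  assumes "\<And>i. Poly_Mapping.keys (f i) \<subseteq> words A i" "finite I"
  shows "Poly_Mapping.keys (sum f I) \<subseteq> W 0" "degree_part k (sum f I) = (if k \<in> I then f k else 0)"
proof -
  show "Poly_Mapping.keys (sum f I) \<subseteq> W 0"
    using assms(1) words_subset by (intro keys_sum_subset) blast
  show "degree_part k (sum f I) = (if k \<in> I then f k else 0)"
    using assms(2) by (simp add: degree_part_sum degree_part_same[OF assms(1)])
qed

lemma rep_exists:
  assumes "x \<in> families"
  obtains u where "rep n u x"
proof -
  obtain f where f: "\<And>i. Poly_Mapping.keys (f i) \<subseteq> words A i" "\<And>i. x i = cls i (f i)"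
    using choose_components[OF assms] by blast
  have "rep n (sum f {..n}) x"
    using f by (simp add: rep_def sum_components)
  then show ?thesis by (rule that)
qed

lemma family_in_families: "Poly_Mapping.keys u \<subseteq> W 0 \<Longrightarrow> family u \<in> families"
  by (auto simp: families_iff family_def Sh_comp_carrier degree_part_keys)

lemma finite_degree_parts: "finite {k. degree_part k u \<noteq> 0}"
  using subset_UNIV[of "Poly_Mapping.keys u"]
proof (induction u rule: frag_induction)
  case (one w)
  show ?case by (rule finite_subset[of _ "{length w - 1}"]) (auto simp: degree_part_of)
next
  case (diff a b)
  show ?case
    by (rule finite_subset[of _ "{k. degree_part k a \<noteq> 0} \<union> {k. degree_part k b \<noteq> 0}"])
      (use diff in \<open>auto simp: degree_part_diff\<close>)
qed (simp add: degree_part_additive)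

lemma Sh_carrier: "carrier (Sh C lam A) = family ` {u. Poly_Mapping.keys u \<subseteq> W 0}"
proof (intro equalityI subsetI)
  fix x assume x: "x \<in> carrier (Sh C lam A)"
  let ?I = "{k. x k \<noteq> \<zero>\<^bsub>Shk k\<^esub>}"
  have fin: "finite ?I" and "x \<in> families" using x by (auto simp: Sh_def families_iff)
  then obtain f where f: "\<And>i. Poly_Mapping.keys (f i) \<subseteq> words A i" "\<And>i. x i = cls i (f i)"
    using choose_components by blast
  have "x = family (sum f ?I)"
    using f fin by (auto simp: fun_eq_iff family_def sum_components Sh_comp_zero)
  then show "x \<in> family ` {u. Poly_Mapping.keys u \<subseteq> W 0}"
    using sum_components(1)[OF f(1) fin] by blast
next
  fix x assume "x \<in> family ` {u. Poly_Mapping.keys u \<subseteq> W 0}"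
  then obtain u where u: "Poly_Mapping.keys u \<subseteq> W 0" "x = family u" by blast
  have "finite {k. x k \<noteq> \<zero>\<^bsub>Shk k\<^esub>}"
    by (rule finite_subset[OF _ finite_degree_parts[of u]]) (auto simp: u family_def Sh_comp_zero)
  then show "x \<in> carrier (Sh C lam A)"
    using family_in_families[OF u(1)] by (simp add: Sh_def u(2) families_iff)
qed

lemma Sh_subset_families: "x \<in> carrier (Sh C lam A) \<Longrightarrow> x \<in> families"
  by (auto simp: Sh_carrier family_in_families)

lemma rep_mul_N:
  assumes "u - u' \<in> N n" "v - v' \<in> N n" "Poly_Mapping.keys u' \<subseteq> W 0" "Poly_Mapping.keys v \<subseteq> W 0"
  shows "mul u v - mul u' v' \<in> N n"
proof -
  have "mul (u - u') v \<in> N n" "mul (v - v') u' \<in> N n" using assms by (auto intro: N_mul)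
  then have "mul (u - u') v + mul u' (v - v') \<in> N n"
    using mul_commute[OF N_keys[OF assms(2)] assms(3)] by (simp add: N_add)
  then show ?thesis by (simp add: shuffle_frag_diff_left shuffle_frag_diff_right)
qed

text \<open>For the representatives that are assembled from the components on the supports, the double sum in
  the definition of the product is the class of the product of formal sums. Any other
  representatives differ from these by an element of \<open>N n\<close>, and so do the products.\<close>

lemma rep_Sh_mult:
  assumes "x \<in> carrier (Sh C lam A)" "y \<in> carrier (Sh C lam A)" "rep n u x" "rep n v y"
  shows "rep n (mul u v) (x \<otimes>\<^bsub>Sh C lam A\<^esub> y)"
proof -
  let ?I = "{i. x i \<noteq> \<zero>\<^bsub>Shk i\<^esub>}" and ?J = "{j. y j \<noteq> \<zero>\<^bsub>Shk j\<^esub>}"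
  obtain f where f: "\<And>i. Poly_Mapping.keys (f i) \<subseteq> words A i" "\<And>i. x i = cls i (f i)"
    using choose_components[OF Sh_subset_families[OF assms(1)]] by blast
  obtain g where g: "\<And>i. Poly_Mapping.keys (g i) \<subseteq> words A i" "\<And>i. y i = cls i (g i)"
    using choose_components[OF Sh_subset_families[OF assms(2)]] by blast
  have fin: "finite ?I" "finite ?J" using assms(1,2) by (auto simp: Sh_def)
  have repx: "rep n (sum f ?I) x" and repy: "rep n (sum g ?J) y"
    using f g fin by (auto simp: rep_def sum_components Sh_comp_zero)
  have k: "(x \<otimes>\<^bsub>Sh C lam A\<^esub> y) k = cls k (degree_part k (mul (sum f ?I) (sum g ?J)))" for k
  proof -
    have W: "Poly_Mapping.keys (f i) \<subseteq> W 0" "Poly_Mapping.keys (g i) \<subseteq> W 0" for i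
      using f(1)[of i] g(1)[of i] words_subset by blast+
    have "(x \<otimes>\<^bsub>Sh C lam A\<^esub> y) k = finsum (Shk k) (\<lambda>(i, j). tensor_shuffle C lam A k (x i) (y j)) (?I \<times> ?J)"
      by (simp add: Sh_def)
    also have "(\<lambda>(i, j). tensor_shuffle C lam A k (x i) (y j)) =
        (\<lambda>ij. cls k (degree_part k (mul (f (fst ij)) (g (snd ij)))))"
      by (auto simp: f(2) g(2) tensor_shuffle_cls[OF f(1) g(1)])
    also have "finsum (Shk k) \<dots> (?I \<times> ?J) =
        cls k (\<Sum>ij\<in>?I \<times> ?J. degree_part k (mul (f (fst ij)) (g (snd ij))))"
      using fin W by (intro Sh_comp_finsum degree_part_keys mul_keys) auto
    also have "(\<Sum>ij\<in>?I \<times> ?J. degree_part k (mul (f (fst ij)) (g (snd ij)))) =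
        degree_part k (\<Sum>i\<in>?I. \<Sum>j\<in>?J. mul (f i) (g j))"
      by (simp add: degree_part_sum sum.cartesian_product case_prod_unfold)
    also have "(\<Sum>i\<in>?I. \<Sum>j\<in>?J. mul (f i) (g j)) = mul (sum f ?I) (sum g ?J)"
    proof -
      have "mul (sum f I) v = (\<Sum>i\<in>I. mul (f i) v)" for I v
        by (induction I rule: infinite_finite_induct) (simp_all add: shuffle_frag_additive_left)
      moreover have "mul u (sum g I) = (\<Sum>i\<in>I. mul u (g i))" for I u
        by (induction I rule: infinite_finite_induct) (simp_all add: shuffle_frag_additive_right)
      ultimately have "mul (sum f ?I) (sum g ?J) = (\<Sum>j\<in>?J. \<Sum>i\<in>?I. mul (f i) (g j))" by simp
      also have "\<dots> = (\<Sum>i\<in>?I. \<Sum>j\<in>?J. mul (f i) (g j))" by (rule sum.swap)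
      finally show ?thesis by (rule sym)
    qed
    finally show ?thesis .
  qed
  have keys: "Poly_Mapping.keys (mul (sum f ?I) (sum g ?J)) \<subseteq> W 0"
    using rep_keys[OF repx] rep_keys[OF repy] by (rule mul_keys)
  have "rep n (mul (sum f ?I) (sum g ?J)) (x \<otimes>\<^bsub>Sh C lam A\<^esub> y)"
    using keys k by (simp add: rep_def)
  then show ?thesis
    by (rule rep_change[OF _ rep_mul_N[OF rep_diff_N[OF repx assms(3)] rep_diff_N[OF repy assms(4)]
            rep_keys[OF assms(3)] rep_keys[OF repy]]
          mul_keys[OF rep_keys[OF assms(3)] rep_keys[OF assms(4)]]])
qed

lemma truncate_Sh:
  assumes "x \<in> families"
  shows "truncate C A n x \<in> carrier (Sh C lam A)"
proof -
  have zero: "\<zero>\<^bsub>Shk k\<^esub> \<in> carrier (Shk k)" for k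
    by (rule abelian_monoid.zero_closed[OF abelian_monoid_Sh_comp])
  have "finite {k. truncate C A n x k \<noteq> \<zero>\<^bsub>Shk k\<^esub>}"
    by (rule finite_subset[of _ "{..n}"]) (auto simp: truncate_def)
  then show ?thesis using assms zero by (simp add: Sh_def families_iff truncate_def)
qed

text \<open>If \<open>u\<close> represents \<open>x\<close> up to degree \<open>n\<close>, it represents all truncations of \<open>x\<close> at or beyond \<open>n\<close>. So
  the components of the products of truncations are constant from there on.\<close>

lemma rep_Sh_prod_mult:
  assumes "x \<in> families" "y \<in> families" "rep n u x" "rep n v y"
  shows "rep n (mul u v) (x \<otimes>\<^bsub>Sh_prod C lam A\<^esub> y)"
  unfolding rep_def
proof (intro conjI allI impI)
  show "Poly_Mapping.keys (mul u v) \<subseteq> W 0" using assms(3,4) rep_keys mul_keys by blast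
  fix k assume k: "k \<le> n"
  let ?m = "\<lambda>N. (truncate C A N x \<otimes>\<^bsub>Sh C lam A\<^esub> truncate C A N y) k"
  have const: "?m N = cls k (degree_part k (mul u v))" if "n \<le> N" for N
  proof -
    have "rep n u (truncate C A N x)" "rep n v (truncate C A N y)"
      using that by (auto intro!: rep_agree[OF assms(3)] rep_agree[OF assms(4)] simp: truncate_def)
    then show ?thesis
      using rep_Sh_mult[OF truncate_Sh[OF assms(1)] truncate_Sh[OF assms(2)]] k
      unfolding rep_def by blast
  qed
  have "(x \<otimes>\<^bsub>Sh_prod C lam A\<^esub> y) k = (THE z. \<forall>\<^sub>F N in sequentially. ?m N = z)"
    by (simp add: Sh_prod_def)
  also have "\<dots> = cls k (degree_part k (mul u v))"
  proof (rule the_equality)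
    show ev: "\<forall>\<^sub>F N in sequentially. ?m N = cls k (degree_part k (mul u v))"
      using const eventually_sequentially by blast
    show "z = cls k (degree_part k (mul u v))" if "\<forall>\<^sub>F N in sequentially. ?m N = z" for z
    proof -
      have "\<forall>\<^sub>F N in sequentially. z = cls k (degree_part k (mul u v))"
        using that ev by eventually_elim simp
      then show ?thesis by simp
    qed
  qed
  finally show "(x \<otimes>\<^bsub>Sh_prod C lam A\<^esub> y) k = cls k (degree_part k (mul u v))" .
qed

lemma degree_part_scale:
  assumes "Poly_Mapping.keys u \<subseteq> W 0"
  shows "degree_part k (scale_frag A c u) = scale_frag A c (degree_part k u)"
  using assms
proof (induction u rule: frag_induction)
  case (one w)
  then show ?case by (elim words_ge_cases) (simp add: degree_part_of scale_frag_additive)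
qed (simp_all add: scale_frag_additive scale_frag_diff degree_part_additive degree_part_diff)

lemma degree_part_prefix:
  assumes "Poly_Mapping.keys u \<subseteq> W 0"
  shows "degree_part (Suc k) (prefix_frag A u) = prefix_frag A (degree_part k u)"
    "degree_part 0 (prefix_frag A u) = 0"
  using assms
proof (induction u rule: frag_induction)
  case (one w)
  {
    case 1
    show ?case by (simp add: degree_part_of prefix_frag_additive)
  next
    case 2
    show ?case using one by (auto simp: degree_part_of words_ge_def)
  }
qed (simp_all add: prefix_frag_additive prefix_frag_diff degree_part_additive degree_part_diff)

lemma rep_add:
  assumes "rep n u x" "rep n v y"
  shows "rep n (u + v) (\<lambda>k. x k \<oplus>\<^bsub>Shk k\<^esub> y k)"
  using assms by (simp add: rep_def Sh_comp_add degree_part_additive keys_add_subset)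

lemma rep_zero: "rep n 0 (\<lambda>k. \<zero>\<^bsub>Shk k\<^esub>)"
  by (simp add: rep_def Sh_comp_zero degree_part_additive)

lemma rep_smult:
  assumes "rep n u x" "c \<in> carrier C"
  shows "rep n (scale_frag A c u) (\<lambda>k. c \<odot>\<^bsub>Shk k\<^esub> x k)"
  using assms by (simp add: rep_def Sh_comp_smult degree_part_scale scale_keys)

lemma rep_incl: "a \<in> carrier A \<Longrightarrow> rep n (frag_of [a]) (Sh_incl C A a)"
  by (auto simp: rep_def Sh_incl_def Sh_comp_zero degree_part_of words_ge_def)

lemma rep_op:
  assumes "rep n u x"
  shows "rep (Suc n) (prefix_frag A u) (Sh_op C A x)"
  unfolding rep_def
proof (intro conjI allI impI)
  show "Poly_Mapping.keys (prefix_frag A u) \<subseteq> W 0"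
    using prefix_keys[OF rep_keys[OF assms]] words_ge_mono[of 0 "Suc 0"] by simp
  fix k assume "k \<le> Suc n"
  then show "Sh_op C A x k = cls k (degree_part k (prefix_frag A u))"
    using assms by (cases k) (auto simp: rep_def Sh_op_def Sh_comp_zero one_tensor_cls degree_part_prefix)
qed

lemma Sh_prod_op_eq: "Sh_prod_op C A x = Sh_op C A x"
  by (rule ext) (simp add: Sh_prod_op_def Sh_op_def split: nat.split)

section \<open>The direct sum and the product are Baxter algebras\<close>

text \<open>A common description of the direct sum and the product: a set of families, closed under the
  operations, on which the operations are computed on representatives.\<close>

definition represented :: "('c, nat \<Rightarrow> 'a tensor) module \<Rightarrow> bool" where
  "represented M \<longleftrightarrow>
     carrier M \<subseteq> families \<and>
     (\<forall>x\<in>carrier M. \<forall>y\<in>carrier M. x \<otimes>\<^bsub>M\<^esub> y \<in> carrier M \<and> x \<oplus>\<^bsub>M\<^esub> y \<in> carrier M) \<and>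
     \<one>\<^bsub>M\<^esub> \<in> carrier M \<and> \<zero>\<^bsub>M\<^esub> \<in> carrier M \<and>
     (\<forall>c\<in>carrier C. \<forall>x\<in>carrier M. c \<odot>\<^bsub>M\<^esub> x \<in> carrier M) \<and>
     (\<forall>x\<in>carrier M. Sh_op C A x \<in> carrier M) \<and>
     (\<forall>n u v. \<forall>x\<in>carrier M. \<forall>y\<in>carrier M. rep n u x \<longrightarrow> rep n v y \<longrightarrow>
        rep n (mul u v) (x \<otimes>\<^bsub>M\<^esub> y) \<and> rep n (u + v) (x \<oplus>\<^bsub>M\<^esub> y)) \<and>
     (\<forall>n. rep n (frag_of [\<one>\<^bsub>A\<^esub>]) \<one>\<^bsub>M\<^esub>) \<and> (\<forall>n. rep n 0 \<zero>\<^bsub>M\<^esub>) \<and>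
     (\<forall>n u. \<forall>c\<in>carrier C. \<forall>x\<in>carrier M. rep n u x \<longrightarrow> rep n (scale_frag A c u) (c \<odot>\<^bsub>M\<^esub> x))"

lemma scale_zero_N: "Poly_Mapping.keys u \<subseteq> W 0 \<Longrightarrow> scale_frag A \<zero>\<^bsub>C\<^esub> u \<in> N n"
  using N_minus[OF scale_add_scalars[of "\<zero>\<^bsub>C\<^esub>" "\<zero>\<^bsub>C\<^esub>" u n]] by simp

text \<open>Each axiom holds for formal sums exactly or modulo \<open>N n\<close>, and two families are equal if for every
  \<open>n\<close> they have representatives that agree modulo \<open>N n\<close> (\<open>rep_ext\<close>).\<close>

lemma represented_baxter_algebra:
  assumes "represented M"
  shows "baxter_algebra C lam M (Sh_op C A)"
proof -
  have sub: "x \<in> carrier M \<Longrightarrow> x \<in> families"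
    and mc: "x \<in> carrier M \<Longrightarrow> y \<in> carrier M \<Longrightarrow> x \<otimes>\<^bsub>M\<^esub> y \<in> carrier M"
    and ac: "x \<in> carrier M \<Longrightarrow> y \<in> carrier M \<Longrightarrow> x \<oplus>\<^bsub>M\<^esub> y \<in> carrier M"
    and oc: "\<one>\<^bsub>M\<^esub> \<in> carrier M" and zc: "\<zero>\<^bsub>M\<^esub> \<in> carrier M"
    and sc: "c \<in> carrier C \<Longrightarrow> x \<in> carrier M \<Longrightarrow> c \<odot>\<^bsub>M\<^esub> x \<in> carrier M"
    and pc: "x \<in> carrier M \<Longrightarrow> Sh_op C A x \<in> carrier M"
    and m: "x \<in> carrier M \<Longrightarrow> y \<in> carrier M \<Longrightarrow> rep n u x \<Longrightarrow> rep n v y \<Longrightarrow> rep n (mul u v) (x \<otimes>\<^bsub>M\<^esub> y)"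
    and a: "x \<in> carrier M \<Longrightarrow> y \<in> carrier M \<Longrightarrow> rep n u x \<Longrightarrow> rep n v y \<Longrightarrow> rep n (u + v) (x \<oplus>\<^bsub>M\<^esub> y)"
    and ou: "rep n (frag_of [\<one>\<^bsub>A\<^esub>]) \<one>\<^bsub>M\<^esub>" and z: "rep n 0 \<zero>\<^bsub>M\<^esub>"
    and s: "c \<in> carrier C \<Longrightarrow> x \<in> carrier M \<Longrightarrow> rep n u x \<Longrightarrow> rep n (scale_frag A c u) (c \<odot>\<^bsub>M\<^esub> x)"
    for x y n u v c
    using assms unfolding represented_def by blast+
  have p: "rep n (prefix_frag A u) (Sh_op C A x)" if "rep n u x" for n u x
    by (rule rep_mono[OF rep_op[OF that]]) simp
  have ex: "\<exists>u. rep n u x" if "x \<in> carrier M" for n x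
    using rep_exists[OF sub[OF that]] by blast
  have ext1: "x = y" if "\<And>n. \<exists>u. rep n u x \<and> rep n u y" for x y
    using that by (intro rep_ext) (metis N_zero cancel_comm_monoid_add_class.diff_cancel)
  have inv: "\<exists>y\<in>carrier M. y \<oplus>\<^bsub>M\<^esub> x = \<zero>\<^bsub>M\<^esub>" if x: "x \<in> carrier M" for x
  proof (intro bexI rep_ext)
    \<comment> \<open>the negative of \<open>x\<close> is \<open>(- 1) x\<close>, so that closure under scalars suffices\<close>
    let ?c = "\<ominus>\<^bsub>C\<^esub> \<one>\<^bsub>C\<^esub>"
    show "?c \<odot>\<^bsub>M\<^esub> x \<in> carrier M" using x by (auto intro!: sc)
    fix n
    obtain u where u: "rep n u x" using ex[OF x] by blast
    have k: "Poly_Mapping.keys u \<subseteq> W 0" using u by (rule rep_keys)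
    have "scale_frag A (?c \<oplus>\<^bsub>C\<^esub> \<one>\<^bsub>C\<^esub>) u - (scale_frag A ?c u + scale_frag A \<one>\<^bsub>C\<^esub> u) \<in> N n"
      using k by (intro scale_add_scalars) auto
    then have "scale_frag A \<zero>\<^bsub>C\<^esub> u - (scale_frag A ?c u + u) \<in> N n"
      by (simp add: scale_one[OF k] R.l_neg)
    from N_diff[OF scale_zero_N[OF k] this]
    have "scale_frag A ?c u + u - 0 \<in> N n" by (simp add: add.commute)
    moreover have "rep n (scale_frag A ?c u + u) (?c \<odot>\<^bsub>M\<^esub> x \<oplus>\<^bsub>M\<^esub> x)"
      using x u by (auto intro!: a s sc)
    ultimately show "\<exists>u v. rep n u (?c \<odot>\<^bsub>M\<^esub> x \<oplus>\<^bsub>M\<^esub> x) \<and> rep n v \<zero>\<^bsub>M\<^esub> \<and> u - v \<in> N n"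
      using z by blast
  qed
  have addg: "abelian_group M"
  proof (rule abelian_groupI)
    fix x y w assume xyw: "x \<in> carrier M" "y \<in> carrier M" "w \<in> carrier M"
    show "x \<oplus>\<^bsub>M\<^esub> y \<oplus>\<^bsub>M\<^esub> w = x \<oplus>\<^bsub>M\<^esub> (y \<oplus>\<^bsub>M\<^esub> w)"
    proof (rule ext1)
      fix n
      obtain u v t where r: "rep n u x" "rep n v y" "rep n t w" using ex xyw by meson
      have "rep n (u + v + t) (x \<oplus>\<^bsub>M\<^esub> y \<oplus>\<^bsub>M\<^esub> w)" "rep n (u + (v + t)) (x \<oplus>\<^bsub>M\<^esub> (y \<oplus>\<^bsub>M\<^esub> w))"
        using xyw r by (auto intro!: a ac)
      then show "\<exists>u. rep n u (x \<oplus>\<^bsub>M\<^esub> y \<oplus>\<^bsub>M\<^esub> w) \<and> rep n u (x \<oplus>\<^bsub>M\<^esub> (y \<oplus>\<^bsub>M\<^esub> w))"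
        by (auto simp: add.assoc)
    qed
    show "x \<oplus>\<^bsub>M\<^esub> y = y \<oplus>\<^bsub>M\<^esub> x"
    proof (rule ext1)
      fix n
      obtain u v where r: "rep n u x" "rep n v y" using ex xyw by meson
      have "rep n (u + v) (x \<oplus>\<^bsub>M\<^esub> y)" "rep n (v + u) (y \<oplus>\<^bsub>M\<^esub> x)"
        using xyw r by (auto intro!: a)
      then show "\<exists>u. rep n u (x \<oplus>\<^bsub>M\<^esub> y) \<and> rep n u (y \<oplus>\<^bsub>M\<^esub> x)"
        by (auto simp: add.commute)
    qed
    show "\<zero>\<^bsub>M\<^esub> \<oplus>\<^bsub>M\<^esub> x = x"
    proof (rule ext1)
      fix n
      obtain u where r: "rep n u x" using ex xyw by meson
      have "rep n (0 + u) (\<zero>\<^bsub>M\<^esub> \<oplus>\<^bsub>M\<^esub> x)" by (rule a[OF zc xyw(1) z r])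
      then show "\<exists>u. rep n u (\<zero>\<^bsub>M\<^esub> \<oplus>\<^bsub>M\<^esub> x) \<and> rep n u x" using r by auto
    qed
  qed (use ac zc inv in auto)
  have comm: "comm_monoid M"
  proof (rule comm_monoidI)
    fix x y w assume xyw: "x \<in> carrier M" "y \<in> carrier M" "w \<in> carrier M"
    show "x \<otimes>\<^bsub>M\<^esub> y \<otimes>\<^bsub>M\<^esub> w = x \<otimes>\<^bsub>M\<^esub> (y \<otimes>\<^bsub>M\<^esub> w)"
    proof (rule ext1)
      fix n
      obtain u v t where r: "rep n u x" "rep n v y" "rep n t w" using ex xyw by meson
      have "rep n (mul (mul u v) t) (x \<otimes>\<^bsub>M\<^esub> y \<otimes>\<^bsub>M\<^esub> w)" "rep n (mul u (mul v t)) (x \<otimes>\<^bsub>M\<^esub> (y \<otimes>\<^bsub>M\<^esub> w))"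
        using xyw r by (auto intro!: m mc)
      then show "\<exists>u. rep n u (x \<otimes>\<^bsub>M\<^esub> y \<otimes>\<^bsub>M\<^esub> w) \<and> rep n u (x \<otimes>\<^bsub>M\<^esub> (y \<otimes>\<^bsub>M\<^esub> w))"
        using mul_assoc[OF r[THEN rep_keys]] by auto
    qed
  next
    fix x y assume xyw: "x \<in> carrier M" "y \<in> carrier M"
    show "x \<otimes>\<^bsub>M\<^esub> y = y \<otimes>\<^bsub>M\<^esub> x"
    proof (rule ext1)
      fix n
      obtain u v where r: "rep n u x" "rep n v y" using ex xyw by meson
      have "rep n (mul u v) (x \<otimes>\<^bsub>M\<^esub> y)" "rep n (mul v u) (y \<otimes>\<^bsub>M\<^esub> x)"
        using xyw r by (auto intro!: m)
      then show "\<exists>u. rep n u (x \<otimes>\<^bsub>M\<^esub> y) \<and> rep n u (y \<otimes>\<^bsub>M\<^esub> x)"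
        using mul_commute[OF r[THEN rep_keys]] by auto
    qed
  next
    fix x assume xyw: "x \<in> carrier M"
    show "\<one>\<^bsub>M\<^esub> \<otimes>\<^bsub>M\<^esub> x = x"
    proof (rule ext1)
      fix n
      obtain u where r: "rep n u x" using ex xyw by meson
      have "rep n (mul (frag_of [\<one>\<^bsub>A\<^esub>]) u) (\<one>\<^bsub>M\<^esub> \<otimes>\<^bsub>M\<^esub> x)" using xyw r ou oc by (auto intro!: m)
      then show "\<exists>u. rep n u (\<one>\<^bsub>M\<^esub> \<otimes>\<^bsub>M\<^esub> x) \<and> rep n u x" using r mul_one[OF rep_keys[OF r]] by auto
    qed
  qed (use mc oc in auto)
  have cring: "cring M"
  proof (rule cringI[OF addg comm])
    fix x y w assume xyw: "x \<in> carrier M" "y \<in> carrier M" "w \<in> carrier M"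
    show "(x \<oplus>\<^bsub>M\<^esub> y) \<otimes>\<^bsub>M\<^esub> w = x \<otimes>\<^bsub>M\<^esub> w \<oplus>\<^bsub>M\<^esub> y \<otimes>\<^bsub>M\<^esub> w"
    proof (rule ext1)
      fix n
      obtain u v t where r: "rep n u x" "rep n v y" "rep n t w" using ex xyw by meson
      have "rep n (mul (u + v) t) ((x \<oplus>\<^bsub>M\<^esub> y) \<otimes>\<^bsub>M\<^esub> w)" using xyw r by (auto intro!: m a ac)
      moreover have "rep n (mul u t + mul v t) (x \<otimes>\<^bsub>M\<^esub> w \<oplus>\<^bsub>M\<^esub> y \<otimes>\<^bsub>M\<^esub> w)"
        using xyw r by (auto intro!: m a mc)
      ultimately show "\<exists>u. rep n u ((x \<oplus>\<^bsub>M\<^esub> y) \<otimes>\<^bsub>M\<^esub> w) \<and> rep n u (x \<otimes>\<^bsub>M\<^esub> w \<oplus>\<^bsub>M\<^esub> y \<otimes>\<^bsub>M\<^esub> w)"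
        by (auto simp: shuffle_frag_additive_left)
    qed
  qed
  have alg: "algebra C M"
  proof (rule algebraI[OF R_cring cring])
    fix c x assume "c \<in> carrier C" "x \<in> carrier M"
    then show "c \<odot>\<^bsub>M\<^esub> x \<in> carrier M" by (rule sc)
  next
    fix c d x assume cd: "c \<in> carrier C" "d \<in> carrier C" and x: "x \<in> carrier M"
    show "(c \<oplus>\<^bsub>C\<^esub> d) \<odot>\<^bsub>M\<^esub> x = c \<odot>\<^bsub>M\<^esub> x \<oplus>\<^bsub>M\<^esub> d \<odot>\<^bsub>M\<^esub> x"
    proof (rule rep_ext)
      fix n
      obtain u where r: "rep n u x" using ex x by meson
      have "rep n (scale_frag A (c \<oplus>\<^bsub>C\<^esub> d) u) ((c \<oplus>\<^bsub>C\<^esub> d) \<odot>\<^bsub>M\<^esub> x)"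
        "rep n (scale_frag A c u + scale_frag A d u) (c \<odot>\<^bsub>M\<^esub> x \<oplus>\<^bsub>M\<^esub> d \<odot>\<^bsub>M\<^esub> x)"
        using cd x r by (auto intro!: s a sc)
      then show "\<exists>u v. rep n u ((c \<oplus>\<^bsub>C\<^esub> d) \<odot>\<^bsub>M\<^esub> x) \<and> rep n v (c \<odot>\<^bsub>M\<^esub> x \<oplus>\<^bsub>M\<^esub> d \<odot>\<^bsub>M\<^esub> x) \<and> u - v \<in> N n"
        using scale_add_scalars[OF cd rep_keys[OF r]] by blast
    qed
    show "(c \<otimes>\<^bsub>C\<^esub> d) \<odot>\<^bsub>M\<^esub> x = c \<odot>\<^bsub>M\<^esub> (d \<odot>\<^bsub>M\<^esub> x)"
    proof (rule ext1)
      fix n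
      obtain u where r: "rep n u x" using ex x by meson
      have "rep n (scale_frag A (c \<otimes>\<^bsub>C\<^esub> d) u) ((c \<otimes>\<^bsub>C\<^esub> d) \<odot>\<^bsub>M\<^esub> x)"
        "rep n (scale_frag A c (scale_frag A d u)) (c \<odot>\<^bsub>M\<^esub> (d \<odot>\<^bsub>M\<^esub> x))"
        using cd x r by (auto intro!: s sc)
      then show "\<exists>u. rep n u ((c \<otimes>\<^bsub>C\<^esub> d) \<odot>\<^bsub>M\<^esub> x) \<and> rep n u (c \<odot>\<^bsub>M\<^esub> (d \<odot>\<^bsub>M\<^esub> x))"
        using scale_scale[OF cd rep_keys[OF r]] by auto
    qed
  next
    fix c x y assume c: "c \<in> carrier C" and x: "x \<in> carrier M" and y: "y \<in> carrier M"
    show "c \<odot>\<^bsub>M\<^esub> (x \<oplus>\<^bsub>M\<^esub> y) = c \<odot>\<^bsub>M\<^esub> x \<oplus>\<^bsub>M\<^esub> c \<odot>\<^bsub>M\<^esub> y"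
    proof (rule ext1)
      fix n
      obtain u v where r: "rep n u x" "rep n v y" using ex x y by meson
      have "rep n (scale_frag A c (u + v)) (c \<odot>\<^bsub>M\<^esub> (x \<oplus>\<^bsub>M\<^esub> y))"
        "rep n (scale_frag A c u + scale_frag A c v) (c \<odot>\<^bsub>M\<^esub> x \<oplus>\<^bsub>M\<^esub> c \<odot>\<^bsub>M\<^esub> y)"
        using c x y r by (auto intro!: s a sc ac)
      then show "\<exists>u. rep n u (c \<odot>\<^bsub>M\<^esub> (x \<oplus>\<^bsub>M\<^esub> y)) \<and> rep n u (c \<odot>\<^bsub>M\<^esub> x \<oplus>\<^bsub>M\<^esub> c \<odot>\<^bsub>M\<^esub> y)"
        by (auto simp: scale_frag_additive)
    qed
    show "(c \<odot>\<^bsub>M\<^esub> x) \<otimes>\<^bsub>M\<^esub> y = c \<odot>\<^bsub>M\<^esub> (x \<otimes>\<^bsub>M\<^esub> y)"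
    proof (rule ext1)
      fix n
      obtain u v where r: "rep n u x" "rep n v y" using ex x y by meson
      have "rep n (mul (scale_frag A c u) v) ((c \<odot>\<^bsub>M\<^esub> x) \<otimes>\<^bsub>M\<^esub> y)"
        "rep n (scale_frag A c (mul u v)) (c \<odot>\<^bsub>M\<^esub> (x \<otimes>\<^bsub>M\<^esub> y))"
        using c x y r by (auto intro!: s m sc mc)
      then show "\<exists>u. rep n u ((c \<odot>\<^bsub>M\<^esub> x) \<otimes>\<^bsub>M\<^esub> y) \<and> rep n u (c \<odot>\<^bsub>M\<^esub> (x \<otimes>\<^bsub>M\<^esub> y))"
        using mul_scale[OF c r[THEN rep_keys]] by auto
    qed
  next
    fix x assume x: "x \<in> carrier M"
    show "\<one>\<^bsub>C\<^esub> \<odot>\<^bsub>M\<^esub> x = x"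
    proof (rule ext1)
      fix n
      obtain u where r: "rep n u x" using ex x by meson
      have "rep n (scale_frag A \<one>\<^bsub>C\<^esub> u) (\<one>\<^bsub>C\<^esub> \<odot>\<^bsub>M\<^esub> x)" using x r by (auto intro!: s)
      then show "\<exists>u. rep n u (\<one>\<^bsub>C\<^esub> \<odot>\<^bsub>M\<^esub> x) \<and> rep n u x" using scale_one[OF rep_keys[OF r]] r by auto
    qed
  qed
  have lin: "linear_map C M M (Sh_op C A)"
    unfolding linear_map_def
  proof (intro conjI ballI funcsetI)
    fix x assume "x \<in> carrier M"
    then show "Sh_op C A x \<in> carrier M" by (rule pc)
  next
    fix x y assume x: "x \<in> carrier M" and y: "y \<in> carrier M"
    show "Sh_op C A (x \<oplus>\<^bsub>M\<^esub> y) = Sh_op C A x \<oplus>\<^bsub>M\<^esub> Sh_op C A y"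
    proof (rule ext1)
      fix n
      obtain u v where r: "rep n u x" "rep n v y" using ex x y by meson
      have "rep n (prefix_frag A (u + v)) (Sh_op C A (x \<oplus>\<^bsub>M\<^esub> y))"
        "rep n (prefix_frag A u + prefix_frag A v) (Sh_op C A x \<oplus>\<^bsub>M\<^esub> Sh_op C A y)"
        using x y r by (auto intro!: p a pc ac)
      then show "\<exists>u. rep n u (Sh_op C A (x \<oplus>\<^bsub>M\<^esub> y)) \<and> rep n u (Sh_op C A x \<oplus>\<^bsub>M\<^esub> Sh_op C A y)"
        by (auto simp: prefix_frag_additive)
    qed
  next
    fix c x assume c: "c \<in> carrier C" and x: "x \<in> carrier M"
    show "Sh_op C A (c \<odot>\<^bsub>M\<^esub> x) = c \<odot>\<^bsub>M\<^esub> Sh_op C A x"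
    proof (rule rep_ext)
      fix n
      obtain u where r: "rep n u x" using ex x by meson
      have "rep n (prefix_frag A (scale_frag A c u)) (Sh_op C A (c \<odot>\<^bsub>M\<^esub> x))"
        "rep n (scale_frag A c (prefix_frag A u)) (c \<odot>\<^bsub>M\<^esub> Sh_op C A x)"
        using c x r by (auto intro!: p s pc sc)
      then show "\<exists>u v. rep n u (Sh_op C A (c \<odot>\<^bsub>M\<^esub> x)) \<and> rep n v (c \<odot>\<^bsub>M\<^esub> Sh_op C A x) \<and> u - v \<in> N n"
        using prefix_scale[OF c rep_keys[OF r]] by blast
    qed
  qed
  have "Sh_op C A x \<otimes>\<^bsub>M\<^esub> Sh_op C A y =
      Sh_op C A (x \<otimes>\<^bsub>M\<^esub> Sh_op C A y) \<oplus>\<^bsub>M\<^esub> Sh_op C A (y \<otimes>\<^bsub>M\<^esub> Sh_op C A x) \<oplus>\<^bsub>M\<^esub>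
      lam \<odot>\<^bsub>M\<^esub> Sh_op C A (x \<otimes>\<^bsub>M\<^esub> y)" (is "?l = ?r")
    if x: "x \<in> carrier M" and y: "y \<in> carrier M" for x y
  proof (rule rep_ext)
    fix n
    let ?P = "prefix_frag A"
    obtain u v where r: "rep n u x" "rep n v y" using ex x y by meson
    have "rep n (mul (?P u) (?P v)) ?l" using x y r by (auto intro!: m p pc)
    moreover have "rep n (?P (mul u (?P v)) + ?P (mul v (?P u)) + scale_frag A lam (?P (mul u v))) ?r"
      using x y r by (auto intro!: m p pc a ac mc s sc lam_closed)
    ultimately show "\<exists>u v. rep n u ?l \<and> rep n v ?r \<and> u - v \<in> N n"
      using baxter_identity_frag[OF r[THEN rep_keys]] by blast
  qed
  then show ?thesis
    unfolding baxter_algebra_def baxter_operator_def using alg lin by blast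
qed

lemma rep_all_family:
  assumes "\<And>n. rep n u x"
  shows "x = family u"
proof
  show "x k = family u k" for k using assms[of k] by (simp add: rep_def family_def)
qed

lemma represented_Sh_prod: "represented (Sh_prod C lam A)"
proof -
  have fam: "x \<in> families" if reps: "\<And>n. \<exists>u. rep n u x" for x
    unfolding families_iff
  proof
    fix k
    obtain u where "rep k u x" using reps by blast
    then show "x k \<in> carrier (Shk k)"
      by (auto simp: rep_def Sh_comp_carrier degree_part_keys)
  qed
  have ex: "\<exists>u. rep n u x" if "x \<in> families" for n x
    using rep_exists[OF that] by blast
  have p: "rep n (prefix_frag A u) (Sh_op C A x)" if "rep n u x" for n u x
    by (rule rep_mono[OF rep_op[OF that]]) simp
  have a: "rep n (u + v) (x \<oplus>\<^bsub>Sh_prod C lam A\<^esub> y)" if "rep n u x" "rep n v y" for n u v x y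
    using rep_add[OF that] by (simp add: Sh_prod_def)
  have s: "rep n (scale_frag A c u) (c \<odot>\<^bsub>Sh_prod C lam A\<^esub> x)" if "c \<in> carrier C" "rep n u x" for n u c x
    using rep_smult[OF that(2,1)] by (simp add: Sh_prod_def)
  have ou: "rep n (frag_of [\<one>\<^bsub>A\<^esub>]) \<one>\<^bsub>Sh_prod C lam A\<^esub>" and z: "rep n 0 \<zero>\<^bsub>Sh_prod C lam A\<^esub>" for n
    using rep_incl[of "\<one>\<^bsub>A\<^esub>" n] rep_zero by (simp_all add: Sh_prod_def)
  show ?thesis
    unfolding represented_def
    by (intro conjI ballI allI impI order_refl fam)
      (blast intro: rep_Sh_prod_mult a s ou z p dest: ex)+
qed

lemma represented_Sh: "represented (Sh C lam A)"
proof -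
  let ?S = "carrier (Sh C lam A)"
  have fam: "x \<in> ?S" if "\<And>n. rep n u x" for x u
    using rep_all_family[OF that] rep_keys[OF that[of 0]] by (auto simp: Sh_carrier)
  have ex: "\<exists>u. \<forall>n. rep n u x" if "x \<in> ?S" for x
    using that by (auto simp: Sh_carrier intro: rep_family)
  have p: "rep n (prefix_frag A u) (Sh_op C A x)" if "rep n u x" for n u x
    by (rule rep_mono[OF rep_op[OF that]]) simp
  have a: "rep n (u + v) (x \<oplus>\<^bsub>Sh C lam A\<^esub> y)" if "rep n u x" "rep n v y" for n u v x y
    using rep_add[OF that] by (simp add: Sh_def)
  have s: "rep n (scale_frag A c u) (c \<odot>\<^bsub>Sh C lam A\<^esub> x)" if "c \<in> carrier C" "rep n u x" for n u c x
    using rep_smult[OF that(2,1)] by (simp add: Sh_def)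
  have ou: "rep n (frag_of [\<one>\<^bsub>A\<^esub>]) \<one>\<^bsub>Sh C lam A\<^esub>" and z: "rep n 0 \<zero>\<^bsub>Sh C lam A\<^esub>" for n
    using rep_incl[of "\<one>\<^bsub>A\<^esub>" n] rep_zero by (simp_all add: Sh_def)
  have mc: "x \<otimes>\<^bsub>Sh C lam A\<^esub> y \<in> ?S" if xy: "x \<in> ?S" "y \<in> ?S" for x y
  proof -
    obtain u v where "\<forall>n. rep n u x" "\<forall>n. rep n v y" using ex xy by meson
    then show ?thesis using rep_Sh_mult[OF xy] fam by blast
  qed
  have ac: "x \<oplus>\<^bsub>Sh C lam A\<^esub> y \<in> ?S" if xy: "x \<in> ?S" "y \<in> ?S" for x y
  proof -
    obtain u v where "\<forall>n. rep n u x" "\<forall>n. rep n v y" using ex xy by meson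
    then show ?thesis using a fam by blast
  qed
  have sc: "c \<odot>\<^bsub>Sh C lam A\<^esub> x \<in> ?S" if "c \<in> carrier C" "x \<in> ?S" for c x
    using ex[OF that(2)] s[OF that(1)] fam by blast
  have pc: "Sh_op C A x \<in> ?S" if "x \<in> ?S" for x
    using ex[OF that] p fam by blast
  show ?thesis
    unfolding represented_def
    using mc ac sc pc fam[OF ou] fam[OF z] Sh_subset_families
    by (auto intro: rep_Sh_mult a s ou z)
qed

lemma baxter_Sh: "baxter_algebra C lam (Sh C lam A) (Sh_op C A)"
  by (rule represented_baxter_algebra[OF represented_Sh])

lemma baxter_Sh_prod: "baxter_algebra C lam (Sh_prod C lam A) (Sh_op C A)"
  by (rule represented_baxter_algebra[OF represented_Sh_prod])

section \<open>The Baxter filtration of the direct sum\<close>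

abbreviation ShA where "ShA \<equiv> Sh C lam A"
abbreviation op where "op \<equiv> Sh_op C A"

lemma algebra_Sh: "algebra C ShA"
  using baxter_Sh by (simp add: baxter_algebra_def)

lemma cring_Sh: "cring ShA"
  by (rule algebra.M_cring[OF algebra_Sh])

lemma Sh_closed:
  "x \<in> carrier ShA \<Longrightarrow> y \<in> carrier ShA \<Longrightarrow> x \<otimes>\<^bsub>ShA\<^esub> y \<in> carrier ShA"
  "x \<in> carrier ShA \<Longrightarrow> y \<in> carrier ShA \<Longrightarrow> x \<oplus>\<^bsub>ShA\<^esub> y \<in> carrier ShA"
  "\<one>\<^bsub>ShA\<^esub> \<in> carrier ShA" "\<zero>\<^bsub>ShA\<^esub> \<in> carrier ShA"
  "c \<in> carrier C \<Longrightarrow> x \<in> carrier ShA \<Longrightarrow> c \<odot>\<^bsub>ShA\<^esub> x \<in> carrier ShA"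
  "x \<in> carrier ShA \<Longrightarrow> op x \<in> carrier ShA"
  using represented_Sh unfolding represented_def by blast+

lemma family_Sh: "Poly_Mapping.keys u \<subseteq> W 0 \<Longrightarrow> family u \<in> carrier ShA"
  by (auto simp: Sh_carrier)

lemma family_add:
  "family (u + v) = family u \<oplus>\<^bsub>ShA\<^esub> family v"
  by (simp add: Sh_def family_def Sh_comp_add degree_part_additive)

lemma family_zero: "family 0 = \<zero>\<^bsub>ShA\<^esub>"
  by (simp add: Sh_def family_def Sh_comp_zero degree_part_additive)

lemma family_diff:
  assumes "Poly_Mapping.keys u \<subseteq> W 0" "Poly_Mapping.keys v \<subseteq> W 0"
  shows "family (u - v) = family u \<ominus>\<^bsub>ShA\<^esub> family v"
proof -
  interpret S: cring ShA by (rule cring_Sh)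
  have c: "family (u - v) \<in> carrier ShA" "family v \<in> carrier ShA"
    using assms by (simp_all add: family_Sh keys_diff_subset)
  have "family u = family (u - v) \<oplus>\<^bsub>ShA\<^esub> family v"
    using family_add[of "u - v" v] by simp
  then show ?thesis using c by (simp add: a_minus_def S.a_assoc S.r_neg)
qed

lemma family_mult:
  assumes "Poly_Mapping.keys u \<subseteq> W 0" "Poly_Mapping.keys v \<subseteq> W 0"
  shows "family (mul u v) = family u \<otimes>\<^bsub>ShA\<^esub> family v"
  using assms by (intro rep_all_family[symmetric] rep_Sh_mult rep_family family_Sh)

lemma family_prefix:
  assumes "Poly_Mapping.keys u \<subseteq> W 0"
  shows "family (prefix_frag A u) = op (family u)"
proof (intro rep_all_family[symmetric])
  show "rep n (prefix_frag A u) (op (family u))" for n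
    by (rule rep_mono[OF rep_op[OF rep_family[OF assms, of n]]]) simp
qed

lemma family_letter: "a \<in> carrier A \<Longrightarrow> family (frag_of [a]) = Sh_incl C A a"
  by (intro rep_all_family[symmetric] rep_incl)

text \<open>The factorization \<open>a \<otimes> w = a \<diamondop> (1 \<otimes> w)\<close>. By it pure tensors are reached from \<open>A\<close> through products
  and the Baxter operator, which identifies the filtration and determines homomorphisms.\<close>

lemma family_word_Cons:
  assumes "a \<in> carrier A" "set w \<subseteq> carrier A" "w \<noteq> []"
  shows "family (frag_of (a # w)) = Sh_incl C A a \<otimes>\<^bsub>ShA\<^esub> op (family (frag_of w))"
proof -
  have w: "Poly_Mapping.keys (frag_of w) \<subseteq> W 0" "Poly_Mapping.keys (frag_of [a]) \<subseteq> W 0"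
    using assms by (cases w; simp add: words_ge_def)+
  have "frag_of (a # w) = mul (frag_of [a]) (prefix_frag A (frag_of w))"
    using assms(1) by (simp add: mul_words)
  then show ?thesis
    using w prefix_keys[OF w(1)] words_ge_mono[of 0 "Suc 0"] assms(1)
    by (simp only: family_mult[OF w(2)] family_prefix family_letter subset_trans[OF prefix_keys])
qed

definition order_ge :: "nat \<Rightarrow> (nat \<Rightarrow> 'a tensor) set" where
  "order_ge n = {x \<in> carrier ShA. \<forall>k<n. x k = \<zero>\<^bsub>Shk k\<^esub>}"

lemma order_ge_Suc_rep: "x \<in> order_ge (Suc n) \<longleftrightarrow> x \<in> carrier ShA \<and> rep n 0 x"
  by (auto simp: order_ge_def rep_def Sh_comp_zero degree_part_additive)

lemma order_ge_mono: "m \<le> n \<Longrightarrow> order_ge n \<subseteq> order_ge m"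
  by (auto simp: order_ge_def)

text \<open>Vanishing below degree \<open>n\<close> means being represented by \<open>0\<close> up to degree \<open>n - 1\<close>, and then so is every
  multiple.\<close>

lemma order_ge_mult:
  assumes "x \<in> order_ge n" "y \<in> carrier ShA"
  shows "x \<otimes>\<^bsub>ShA\<^esub> y \<in> order_ge n"
proof (cases n)
  case 0
  then show ?thesis using assms Sh_closed(1) by (simp add: order_ge_def)
next
  case (Suc m)
  then have x: "x \<in> carrier ShA" "rep m 0 x" using assms(1) by (simp_all add: order_ge_Suc_rep)
  obtain v where "rep m v y" using rep_exists[OF Sh_subset_families[OF assms(2)]] by blast
  then have "rep m (mul 0 v) (x \<otimes>\<^bsub>ShA\<^esub> y)" by (rule rep_Sh_mult[OF x(1) assms(2) x(2)])
  then show ?thesis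
    using Sh_closed(1)[OF x(1) assms(2)] by (simp add: Suc order_ge_Suc_rep shuffle_frag_additive_left)
qed

lemma order_ge_op:
  assumes "x \<in> order_ge n"
  shows "op x \<in> order_ge (Suc n)"
proof -
  have "op x \<in> carrier ShA" using assms by (simp add: order_ge_def Sh_closed(6))
  moreover have "op x k = \<zero>\<^bsub>Shk k\<^esub>" if "k < Suc n" for k
    using that assms one_tensor_cls[of _ 0]
    by (cases k) (auto simp: order_ge_def Sh_op_def Sh_comp_zero prefix_frag_additive)
  ultimately show ?thesis by (simp add: order_ge_def)
qed

lemma ideal_order_ge: "ideal (order_ge n) ShA"
proof -
  interpret S: algebra C ShA by (rule algebra_Sh)
  have sub: "order_ge n \<subseteq> carrier ShA" by (auto simp: order_ge_def)
  have add: "x \<oplus>\<^bsub>ShA\<^esub> y \<in> order_ge n" if "x \<in> order_ge n" "y \<in> order_ge n" for x y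
  proof -
    have "(x \<oplus>\<^bsub>ShA\<^esub> y) k = \<zero>\<^bsub>Shk k\<^esub>" if "k < n" for k
    proof -
      have "(x \<oplus>\<^bsub>ShA\<^esub> y) k = x k \<oplus>\<^bsub>Shk k\<^esub> y k" by (simp add: Sh_def)
      then show ?thesis using that \<open>x \<in> order_ge n\<close> \<open>y \<in> order_ge n\<close>
        by (simp add: order_ge_def Sh_comp_zero Sh_comp_add)
    qed
    then show ?thesis using that Sh_closed(2) by (simp add: order_ge_def)
  qed
  have neg: "\<ominus>\<^bsub>ShA\<^esub> x \<in> order_ge n" if "x \<in> order_ge n" for x
  proof -
    have x: "x \<in> carrier ShA" using that by (simp add: order_ge_def)
    have "\<ominus>\<^bsub>ShA\<^esub> x = x \<otimes>\<^bsub>ShA\<^esub> (\<ominus>\<^bsub>ShA\<^esub> \<one>\<^bsub>ShA\<^esub>)" using x by (simp add: S.r_minus)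
    then show ?thesis using order_ge_mult[OF that, of "\<ominus>\<^bsub>ShA\<^esub> \<one>\<^bsub>ShA\<^esub>"] by simp
  qed
  have zero: "\<zero>\<^bsub>ShA\<^esub> \<in> order_ge n" using Sh_closed(4) by (simp add: order_ge_def) (simp add: Sh_def)
  show ?thesis
  proof (rule idealI[OF S.ring_axioms])
    show "subgroup (order_ge n) (add_monoid ShA)"
      by (rule group.subgroupI[OF S.add.is_group]) (use sub add neg zero in \<open>auto simp: a_inv_def\<close>)
  next
    fix x y assume xy: "x \<in> order_ge n" "y \<in> carrier ShA"
    show "x \<otimes>\<^bsub>ShA\<^esub> y \<in> order_ge n" by (rule order_ge_mult[OF xy])
    then show "y \<otimes>\<^bsub>ShA\<^esub> x \<in> order_ge n" using xy sub S.m_comm[of y x] by auto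
  qed
qed

text \<open>A word of degree above \<open>n\<close> is a multiple of the image under the operator of a word of degree
  at least \<open>n\<close>.\<close>

lemma order_ge_generated:
  assumes "ideal I ShA" and P: "op ` order_ge n \<subseteq> I"
  shows "order_ge (Suc n) \<subseteq> I"
proof
  interpret I: ideal I ShA by fact
  have word: "family (frag_of w) \<in> I" if long: "w \<in> W (Suc n)" for w
  proof -
    obtain a w' where w: "w = a # w'" "a \<in> carrier A" "set w' \<subseteq> carrier A" "Suc n \<le> length w'"
      using long by (rule words_ge_cases)
    have w'n: "w' \<in> W n" and w'0: "w' \<in> W 0" and ne: "w' \<noteq> []" using w by (auto simp: words_ge_def)
    have "family (frag_of w') \<in> order_ge n"
      using w'n w'0 family_Sh[of "frag_of w'"]
      by (auto simp: order_ge_def family_def Sh_comp_zero degree_part_of words_ge_def)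
    then have "op (family (frag_of w')) \<in> I" using P by blast
    moreover have "Sh_incl C A a \<in> carrier ShA"
      using family_Sh[of "frag_of [a]"] w(2) by (simp add: family_letter words_ge_def)
    ultimately show ?thesis
      unfolding w(1) family_word_Cons[OF w(2,3) ne] by (rule I.I_l_closed)
  qed
  have frag: "family u \<in> I" if "Poly_Mapping.keys u \<subseteq> W (Suc n)" for u
  proof -
    have "Poly_Mapping.keys u \<subseteq> W (Suc n) \<and> family u \<in> I"
      using that
    proof (induction u rule: frag_induction)
      case (diff u v)
      have "W (Suc n) \<subseteq> W 0" by (rule words_ge_mono) simp
      then have "family (u - v) = family u \<ominus>\<^bsub>ShA\<^esub> family v"
        using diff by (intro family_diff) auto
      moreover have "family u \<ominus>\<^bsub>ShA\<^esub> family v \<in> I"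
        using diff by (simp add: a_minus_def I.a_closed I.a_inv_closed)
      ultimately show ?case using diff keys_diff_subset[of u "W (Suc n)" v] by simp
    qed (simp_all add: word family_zero)
    then show ?thesis ..
  qed
  fix x assume x: "x \<in> order_ge (Suc n)"
  then obtain u where u: "Poly_Mapping.keys u \<subseteq> W 0" "x = family u"
    by (auto simp: order_ge_def Sh_carrier)
  \<comment> \<open>the parts of low degree represent zero, so a representative of \<open>x\<close> without them exists\<close>
  let ?v = "u - (\<Sum>k\<le>n. degree_part k u)"
  have v: "Poly_Mapping.keys ?v \<subseteq> W (Suc n)" using u(1) by (rule degree_parts_rest)
  have "x = family ?v"
  proof
    fix k
    have sum: "degree_part k (\<Sum>j\<le>n. degree_part j u) = (if k \<le> n then degree_part k u else 0)"
      using sum_components(2)[of "\<lambda>j. degree_part j u" "{..n}" k] degree_part_keys[OF u(1)] by simp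
    show "x k = family ?v k"
      using x unfolding order_ge_def
      by (cases "k \<le> n") (auto simp: u(2) family_def degree_part_diff sum Sh_comp_zero)
  qed
  then show "x \<in> I" using frag[OF v] by simp
qed

lemma Fil_Sh: "Fil ShA op n = order_ge n"
proof (induction n)
  case 0
  then show ?case by (simp add: order_ge_def)
next
  case (Suc n)
  have "baxter_ideal ShA op (order_ge (Suc n))"
    using ideal_order_ge order_ge_op order_ge_mono[of "Suc n" "Suc (Suc n)"]
    unfolding baxter_ideal_def by auto
  moreover have "op ` order_ge n \<subseteq> order_ge (Suc n)" using order_ge_op by blast
  ultimately have "baxter_ideal_gen ShA op (op ` order_ge n) \<subseteq> order_ge (Suc n)"
    unfolding baxter_ideal_gen_def by blast
  moreover have "order_ge (Suc n) \<subseteq> baxter_ideal_gen ShA op (op ` order_ge n)"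
    unfolding baxter_ideal_gen_def baxter_ideal_def using order_ge_generated by blast
  ultimately show ?case using Suc by simp
qed

section \<open>The completion as a family of components\<close>

definition nbhd :: "nat \<Rightarrow> (nat \<Rightarrow> 'a tensor) \<Rightarrow> (nat \<Rightarrow> 'a tensor) set" where
  "nbhd n x = {r \<in> carrier ShA. \<forall>k<n. r k = x k}"

lemma nbhd_agree: "(\<And>k. k < n \<Longrightarrow> x k = y k) \<Longrightarrow> nbhd n x = nbhd n y"
  by (auto simp: nbhd_def)

lemma truncate_nbhd: "x \<in> families \<Longrightarrow> truncate C A n x \<in> nbhd n x"
  by (simp add: nbhd_def truncate_Sh) (simp add: truncate_def)

text \<open>Two elements are congruent modulo the \<open>n\<close>-th step of the filtration exactly if their components
  below \<open>n\<close> agree.\<close>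

lemma coset_nbhd:
  assumes "r \<in> carrier ShA"
  shows "Fil ShA op n +>\<^bsub>ShA\<^esub> r = nbhd n r"
proof (intro equalityI subsetI)
  interpret S: cring ShA by (rule cring_Sh)
  fix s assume "s \<in> Fil ShA op n +>\<^bsub>ShA\<^esub> r"
  then obtain h where h: "h \<in> order_ge n" and s: "s = h \<oplus>\<^bsub>ShA\<^esub> r"
    by (auto simp: Fil_Sh a_r_coset_def')
  have h': "h \<in> carrier ShA" using h by (simp add: order_ge_def)
  have "s k = r k" if "k < n" for k
  proof -
    have "s k = h k \<oplus>\<^bsub>Shk k\<^esub> r k" by (simp add: s Sh_def)
    also have "\<dots> = (\<zero>\<^bsub>ShA\<^esub> \<oplus>\<^bsub>ShA\<^esub> r) k" using h that by (simp add: order_ge_def) (simp add: Sh_def)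
    also have "\<dots> = r k" using assms by simp
    finally show ?thesis .
  qed
  then show "s \<in> nbhd n r" using h' assms s by (simp add: nbhd_def)
next
  fix s assume s: "s \<in> nbhd n r"
  obtain u v where u: "Poly_Mapping.keys u \<subseteq> W 0" "r = family u" and v: "Poly_Mapping.keys v \<subseteq> W 0" "s = family v"
    using s assms by (auto simp: nbhd_def Sh_carrier)
  have "family (v - u) \<in> order_ge n"
    using s family_Sh[OF keys_diff_subset[OF v(1) u(1)]]
    by (auto simp: order_ge_def nbhd_def u v family_def Sh_comp_zero cls_eq_iff degree_part_diff)
  moreover have "s = family (v - u) \<oplus>\<^bsub>ShA\<^esub> r"
    using family_add[of "v - u" u] by (simp add: u v)
  ultimately show "s \<in> Fil ShA op n +>\<^bsub>ShA\<^esub> r"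
    by (auto simp: Fil_Sh a_r_coset_def')
qed

text \<open>This evaluates every map that is defined on cosets through representatives: only the components
  below \<open>n\<close> of the values matter.\<close>

lemma UN_cosets:
  assumes "S \<noteq> {}" "\<And>r. r \<in> S \<Longrightarrow> h r \<in> carrier ShA" "\<And>r k. r \<in> S \<Longrightarrow> k < n \<Longrightarrow> h r k = y k"
  shows "(\<Union>r\<in>S. Fil ShA op n +>\<^bsub>ShA\<^esub> h r) = nbhd n y"
proof (rule UN_constant_value[OF assms(1)])
  fix r assume r: "r \<in> S"
  show "Fil ShA op n +>\<^bsub>ShA\<^esub> h r = nbhd n y"
    unfolding coset_nbhd[OF assms(2)[OF r]] by (rule nbhd_agree) (rule assms(3)[OF r])
qed

lemma Quot_carrier: "carrier (ShA Quot Fil ShA op n) = nbhd n ` carrier ShA"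
  by (auto simp: FactRing_def A_RCOSETS_def' coset_nbhd)

text \<open>The inverse of \<^const>\<open>psi\<close>.\<close>

definition cosets_of :: "(nat \<Rightarrow> 'a tensor) \<Rightarrow> nat \<Rightarrow> (nat \<Rightarrow> 'a tensor) set" where
  "cosets_of x = (\<lambda>n. nbhd n x)"

lemma nbhd_truncate: "nbhd n (truncate C A n x) = nbhd n x"
  by (rule nbhd_agree) (simp add: truncate_def)

text \<open>In a compatible sequence the components below \<open>m\<close> are already determined at stage \<open>m\<close>. The component
  of degree \<open>k\<close> of the family is read off at stage \<open>k + 1\<close>, the first one that determines it.\<close>

lemma Sh_hat_carrier: "carrier (Sh_hat C lam A) = cosets_of ` families"
proof (intro equalityI subsetI)
  fix X assume "X \<in> carrier (Sh_hat C lam A)"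
  then have X: "\<And>n. X n \<in> nbhd n ` carrier ShA"
    and compat: "\<And>m n. m \<le> n \<Longrightarrow> (\<Union>r\<in>X n. Fil ShA op m +>\<^bsub>ShA\<^esub> r) = X m"
    by (auto simp: Sh_hat_def completion_def Quot_carrier)
  from X have "\<forall>n. \<exists>r. r \<in> carrier ShA \<and> X n = nbhd n r" by blast
  then obtain r where "\<forall>n. r n \<in> carrier ShA \<and> X n = nbhd n (r n)" by (rule choice[THEN exE])
  then have r: "\<And>n. r n \<in> carrier ShA" "\<And>n. X n = nbhd n (r n)" by simp_all
  have self: "r n \<in> X n" for n using r by (simp add: nbhd_def)
  have agree: "r m k = r n k" if "k < m" "m \<le> n" for k m n
  proof -
    have "X m = nbhd m (r n)"
      unfolding compat[OF that(2), symmetric]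
      by (rule UN_cosets) (use self that in \<open>auto simp: r(2) nbhd_def\<close>)
    then show ?thesis using self[of m] that(1) by (simp add: nbhd_def)
  qed
  define x where "x k = r (Suc k) k" for k
  have "x \<in> families"
    unfolding families_iff x_def using r(1)[THEN Sh_subset_families] by (simp add: families_iff)
  moreover have "X = cosets_of x"
  proof
    fix n
    show "X n = cosets_of x n"
      unfolding cosets_of_def r(2) by (rule nbhd_agree) (simp add: x_def agree[of _ "Suc _" n])
  qed
  ultimately show "X \<in> cosets_of ` families" by blast
next
  fix X assume "X \<in> cosets_of ` families"
  then obtain x where x: "x \<in> families" "X = cosets_of x" by blast
  have "X n \<in> nbhd n ` carrier ShA" for n
    using truncate_Sh[OF x(1), of n] nbhd_truncate[of n x] by (metis x(2) cosets_of_def image_eqI)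
  moreover have "(\<Union>r\<in>X n. Fil ShA op m +>\<^bsub>ShA\<^esub> r) = X m" if "m \<le> n" for m n
    unfolding x(2) cosets_of_def
    by (rule UN_cosets) (use truncate_nbhd[OF x(1)] that in \<open>auto simp: nbhd_def\<close>)
  ultimately show "X \<in> carrier (Sh_hat C lam A)"
    by (simp add: Sh_hat_def completion_def Quot_carrier)
qed

lemma psi_cosets_of:
  assumes "x \<in> families"
  shows "psi (cosets_of x) = x"
proof
  fix k
  have "(THE z. \<forall>n>k. \<forall>r\<in>cosets_of x n. r k = z) = x k"
  proof (rule the_equality)
    fix z assume "\<forall>n>k. \<forall>r\<in>cosets_of x n. r k = z"
    then have "truncate C A (Suc k) x k = z"
      using truncate_nbhd[OF assms] unfolding cosets_of_def by blast
    then show "z = x k" by (simp add: truncate_def)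
  qed (simp add: cosets_of_def nbhd_def)
  then show "psi (cosets_of x) k = x k" by (simp add: psi_def)
qed

lemma nbhd_coset:
  assumes "x \<in> families"
  shows "nbhd n x = Fil ShA op n +>\<^bsub>ShA\<^esub> truncate C A n x"
  by (simp add: coset_nbhd truncate_Sh[OF assms] nbhd_truncate)

text \<open>The coset of level \<open>n\<close> contains the truncation at \<open>n\<close>, and a product up to degree \<open>n\<close> does not notice
  the truncation of its factors.\<close>

lemma cosets_of_mult:
  assumes "x \<in> families" "y \<in> families"
  shows "cosets_of (x \<otimes>\<^bsub>Sh_prod C lam A\<^esub> y) = cosets_of x \<otimes>\<^bsub>Sh_hat C lam A\<^esub> cosets_of y"
proof
  fix n
  let ?x = "truncate C A n x" and ?y = "truncate C A n y"
  interpret I: ideal "Fil ShA op n" ShA by (simp add: Fil_Sh ideal_order_ge)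
  have t: "?x \<in> carrier ShA" "?y \<in> carrier ShA" using assms by (simp_all add: truncate_Sh)
  have "(cosets_of x \<otimes>\<^bsub>Sh_hat C lam A\<^esub> cosets_of y) n =
      rcoset_mult ShA (Fil ShA op n) (Fil ShA op n +>\<^bsub>ShA\<^esub> ?x) (Fil ShA op n +>\<^bsub>ShA\<^esub> ?y)"
    by (simp add: Sh_hat_def completion_def FactRing_def cosets_of_def nbhd_coset assms)
  also have "\<dots> = nbhd n (?x \<otimes>\<^bsub>ShA\<^esub> ?y)"
    by (simp only: I.rcoset_mult_add[OF t] coset_nbhd[OF Sh_closed(1)[OF t]])
  also have "\<dots> = nbhd n (x \<otimes>\<^bsub>Sh_prod C lam A\<^esub> y)"
  proof (rule nbhd_agree)
    fix k assume "k < n"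
    obtain u v where uv: "rep n u x" "rep n v y" using rep_exists assms by meson
    have uv': "rep n u ?x" "rep n v ?y" using uv by (auto simp: rep_def truncate_def)
    have "rep n (mul u v) (?x \<otimes>\<^bsub>ShA\<^esub> ?y)" by (rule rep_Sh_mult[OF t uv'])
    moreover have "rep n (mul u v) (x \<otimes>\<^bsub>Sh_prod C lam A\<^esub> y)" by (rule rep_Sh_prod_mult[OF assms uv])
    ultimately show "(?x \<otimes>\<^bsub>ShA\<^esub> ?y) k = (x \<otimes>\<^bsub>Sh_prod C lam A\<^esub> y) k"
      using \<open>k < n\<close> by (simp add: rep_def)
  qed
  finally show "cosets_of (x \<otimes>\<^bsub>Sh_prod C lam A\<^esub> y) n = (cosets_of x \<otimes>\<^bsub>Sh_hat C lam A\<^esub> cosets_of y) n"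
    by (simp add: cosets_of_def)
qed

lemma cosets_of_add:
  assumes "x \<in> families" "y \<in> families"
  shows "cosets_of (x \<oplus>\<^bsub>Sh_prod C lam A\<^esub> y) = cosets_of x \<oplus>\<^bsub>Sh_hat C lam A\<^esub> cosets_of y"
proof
  fix n
  let ?x = "truncate C A n x" and ?y = "truncate C A n y"
  interpret I: ideal "Fil ShA op n" ShA by (simp add: Fil_Sh ideal_order_ge)
  have t: "?x \<in> carrier ShA" "?y \<in> carrier ShA" using assms by (simp_all add: truncate_Sh)
  have "(cosets_of x \<oplus>\<^bsub>Sh_hat C lam A\<^esub> cosets_of y) n =
      set_add ShA (Fil ShA op n +>\<^bsub>ShA\<^esub> ?x) (Fil ShA op n +>\<^bsub>ShA\<^esub> ?y)"
    by (simp add: Sh_hat_def completion_def FactRing_def cosets_of_def nbhd_coset assms)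
  also have "\<dots> = nbhd n (?x \<oplus>\<^bsub>ShA\<^esub> ?y)"
    by (simp only: I.a_rcos_sum[OF t] coset_nbhd[OF Sh_closed(2)[OF t]])
  also have "\<dots> = nbhd n (x \<oplus>\<^bsub>Sh_prod C lam A\<^esub> y)"
    by (rule nbhd_agree) (simp add: Sh_def Sh_prod_def truncate_def)
  finally show "cosets_of (x \<oplus>\<^bsub>Sh_prod C lam A\<^esub> y) n = (cosets_of x \<oplus>\<^bsub>Sh_hat C lam A\<^esub> cosets_of y) n"
    by (simp add: cosets_of_def)
qed

lemma cosets_of_one: "cosets_of \<one>\<^bsub>Sh_prod C lam A\<^esub> = \<one>\<^bsub>Sh_hat C lam A\<^esub>"
proof
  fix n
  have "\<one>\<^bsub>Sh_hat C lam A\<^esub> n = nbhd n \<one>\<^bsub>ShA\<^esub>"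
    by (simp add: Sh_hat_def completion_def FactRing_def coset_nbhd Sh_closed)
  then show "cosets_of \<one>\<^bsub>Sh_prod C lam A\<^esub> n = \<one>\<^bsub>Sh_hat C lam A\<^esub> n"
    by (simp add: cosets_of_def Sh_def Sh_prod_def)
qed

lemma cosets_of_zero: "cosets_of \<zero>\<^bsub>Sh_prod C lam A\<^esub> = \<zero>\<^bsub>Sh_hat C lam A\<^esub>"
proof
  fix n
  have "\<zero>\<^bsub>Sh_hat C lam A\<^esub> n = order_ge n"
    by (simp add: Sh_hat_def completion_def FactRing_def Fil_Sh)
  then show "cosets_of \<zero>\<^bsub>Sh_prod C lam A\<^esub> n = \<zero>\<^bsub>Sh_hat C lam A\<^esub> n"
    by (simp add: cosets_of_def order_ge_def nbhd_def Sh_prod_def)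
qed

lemma cosets_of_smult:
  assumes "c \<in> carrier C" "x \<in> families"
  shows "cosets_of (c \<odot>\<^bsub>Sh_prod C lam A\<^esub> x) = c \<odot>\<^bsub>Sh_hat C lam A\<^esub> cosets_of x"
proof
  fix n
  have "(c \<odot>\<^bsub>Sh_hat C lam A\<^esub> cosets_of x) n = (\<Union>r\<in>nbhd n x. Fil ShA op n +>\<^bsub>ShA\<^esub> (c \<odot>\<^bsub>ShA\<^esub> r))"
    by (simp add: Sh_hat_def completion_def cosets_of_def)
  also have "\<dots> = nbhd n (c \<odot>\<^bsub>Sh_prod C lam A\<^esub> x)"
  proof (rule UN_cosets)
    show "nbhd n x \<noteq> {}" using truncate_nbhd[OF assms(2)] by blast
    show "c \<odot>\<^bsub>ShA\<^esub> r \<in> carrier ShA" if "r \<in> nbhd n x" for r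
      using that assms(1) by (simp add: nbhd_def Sh_closed)
    show "(c \<odot>\<^bsub>ShA\<^esub> r) k = (c \<odot>\<^bsub>Sh_prod C lam A\<^esub> x) k" if "r \<in> nbhd n x" "k < n" for r k
      using that by (simp add: nbhd_def) (simp add: Sh_def Sh_prod_def)
  qed
  finally show "cosets_of (c \<odot>\<^bsub>Sh_prod C lam A\<^esub> x) n = (c \<odot>\<^bsub>Sh_hat C lam A\<^esub> cosets_of x) n"
    by (simp add: cosets_of_def)
qed

lemma cosets_of_op:
  assumes "x \<in> families"
  shows "Sh_hat_op C lam A (cosets_of x) = cosets_of (op x)"
proof
  fix n
  have "Sh_hat_op C lam A (cosets_of x) n = (\<Union>r\<in>nbhd n x. Fil ShA op n +>\<^bsub>ShA\<^esub> op r)"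
    by (simp add: Sh_hat_op_def completion_op_def completion_map_def cosets_of_def)
  also have "\<dots> = nbhd n (op x)"
  proof (rule UN_cosets)
    show "nbhd n x \<noteq> {}" using truncate_nbhd[OF assms] by blast
    show "op r k = op x k" if "r \<in> nbhd n x" "k < n" for r k
      using that by (auto simp: nbhd_def Sh_op_def split: nat.split)
  qed (simp add: nbhd_def Sh_closed)
  finally show "Sh_hat_op C lam A (cosets_of x) n = cosets_of (op x) n"
    by (simp add: cosets_of_def)
qed

end

section \<open>Transport along maps that respect the operations\<close>

text \<open>A surjection onto a structure of which no algebra axiom is presupposed. The completion receives its
  axioms in this way.\<close>

definition baxter_image ::
  "('c,'k) ring_scheme \<Rightarrow> ('c,'r,'m) module_scheme \<Rightarrow> ('r \<Rightarrow> 'r) \<Rightarrow>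
     ('c,'s,'n) module_scheme \<Rightarrow> ('s \<Rightarrow> 's) \<Rightarrow> ('r \<Rightarrow> 's) \<Rightarrow> bool"
where
  "baxter_image C M P N Q h \<longleftrightarrow>
     h ` carrier M = carrier N \<and> h \<one>\<^bsub>M\<^esub> = \<one>\<^bsub>N\<^esub> \<and> h \<zero>\<^bsub>M\<^esub> = \<zero>\<^bsub>N\<^esub> \<and>
     (\<forall>x\<in>carrier M. \<forall>y\<in>carrier M.
        h (x \<otimes>\<^bsub>M\<^esub> y) = h x \<otimes>\<^bsub>N\<^esub> h y \<and> h (x \<oplus>\<^bsub>M\<^esub> y) = h x \<oplus>\<^bsub>N\<^esub> h y) \<and>
     (\<forall>c\<in>carrier C. \<forall>x\<in>carrier M. h (c \<odot>\<^bsub>M\<^esub> x) = c \<odot>\<^bsub>N\<^esub> h x) \<and>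
     (\<forall>x\<in>carrier M. h (P x) = Q (h x))"

lemma baxter_algebra_image:
  assumes M: "baxter_algebra C lam M P" and lam: "lam \<in> carrier C" and h: "baxter_image C M P N Q h"
  shows "baxter_algebra C lam N Q"
proof -
  interpret M: algebra C M using M by (simp add: baxter_algebra_def)
  have P: "baxter_operator C lam M P" using M by (simp add: baxter_algebra_def)
  then have Pc: "x \<in> carrier M \<Longrightarrow> P x \<in> carrier M"
    and Padd: "x \<in> carrier M \<Longrightarrow> y \<in> carrier M \<Longrightarrow> P (x \<oplus>\<^bsub>M\<^esub> y) = P x \<oplus>\<^bsub>M\<^esub> P y"
    and Psmult: "c \<in> carrier C \<Longrightarrow> x \<in> carrier M \<Longrightarrow> P (c \<odot>\<^bsub>M\<^esub> x) = c \<odot>\<^bsub>M\<^esub> P x"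
    and Pmult: "x \<in> carrier M \<Longrightarrow> y \<in> carrier M \<Longrightarrow>
        P x \<otimes>\<^bsub>M\<^esub> P y = P (x \<otimes>\<^bsub>M\<^esub> P y) \<oplus>\<^bsub>M\<^esub> P (y \<otimes>\<^bsub>M\<^esub> P x) \<oplus>\<^bsub>M\<^esub> lam \<odot>\<^bsub>M\<^esub> P (x \<otimes>\<^bsub>M\<^esub> y)" for x y c
    by (auto simp: baxter_operator_def linear_map_def)
  have img: "h ` carrier M = carrier N"
    and one: "\<one>\<^bsub>N\<^esub> = h \<one>\<^bsub>M\<^esub>" and zero: "\<zero>\<^bsub>N\<^esub> = h \<zero>\<^bsub>M\<^esub>"
    and mult: "x \<in> carrier M \<Longrightarrow> y \<in> carrier M \<Longrightarrow> h x \<otimes>\<^bsub>N\<^esub> h y = h (x \<otimes>\<^bsub>M\<^esub> y)"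
    and add: "x \<in> carrier M \<Longrightarrow> y \<in> carrier M \<Longrightarrow> h x \<oplus>\<^bsub>N\<^esub> h y = h (x \<oplus>\<^bsub>M\<^esub> y)"
    and smult: "c \<in> carrier C \<Longrightarrow> x \<in> carrier M \<Longrightarrow> c \<odot>\<^bsub>N\<^esub> h x = h (c \<odot>\<^bsub>M\<^esub> x)"
    and Q: "x \<in> carrier M \<Longrightarrow> Q (h x) = h (P x)" for x y c
    using h by (simp_all add: baxter_image_def)
  have all: "(\<forall>y\<in>carrier N. R y) \<longleftrightarrow> (\<forall>x\<in>carrier M. R (h x))" for R
    unfolding img[symmetric] by blast
  have memN: "x \<in> carrier M \<Longrightarrow> h x \<in> carrier N" for x using img by blast
  have addg: "abelian_group N"
  proof (rule abelian_groupI)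
    show "\<And>x y. x \<in> carrier N \<Longrightarrow> y \<in> carrier N \<Longrightarrow> x \<oplus>\<^bsub>N\<^esub> y \<in> carrier N"
      unfolding Ball_def[symmetric] img[symmetric] by (auto simp: add)
    show "\<zero>\<^bsub>N\<^esub> \<in> carrier N" by (simp add: zero memN)
    show "\<And>x y z. x \<in> carrier N \<Longrightarrow> y \<in> carrier N \<Longrightarrow> z \<in> carrier N \<Longrightarrow> x \<oplus>\<^bsub>N\<^esub> y \<oplus>\<^bsub>N\<^esub> z = x \<oplus>\<^bsub>N\<^esub> (y \<oplus>\<^bsub>N\<^esub> z)"
      unfolding img[symmetric] by (auto simp: add M.a_assoc)
    show "\<And>x y. x \<in> carrier N \<Longrightarrow> y \<in> carrier N \<Longrightarrow> x \<oplus>\<^bsub>N\<^esub> y = y \<oplus>\<^bsub>N\<^esub> x"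
      unfolding img[symmetric] by (auto simp: add M.a_comm)
    show "\<And>x. x \<in> carrier N \<Longrightarrow> \<zero>\<^bsub>N\<^esub> \<oplus>\<^bsub>N\<^esub> x = x"
      unfolding img[symmetric] by (auto simp: add zero)
    fix x assume "x \<in> carrier N"
    then obtain a where a: "a \<in> carrier M" "x = h a" unfolding img[symmetric] by blast
    then have "h (\<ominus>\<^bsub>M\<^esub> a) \<oplus>\<^bsub>N\<^esub> x = \<zero>\<^bsub>N\<^esub>" by (simp add: add zero M.l_neg)
    then show "\<exists>y\<in>carrier N. y \<oplus>\<^bsub>N\<^esub> x = \<zero>\<^bsub>N\<^esub>" using a memN by blast
  qed
  have comm: "comm_monoid N"
    by (rule comm_monoidI; unfold img[symmetric]) (auto simp: mult one M.m_ac)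
  have cring: "cring N"
    by (rule cringI[OF addg comm]; unfold img[symmetric]) (auto simp: mult add M.l_distr)
  have alg: "algebra C N"
    by (rule algebraI[OF M.R_cring cring]; unfold img[symmetric])
      (auto simp: mult add smult M.smult_l_distr M.smult_r_distr M.smult_assoc1 M.smult_assoc2)
  have lin: "linear_map C N N Q"
    unfolding linear_map_def Pi_iff all
    by (auto simp: add smult Q Padd Psmult Pc memN)
  show ?thesis
    unfolding baxter_algebra_def baxter_operator_def all
    using alg lin by (auto simp: add smult Q mult Pc Pmult lam)
qed

text \<open>Applied with \<open>h' = id\<close> to an inverse \<open>h\<close> of \<open>G\<close>, this makes \<open>G\<close> a homomorphism; applied to two such
  maps it carries homomorphisms between products over to the completions.\<close>

lemma baxter_hom_image:
  assumes F: "baxter_hom C lam M P M' P' F" and lam: "lam \<in> carrier C"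
    and h: "baxter_image C M P N Q h" and h': "baxter_image C M' P' N' Q' h'"
    and G: "\<And>x. x \<in> carrier M \<Longrightarrow> G (h x) = h' (F x)"
  shows "baxter_hom C lam N Q N' Q' G"
proof -
  have M: "baxter_algebra C lam M P" "baxter_algebra C lam M' P'"
    and Fh: "F \<in> algebra_hom C M M'" and FP: "\<And>x. x \<in> carrier M \<Longrightarrow> F (P x) = P' (F x)"
    using F by (auto simp: baxter_hom_def)
  interpret M: algebra C M using M by (simp add: baxter_algebra_def)
  have Fc: "x \<in> carrier M \<Longrightarrow> F x \<in> carrier M'" for x
    using Fh by (auto simp: algebra_hom_def ring_hom_def)
  have Pc: "x \<in> carrier M \<Longrightarrow> P x \<in> carrier M" for x
    using M(1) by (auto simp: baxter_algebra_def baxter_operator_def linear_map_def)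
  have img: "carrier N = h ` carrier M" and img': "carrier N' = h' ` carrier M'"
    using h h' by (simp_all add: baxter_image_def)
  note hs = h[unfolded baxter_image_def, THEN conjunct2]
    and hs' = h'[unfolded baxter_image_def, THEN conjunct2]
  have mult: "h x \<otimes>\<^bsub>N\<^esub> h y = h (x \<otimes>\<^bsub>M\<^esub> y)" and add: "h x \<oplus>\<^bsub>N\<^esub> h y = h (x \<oplus>\<^bsub>M\<^esub> y)"
    if "x \<in> carrier M" "y \<in> carrier M" for x y
    using hs that by simp_all
  have smult: "c \<odot>\<^bsub>N\<^esub> h x = h (c \<odot>\<^bsub>M\<^esub> x)" if "c \<in> carrier C" "x \<in> carrier M" for c x
    using hs that by simp
  have Q: "Q (h x) = h (P x)" if "x \<in> carrier M" for x using hs that by simp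
  have Fs: "F (x \<otimes>\<^bsub>M\<^esub> y) = F x \<otimes>\<^bsub>M'\<^esub> F y" "F (x \<oplus>\<^bsub>M\<^esub> y) = F x \<oplus>\<^bsub>M'\<^esub> F y"
    if "x \<in> carrier M" "y \<in> carrier M" for x y
    using Fh that by (auto simp: algebra_hom_def ring_hom_def)
  have F1: "F \<one>\<^bsub>M\<^esub> = \<one>\<^bsub>M'\<^esub>" using Fh by (auto simp: algebra_hom_def ring_hom_def)
  have Fsm: "F (c \<odot>\<^bsub>M\<^esub> x) = c \<odot>\<^bsub>M'\<^esub> F x" if "c \<in> carrier C" "x \<in> carrier M" for c x
    using Fh that by (auto simp: algebra_hom_def linear_map_def)
  have G1: "G \<one>\<^bsub>N\<^esub> = \<one>\<^bsub>N'\<^esub>"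
    using G[of "\<one>\<^bsub>M\<^esub>"] hs hs' by (simp add: F1)
  have "G \<in> ring_hom N N'"
    by (rule ring_hom_memI) (auto simp: img img' G Fc mult add Fs hs' G1)
  moreover have "linear_map C N N' G"
    unfolding linear_map_def by (auto simp: img img' G Fc add smult Fs Fsm hs')
  moreover have "\<forall>x\<in>carrier N. G (Q x) = Q' (G x)"
    by (auto simp: img Q G Pc FP hs' Fc)
  ultimately show ?thesis
    unfolding baxter_hom_def algebra_hom_def
    using baxter_algebra_image[OF M(1) lam h] baxter_algebra_image[OF M(2) lam h'] by blast
qed

lemma baxter_image_id: "baxter_image C M P M P (\<lambda>x. x)"
  by (simp add: baxter_image_def)

lemma baxter_hom_id:
  assumes "baxter_algebra C lam M P"
  shows "baxter_hom C lam M P M P (\<lambda>x. x)"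
  using assms by (auto simp: baxter_hom_def algebra_hom_def linear_map_def intro!: ring_hom_memI)

context shuffle_algebra
begin

lemma Sh_prod_op_fun: "Sh_prod_op C A = op"
  by (rule ext) (rule Sh_prod_op_eq)

lemma baxter_image_cosets_of:
  "baxter_image C (Sh_prod C lam A) op (Sh_hat C lam A) (Sh_hat_op C lam A) cosets_of"
  unfolding baxter_image_def
  by (simp add: Sh_hat_carrier cosets_of_one cosets_of_zero cosets_of_mult cosets_of_add
      cosets_of_smult cosets_of_op)

lemma baxter_iso_psi:
  "baxter_iso C lam (Sh_hat C lam A) (Sh_hat_op C lam A) (Sh_prod C lam A) op psi"
proof -
  have "baxter_hom C lam (Sh_hat C lam A) (Sh_hat_op C lam A) (Sh_prod C lam A) op psi"
    by (rule baxter_hom_image[OF baxter_hom_id[OF baxter_Sh_prod] lam_closed baxter_image_cosets_of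
          baxter_image_id]) (rule psi_cosets_of)
  moreover have "bij_betw psi (carrier (Sh_hat C lam A)) families"
    by (rule bij_betw_byWitness[where f' = cosets_of]) (auto simp: Sh_hat_carrier psi_cosets_of)
  ultimately show ?thesis by (simp add: baxter_iso_def)
qed

end

section \<open>Functoriality\<close>

definition map_frag :: "('a \<Rightarrow> 'b) \<Rightarrow> ('a list \<Rightarrow>\<^sub>0 int) \<Rightarrow> ('b list \<Rightarrow>\<^sub>0 int)" where
  "map_frag f = frag_extend (\<lambda>w. frag_of (map f w))"

lemma map_frag_diff: "map_frag f (u - v) = map_frag f u - map_frag f v"
  by (simp add: map_frag_def frag_extend_diff)

lemmas map_frag_additive = additive_map[of "map_frag _", OF map_frag_diff]

lemma map_frag_of [simp]: "map_frag f (frag_of w) = frag_of (map f w)"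
  by (simp add: map_frag_def)

lemma degree_part_map_frag: "degree_part k (map_frag f u) = map_frag f (degree_part k u)"
  using subset_UNIV[of "Poly_Mapping.keys u"]
  by (induction u rule: frag_induction)
    (simp_all add: map_frag_additive map_frag_diff degree_part_additive degree_part_diff degree_part_of)

locale shuffle_algebra_hom = A: shuffle_algebra C A lam + B: shuffle_algebra C B lam
  for C :: "('c,'k) ring_scheme" and A :: "('c,'a,'m) module_scheme"
    and B :: "('c,'b,'n) module_scheme" and lam :: 'c +
  fixes f :: "'a \<Rightarrow> 'b"
  assumes f: "f \<in> algebra_hom C A B"
begin

lemma f_closed [simp]: "a \<in> carrier A \<Longrightarrow> f a \<in> carrier B"
  and f_mult: "a \<in> carrier A \<Longrightarrow> b \<in> carrier A \<Longrightarrow> f (a \<otimes>\<^bsub>A\<^esub> b) = f a \<otimes>\<^bsub>B\<^esub> f b"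
  and f_add: "a \<in> carrier A \<Longrightarrow> b \<in> carrier A \<Longrightarrow> f (a \<oplus>\<^bsub>A\<^esub> b) = f a \<oplus>\<^bsub>B\<^esub> f b"
  and f_one: "f \<one>\<^bsub>A\<^esub> = \<one>\<^bsub>B\<^esub>"
  and f_smult: "c \<in> carrier C \<Longrightarrow> a \<in> carrier A \<Longrightarrow> f (c \<odot>\<^bsub>A\<^esub> a) = c \<odot>\<^bsub>B\<^esub> f a"
  using f by (auto simp: algebra_hom_def ring_hom_def linear_map_def)

lemma map_keys:
  assumes "Poly_Mapping.keys u \<subseteq> words_ge A m"
  shows "Poly_Mapping.keys (map_frag f u) \<subseteq> words_ge B m"
  using assms
proof (induction u rule: frag_induction)
  case (one w)
  then show ?case by (auto simp: words_ge_def)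
qed (simp_all add: map_frag_additive map_frag_diff A.keys_diff_subset)

lemma qshuffle_map:
  assumes "set xs \<subseteq> carrier A" "set ys \<subseteq> carrier A"
  shows "qshuffle B (map f xs) (map f ys) F = qshuffle A xs ys (\<lambda>e w. F e (map f w))"
  using assms
proof (induction "length xs + length ys" arbitrary: xs ys F rule: less_induct)
  case less
  show ?case
  proof (cases "xs = [] \<or> ys = []")
    case True
    then show ?thesis by auto
  next
    case False
    then obtain x p y q where "xs = x # p" "ys = y # q" by (meson neq_Nil_conv)
    then show ?thesis
      using less.prems less.hyps[of p "y # q"] less.hyps[of "x # p" q] less.hyps[of p q]
      by (simp add: f_mult)
  qed
qed

lemma map_mul:
  assumes "Poly_Mapping.keys u \<subseteq> words_ge A 0" "Poly_Mapping.keys v \<subseteq> words_ge A 0"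
  shows "map_frag f (shuffle_frag C lam A u v) = shuffle_frag C lam B (map_frag f u) (map_frag f v)"
  using assms
proof (induction u v rule: A.bilinear_words_induct)
  case (words a p b q)
  have "map_frag f (qshuffle A p q F) = qshuffle A p q (\<lambda>e w. map_frag f (F e w))" for F
    by (rule qshuffle_hom) (simp_all add: map_frag_additive)
  then show ?case using words
    by (simp add: A.mul_words B.mul_words qshuffle_map f_mult f_smult)
qed (simp_all add: shuffle_frag_additive_left shuffle_frag_diff_left shuffle_frag_additive_right
   shuffle_frag_diff_right map_frag_additive map_frag_diff)

lemma map_scale:
  assumes "c \<in> carrier C" "Poly_Mapping.keys u \<subseteq> words_ge A 0"
  shows "map_frag f (scale_frag A c u) = scale_frag B c (map_frag f u)"
  using assms(2)
proof (induction u rule: frag_induction)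
  case (one w)
  then show ?case using assms(1) by (elim A.words_ge_cases) (simp add: f_smult)
qed (simp_all add: map_frag_additive map_frag_diff scale_frag_additive scale_frag_diff)

lemma map_prefix: "map_frag f (prefix_frag A u) = prefix_frag B (map_frag f u)"
  using subset_UNIV[of "Poly_Mapping.keys u"]
  by (induction u rule: frag_induction)
    (simp_all add: map_frag_additive map_frag_diff prefix_frag_additive prefix_frag_diff f_one)

text \<open>A map applied letter by letter descends to tensor powers because \<open>f\<close> is additive and \<open>C\<close>-linear.\<close>

lemma map_relators:
  assumes "r \<in> tensor_relators C A k"
  shows "map_frag f r \<in> tensor_relators C B k"
proof -
  have w: "map f w \<in> words B k" if "w \<in> words A k" for w using that by (auto simp: words_def)
  from assms consider
    w i a b where "w \<in> words A k" "i \<le> k" "a \<in> carrier A" "b \<in> carrier A"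
      "r = frag_of (w[i := a \<oplus>\<^bsub>A\<^esub> b]) - frag_of (w[i := a]) - frag_of (w[i := b])"
  | w i j c where "w \<in> words A k" "i \<le> k" "j \<le> k" "c \<in> carrier C"
      "r = frag_of (w[i := c \<odot>\<^bsub>A\<^esub> (w ! i)]) - frag_of (w[j := c \<odot>\<^bsub>A\<^esub> (w ! j)])"
    unfolding tensor_relators_def by blast
  then show ?thesis
  proof cases
    case 1
    then show ?thesis
      using B.relator_additive[OF w[OF 1(1)] 1(2), of "f a" "f b"]
      by (simp add: map_frag_diff map_update f_add)
  next
    case 2
    have "length w = Suc k" "w ! i \<in> carrier A" "w ! j \<in> carrier A"
      using 2 by (auto simp: words_def)
    then show ?thesis
      using B.relator_scalar[OF w[OF 2(1)] 2(2,3,4)] 2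
      by (simp add: map_frag_diff map_update f_smult)
  qed
qed

lemma map_tensor_rel:
  assumes "r \<in> tensor_rel C A k"
  shows "map_frag f r \<in> tensor_rel C B k"
  using assms
proof (induction rule: A.tensor_rel_induct)
  case (relator r)
  then show ?case unfolding tensor_rel_def by (intro generate.incl map_relators)
qed (simp_all add: map_frag_additive map_frag_diff B.tensor_rel_zero B.tensor_rel_diff)

lemma tensor_map_cls: "tensor_map C B f k (A.cls k u) = B.cls k (map_frag f u)"
  unfolding tensor_map_def map_frag_def[symmetric]
proof (rule UN_constant_value)
  show "A.cls k u \<noteq> {}" using A.cls_self by blast
qed (auto simp: A.cls_mem B.cls_eq_iff map_frag_diff[symmetric] map_tensor_rel)

abbreviation F where "F \<equiv> Sh_prod_map C B f"

lemma rep_map: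
  assumes "A.rep n u x"
  shows "B.rep n (map_frag f u) (F x)"
  using assms by (simp add: A.rep_def B.rep_def map_keys Sh_prod_map_def tensor_map_cls degree_part_map_frag)

lemma map_family: "Poly_Mapping.keys u \<subseteq> words_ge A 0 \<Longrightarrow> F (A.family u) = B.family (map_frag f u)"
  by (intro B.rep_all_family rep_map A.rep_family)

text \<open>As for the axioms, it suffices to compare representatives up to each degree; there the map is
  \<^const>\<open>map_frag\<close>, which commutes with all operations on formal sums.\<close>

lemma baxter_hom_represented:
  assumes M: "A.represented M" and M': "B.represented M'"
    and closed: "\<And>x. x \<in> carrier M \<Longrightarrow> F x \<in> carrier M'"
  shows "baxter_hom C lam M A.op M' B.op F"
proof -
  have fam: "x \<in> carrier M \<Longrightarrow> x \<in> A.families"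
    and mult: "x \<in> carrier M \<Longrightarrow> y \<in> carrier M \<Longrightarrow> A.rep n u x \<Longrightarrow> A.rep n v y \<Longrightarrow>
        A.rep n (A.mul u v) (x \<otimes>\<^bsub>M\<^esub> y)"
    and add: "x \<in> carrier M \<Longrightarrow> y \<in> carrier M \<Longrightarrow> A.rep n u x \<Longrightarrow> A.rep n v y \<Longrightarrow>
        A.rep n (u + v) (x \<oplus>\<^bsub>M\<^esub> y)"
    and one: "A.rep n (frag_of [\<one>\<^bsub>A\<^esub>]) \<one>\<^bsub>M\<^esub>"
    and smult: "c \<in> carrier C \<Longrightarrow> x \<in> carrier M \<Longrightarrow> A.rep n u x \<Longrightarrow>
        A.rep n (scale_frag A c u) (c \<odot>\<^bsub>M\<^esub> x)" for x y n u v c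
    using M unfolding A.represented_def by blast+
  have mult': "x \<in> carrier M' \<Longrightarrow> y \<in> carrier M' \<Longrightarrow> B.rep n u x \<Longrightarrow> B.rep n v y \<Longrightarrow>
        B.rep n (B.mul u v) (x \<otimes>\<^bsub>M'\<^esub> y)"
    and add': "x \<in> carrier M' \<Longrightarrow> y \<in> carrier M' \<Longrightarrow> B.rep n u x \<Longrightarrow> B.rep n v y \<Longrightarrow>
        B.rep n (u + v) (x \<oplus>\<^bsub>M'\<^esub> y)"
    and one': "B.rep n (frag_of [\<one>\<^bsub>B\<^esub>]) \<one>\<^bsub>M'\<^esub>"
    and smult': "c \<in> carrier C \<Longrightarrow> x \<in> carrier M' \<Longrightarrow> B.rep n u x \<Longrightarrow>
        B.rep n (scale_frag B c u) (c \<odot>\<^bsub>M'\<^esub> x)" for x y n u v c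
    using M' unfolding B.represented_def by blast+
  have ex: "\<exists>u. A.rep n u x" if "x \<in> carrier M" for n x
    using A.rep_exists[OF fam[OF that]] by blast
  have ext: "x = y" if "\<And>n. \<exists>u. B.rep n u x \<and> B.rep n u y" for x y
    using that by (intro B.rep_ext) (metis B.N_zero cancel_comm_monoid_add_class.diff_cancel)
  have Fmult: "F (x \<otimes>\<^bsub>M\<^esub> y) = F x \<otimes>\<^bsub>M'\<^esub> F y" and Fadd: "F (x \<oplus>\<^bsub>M\<^esub> y) = F x \<oplus>\<^bsub>M'\<^esub> F y"
    if xy: "x \<in> carrier M" "y \<in> carrier M" for x y
  proof -
    show "F (x \<otimes>\<^bsub>M\<^esub> y) = F x \<otimes>\<^bsub>M'\<^esub> F y"
    proof (rule ext)
      fix n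
      obtain u v where r: "A.rep n u x" "A.rep n v y" using ex xy by meson
      have "B.rep n (map_frag f (A.mul u v)) (F (x \<otimes>\<^bsub>M\<^esub> y))"
        by (rule rep_map[OF mult[OF xy r]])
      moreover have "B.rep n (B.mul (map_frag f u) (map_frag f v)) (F x \<otimes>\<^bsub>M'\<^esub> F y)"
        by (rule mult'[OF closed[OF xy(1)] closed[OF xy(2)] r[THEN rep_map]])
      ultimately show "\<exists>u. B.rep n u (F (x \<otimes>\<^bsub>M\<^esub> y)) \<and> B.rep n u (F x \<otimes>\<^bsub>M'\<^esub> F y)"
        using map_mul[OF r[THEN A.rep_keys]] by auto
    qed
    show "F (x \<oplus>\<^bsub>M\<^esub> y) = F x \<oplus>\<^bsub>M'\<^esub> F y"
    proof (rule ext)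
      fix n
      obtain u v where r: "A.rep n u x" "A.rep n v y" using ex xy by meson
      have "B.rep n (map_frag f (u + v)) (F (x \<oplus>\<^bsub>M\<^esub> y))"
        by (rule rep_map[OF add[OF xy r]])
      moreover have "B.rep n (map_frag f u + map_frag f v) (F x \<oplus>\<^bsub>M'\<^esub> F y)"
        by (rule add'[OF closed[OF xy(1)] closed[OF xy(2)] r[THEN rep_map]])
      ultimately show "\<exists>u. B.rep n u (F (x \<oplus>\<^bsub>M\<^esub> y)) \<and> B.rep n u (F x \<oplus>\<^bsub>M'\<^esub> F y)"
        by (auto simp: map_frag_additive)
    qed
  qed
  have Fone: "F \<one>\<^bsub>M\<^esub> = \<one>\<^bsub>M'\<^esub>"
  proof (rule ext)
    fix n
    show "\<exists>u. B.rep n u (F \<one>\<^bsub>M\<^esub>) \<and> B.rep n u \<one>\<^bsub>M'\<^esub>"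
      using rep_map[OF one] one'[of n] by (auto simp: f_one)
  qed
  have Fsmult: "F (c \<odot>\<^bsub>M\<^esub> x) = c \<odot>\<^bsub>M'\<^esub> F x" if c: "c \<in> carrier C" and x: "x \<in> carrier M" for c x
  proof (rule ext)
    fix n
    obtain u where r: "A.rep n u x" using ex x by meson
    have "B.rep n (map_frag f (scale_frag A c u)) (F (c \<odot>\<^bsub>M\<^esub> x))"
      by (rule rep_map[OF smult[OF c x r]])
    moreover have "B.rep n (scale_frag B c (map_frag f u)) (c \<odot>\<^bsub>M'\<^esub> F x)"
      by (rule smult'[OF c closed[OF x] rep_map[OF r]])
    ultimately show "\<exists>u. B.rep n u (F (c \<odot>\<^bsub>M\<^esub> x)) \<and> B.rep n u (c \<odot>\<^bsub>M'\<^esub> F x)"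
      using map_scale[OF c A.rep_keys[OF r]] by auto
  qed
  have Fop: "F (A.op x) = B.op (F x)" if x: "x \<in> carrier M" for x
  proof (rule ext)
    fix n
    obtain u where r: "A.rep n u x" using ex x by meson
    have "B.rep (Suc n) (map_frag f (prefix_frag A u)) (F (A.op x))"
      by (rule rep_map[OF A.rep_op[OF r]])
    moreover have "B.rep (Suc n) (prefix_frag B (map_frag f u)) (B.op (F x))"
      by (rule B.rep_op[OF rep_map[OF r]])
    ultimately have "B.rep (Suc n) (prefix_frag B (map_frag f u)) (F (A.op x))"
      "B.rep (Suc n) (prefix_frag B (map_frag f u)) (B.op (F x))"
      by (simp_all add: map_prefix)
    then show "\<exists>u. B.rep n u (F (A.op x)) \<and> B.rep n u (B.op (F x))"
      by (meson B.rep_mono le_SucI order_refl)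
  qed
  have "F \<in> ring_hom M M'"
    by (rule ring_hom_memI) (auto simp: closed Fmult Fadd Fone)
  moreover have "linear_map C M M' F"
    by (auto simp: linear_map_def closed Fadd Fsmult)
  ultimately show ?thesis
    unfolding baxter_hom_def algebra_hom_def
    using A.represented_baxter_algebra[OF M] B.represented_baxter_algebra[OF M'] Fop by blast
qed

lemma map_Sh: "x \<in> carrier A.ShA \<Longrightarrow> F x \<in> carrier B.ShA"
  by (auto simp: A.Sh_carrier map_family intro!: B.family_Sh map_keys)

lemma map_families:
  assumes "x \<in> A.families"
  shows "F x \<in> B.families"
  unfolding B.families_iff
proof
  fix k
  obtain u where "A.rep k u x" using A.rep_exists[OF assms] by blast
  then have "B.rep k (map_frag f u) (F x)" by (rule rep_map)
  then show "F x k \<in> carrier (Sh_comp C B k)"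
    by (auto simp: B.rep_def B.Sh_comp_carrier B.degree_part_keys)
qed

lemma baxter_hom_Sh: "baxter_hom C lam A.ShA A.op B.ShA B.op F"
  by (rule baxter_hom_represented[OF A.represented_Sh B.represented_Sh map_Sh])

lemma baxter_hom_Sh_prod: "baxter_hom C lam (Sh_prod C lam A) A.op (Sh_prod C lam B) B.op F"
  by (rule baxter_hom_represented[OF A.represented_Sh_prod B.represented_Sh_prod map_families])

text \<open>By \<open>family_word_Cons\<close> and induction on words the values on pure tensors are determined by those
  on \<open>A\<close>.\<close>

lemma baxter_hom_unique:
  assumes G: "baxter_hom C lam A.ShA A.op B.ShA B.op G"
    and incl: "\<And>a. a \<in> carrier A \<Longrightarrow> G (Sh_incl C A a) = Sh_incl C B (f a)"
    and x: "x \<in> carrier A.ShA"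
  shows "G x = F x"
proof -
  interpret SA: cring A.ShA by (rule A.cring_Sh)
  interpret SB: cring B.ShA by (rule B.cring_Sh)
  have Gh: "G \<in> ring_hom A.ShA B.ShA" and Gop: "\<And>x. x \<in> carrier A.ShA \<Longrightarrow> G (A.op x) = B.op (G x)"
    using G by (auto simp: baxter_hom_def algebra_hom_def)
  interpret G: ring_hom_cring A.ShA B.ShA G
    using A.cring_Sh B.cring_Sh Gh by (simp add: ring_hom_cring_def ring_hom_cring_axioms_def)
  have word: "G (A.family (frag_of w)) = B.family (frag_of (map f w))" if "w \<in> words_ge A 0" for w
    using that
  proof (induction w)
    case Nil
    then show ?case by (simp add: words_ge_def)
  next
    case (Cons a w)
    then have a: "a \<in> carrier A" "set w \<subseteq> carrier A" by (auto simp: words_ge_def)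
    show ?case
    proof (cases "w = []")
      case True
      then show ?thesis using a incl by (simp add: A.family_letter B.family_letter)
    next
      case False
      then have w: "w \<in> words_ge A 0" using a by (cases w) (auto simp: words_ge_def)
      have c: "Sh_incl C A a \<in> carrier A.ShA"
        using A.family_Sh[of "frag_of [a]"] a by (simp add: A.family_letter words_ge_def)
      have c': "A.family (frag_of w) \<in> carrier A.ShA" using w by (intro A.family_Sh) simp
      have fw: "set (map f w) \<subseteq> carrier B" "map f w \<noteq> []" using a False by auto
      have "G (A.family (frag_of (a # w))) =
          G (Sh_incl C A a) \<otimes>\<^bsub>B.ShA\<^esub> G (A.op (A.family (frag_of w)))"
        unfolding A.family_word_Cons[OF a False] using c A.Sh_closed(6)[OF c'] by (rule G.hom_mult)
      also have "\<dots> = B.family (frag_of (f a # map f w))"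
        using Cons.IH[OF w] c' a B.family_word_Cons[OF _ fw, of "f a"] by (simp add: incl Gop)
      finally show ?thesis by simp
    qed
  qed
  obtain u where u: "Poly_Mapping.keys u \<subseteq> words_ge A 0" "x = A.family u"
    using x by (auto simp: A.Sh_carrier)
  have "Poly_Mapping.keys u \<subseteq> words_ge A 0 \<and> G (A.family u) = B.family (map_frag f u)"
    using u(1)
  proof (induction u rule: frag_induction)
    case zero
    then show ?case by (simp add: A.family_zero B.family_zero map_frag_additive)
  next
    case (diff u v)
    then show ?case
      using A.family_diff[of u v] B.family_diff[OF map_keys map_keys, of u v] A.keys_diff_subset[of u "words_ge A 0" v]
      by (simp add: map_frag_diff a_minus_def A.family_Sh)
  qed (simp add: word)
  then show ?thesis using u map_family by simp
qed

lemma Sh_map_eq: "Sh_map C lam A B f = restrict F (carrier A.ShA)"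
  unfolding Sh_map_def
proof (rule the_equality)
  have cong: "baxter_hom C lam A.ShA A.op B.ShA B.op (restrict F (carrier A.ShA))"
    by (rule baxter_hom_image[OF baxter_hom_Sh A.lam_closed baxter_image_id baxter_image_id]) simp
  have incl: "F (Sh_incl C A a) = Sh_incl C B (f a)" and inclc: "Sh_incl C A a \<in> carrier A.ShA"
    if "a \<in> carrier A" for a
  proof -
    have k: "Poly_Mapping.keys (frag_of [a]) \<subseteq> words_ge A 0" using that by (simp add: words_ge_def)
    show "F (Sh_incl C A a) = Sh_incl C B (f a)"
      using map_family[OF k] that by (simp add: A.family_letter B.family_letter)
    show "Sh_incl C A a \<in> carrier A.ShA"
      using A.family_Sh[OF k] that by (simp add: A.family_letter)
  qed
  show "restrict F (carrier A.ShA) \<in> extensional (carrier A.ShA) \<and>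
      baxter_hom C lam A.ShA A.op B.ShA B.op (restrict F (carrier A.ShA)) \<and>
      (\<forall>a\<in>carrier A. restrict F (carrier A.ShA) (Sh_incl C A a) = Sh_incl C B (f a))"
    using cong incl inclc by simp
  fix G assume "G \<in> extensional (carrier A.ShA) \<and>
      baxter_hom C lam A.ShA A.op B.ShA B.op G \<and> (\<forall>a\<in>carrier A. G (Sh_incl C A a) = Sh_incl C B (f a))"
  then have ext: "G \<in> extensional (carrier A.ShA)"
    and hom: "baxter_hom C lam A.ShA A.op B.ShA B.op G"
    and G_incl: "\<And>a. a \<in> carrier A \<Longrightarrow> G (Sh_incl C A a) = Sh_incl C B (f a)" by blast+
  show "G = restrict F (carrier A.ShA)"
  proof (rule extensionalityI[OF ext restrict_extensional])
    show "G x = restrict F (carrier A.ShA) x" if "x \<in> carrier A.ShA" for x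
      using baxter_hom_unique[OF hom G_incl that] that by simp
  qed
qed

lemma Sh_hat_map_cosets_of:
  assumes "x \<in> A.families"
  shows "Sh_hat_map C lam A B f (A.cosets_of x) = B.cosets_of (F x)"
proof
  fix n
  have "Sh_hat_map C lam A B f (A.cosets_of x) n =
      (\<Union>r\<in>A.nbhd n x. Fil B.ShA B.op n +>\<^bsub>B.ShA\<^esub> Sh_map C lam A B f r)"
    by (simp add: Sh_hat_map_def completion_map_def A.cosets_of_def)
  also have "\<dots> = B.nbhd n (F x)"
  proof (rule B.UN_cosets)
    show "A.nbhd n x \<noteq> {}" using A.truncate_nbhd[OF assms] by blast
    show "Sh_map C lam A B f r \<in> carrier B.ShA" if "r \<in> A.nbhd n x" for r
      using that by (simp add: Sh_map_eq A.nbhd_def map_Sh)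
    show "Sh_map C lam A B f r k = F x k" if "r \<in> A.nbhd n x" "k < n" for r k
      using that by (simp add: Sh_map_eq A.nbhd_def Sh_prod_map_def)
  qed
  finally show "Sh_hat_map C lam A B f (A.cosets_of x) n = B.cosets_of (F x) n"
    by (simp add: B.cosets_of_def)
qed

lemma baxter_hom_Sh_hat:
  "baxter_hom C lam (Sh_hat C lam A) (Sh_hat_op C lam A)
     (Sh_hat C lam B) (Sh_hat_op C lam B) (Sh_hat_map C lam A B f)"
  by (rule baxter_hom_image[OF baxter_hom_Sh_prod A.lam_closed A.baxter_image_cosets_of
        B.baxter_image_cosets_of]) (rule Sh_hat_map_cosets_of)

lemma psi_natural:
  assumes "X \<in> carrier (Sh_hat C lam A)"
  shows "F (psi X) = psi (Sh_hat_map C lam A B f X)"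
proof -
  obtain x where "x \<in> A.families" "X = A.cosets_of x"
    using assms by (auto simp: A.Sh_hat_carrier)
  then show ?thesis by (simp add: A.psi_cosets_of Sh_hat_map_cosets_of B.psi_cosets_of map_families)
qed

end

theorem theorem3p6:
  fixes C :: "('c,'k) ring_scheme" and lam :: 'c and A :: "('c,'a,'m) module_scheme"
  assumes "cring C" and "lam \<in> carrier C" and "algebra C A"
  shows
    "(baxter_algebra C lam (Sh_prod C lam A) (Sh_prod_op C A) \<and>
      baxter_iso C lam (Sh_hat C lam A) (Sh_hat_op C lam A) (Sh_prod C lam A) (Sh_prod_op C A) psi) \<and>
     (\<forall>(B :: ('c,'b,'n) module_scheme) f.
        algebra C B \<and> f \<in> algebra_hom C A B \<longrightarrow>
          baxter_hom C lam (Sh_hat C lam A) (Sh_hat_op C lam A)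
            (Sh_hat C lam B) (Sh_hat_op C lam B) (Sh_hat_map C lam A B f) \<and>
          baxter_hom C lam (Sh_prod C lam A) (Sh_prod_op C A)
            (Sh_prod C lam B) (Sh_prod_op C B) (Sh_prod_map C B f) \<and>
          (\<forall>X\<in>carrier (Sh_hat C lam A).
             Sh_prod_map C B f (psi X) = psi (Sh_hat_map C lam A B f X)))"
proof (intro conjI allI impI ballI)
  interpret A: shuffle_algebra C A lam
    using assms by (intro shuffle_algebra.intro shuffle_algebra_axioms.intro)
  show "baxter_algebra C lam (Sh_prod C lam A) (Sh_prod_op C A)"
    using A.baxter_Sh_prod by (simp add: A.Sh_prod_op_fun)
  show "baxter_iso C lam (Sh_hat C lam A) (Sh_hat_op C lam A) (Sh_prod C lam A) (Sh_prod_op C A) psi"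
    using A.baxter_iso_psi by (simp add: A.Sh_prod_op_fun)
  fix B :: "('c,'b,'n) module_scheme" and f
  assume B: "algebra C B \<and> f \<in> algebra_hom C A B"
  interpret AB: shuffle_algebra_hom C A B lam f
    using assms B
    by (intro shuffle_algebra_hom.intro shuffle_algebra_hom_axioms.intro
        shuffle_algebra.intro shuffle_algebra_axioms.intro) auto
  show "baxter_hom C lam (Sh_hat C lam A) (Sh_hat_op C lam A)
      (Sh_hat C lam B) (Sh_hat_op C lam B) (Sh_hat_map C lam A B f)"
    by (rule AB.baxter_hom_Sh_hat)
  show "baxter_hom C lam (Sh_prod C lam A) (Sh_prod_op C A)
      (Sh_prod C lam B) (Sh_prod_op C B) (Sh_prod_map C B f)"
    using AB.baxter_hom_Sh_prod by (simp add: A.Sh_prod_op_fun AB.B.Sh_prod_op_fun)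
  fix X assume "X \<in> carrier (Sh_hat C lam A)"
  then show "Sh_prod_map C B f (psi X) = psi (Sh_hat_map C lam A B f X)"
    by (rule AB.psi_natural)
qed

end
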